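(* Let $B\subset\mathbb{R}^2$ be a ball centered at the origin, and let $\theta,q$ satisfy $0<2\theta<1$ and $2(1-\theta)\le q<2$. Then for all $p$ sufficiently large, $\lambda^{\theta,p}(B)<\lambda^{\theta,p}_{as}(B)$. Therefore, for $p$ sufficiently large, the minimizers for $\lambda^{\theta,p}(B)$ are not anti-symmetric, i.e. they do not belong to $W^{1,q}_{as}(B)$.
   Context: For $v\in W^{1,q}(B)$ let $\mathcal{F}(v)=\int_B\frac{|\nabla v|^2}{(1+|v|)^{2\theta}}\,dx$. Let $$W^{1,q}_{as}(B)=\{v\in W^{1,q}(B):\ v(x_1,-x_2)=-v(x_1,x_2)\}$$ be the space of functions anti-symmetric with respect to the line $\{x_2=0\}$. For $1<p<+\infty$ define $$\lambda^{\theta,p}(B)=\inf\left\{\mathcal{F}(v):\ v\in W^{1,q}(B),\ v\ne0,\ \int_B v\,dx=0,\ \|v\|_{L^p(B)}=1\right\},$$ $$\lambda^{\theta,p}_{as}(B)=\inf\left\{\mathcal{F}(v):\ v\in W^{1,q}_{as}(B),\ v\ne0,\ \int_B v\,dx=0,\ \|v\|_{L^p(B)}=1\right\}.$$ A minimizer for $\lambda^{\theta,p}(B)$ is an admissible function at which the first infimum is attained. *)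

theory Defs
  imports "HOL-Analysis.Analysis"
begin

primrec C_k :: "nat \<Rightarrow> ('a::euclidean_space \<Rightarrow> real) \<Rightarrow> bool" where
  "C_k 0 f \<longleftrightarrow> continuous_on UNIV f"
| "C_k (Suc k) f \<longleftrightarrow> (\<forall>x. f differentiable (at x)) \<and>
     (\<forall>b\<in>Basis. C_k k (\<lambda>x. frechet_derivative f (at x) b))"

definition test_functions :: "'a::euclidean_space set \<Rightarrow> ('a \<Rightarrow> real) set" where
  "test_functions S = {\<phi>. (\<forall>k. C_k k \<phi>) \<and>
     compact (closure {x. \<phi> x \<noteq> 0}) \<and> closure {x. \<phi> x \<noteq> 0} \<subseteq> S}"

text \<open>Elements of Lebesgue and Sobolev spaces are represented by functions on the whole space;
  only their values almost everywhere on \<open>S\<close> matter.\<close>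

definition Lp_on :: "real \<Rightarrow> 'a::euclidean_space set \<Rightarrow> ('a \<Rightarrow> 'b::euclidean_space) set" where
  "Lp_on p S = {f. f \<in> borel_measurable (lebesgue_on S) \<and>
     integrable (lebesgue_on S) (\<lambda>x. norm (f x) powr p)}"

definition Lp_norm_on :: "real \<Rightarrow> 'a::euclidean_space set \<Rightarrow> ('a \<Rightarrow> 'b::euclidean_space) \<Rightarrow> real" where
  "Lp_norm_on p S f = (LINT x|lebesgue_on S. norm (f x) powr p) powr (1 / p)"

text \<open>Local integrability is required explicitly because the Bochner integral of a
  non-integrable function is \<open>0\<close>, so that the integral identity alone would not determine
  \<open>g\<close> almost everywhere on an open set \<open>S\<close>.\<close>

definition has_weak_gradient_on ::
    "('a::euclidean_space \<Rightarrow> real) \<Rightarrow> ('a \<Rightarrow> 'a) \<Rightarrow> 'a set \<Rightarrow> bool" where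
  "has_weak_gradient_on v g S \<longleftrightarrow>
     (\<forall>K. compact K \<and> K \<subseteq> S \<longrightarrow> v absolutely_integrable_on K \<and> g absolutely_integrable_on K) \<and>
     (\<forall>\<phi>\<in>test_functions S. \<forall>b\<in>Basis.
        (LINT x|lebesgue_on S. v x * frechet_derivative \<phi> (at x) b) =
        - (LINT x|lebesgue_on S. (g x \<bullet> b) * \<phi> x))"

definition weak_gradient :: "'a::euclidean_space set \<Rightarrow> ('a \<Rightarrow> real) \<Rightarrow> 'a \<Rightarrow> 'a" where
  "weak_gradient S v = (SOME g. has_weak_gradient_on v g S)"

definition W1 :: "real \<Rightarrow> 'a::euclidean_space set \<Rightarrow> ('a \<Rightarrow> real) set" where
  "W1 q S = {v \<in> Lp_on q S. \<exists>g \<in> Lp_on q S. has_weak_gradient_on v g S}"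

definition W1_as :: "real \<Rightarrow> (real^2) set \<Rightarrow> (real^2 \<Rightarrow> real) set" where
  "W1_as q B = {v \<in> W1 q B. AE x in lebesgue_on B. v (vector [x $ 1, - (x $ 2)]) = - v x}"

text \<open>The energy is extended-valued: for \<open>v\<close> in \<open>W1 q B\<close> with \<open>q < 2\<close> it may be infinite.\<close>

definition energy :: "real \<Rightarrow> 'a::euclidean_space set \<Rightarrow> ('a \<Rightarrow> real) \<Rightarrow> ennreal" where
  "energy \<theta> B v =
     (\<integral>\<^sup>+x. ennreal ((norm (weak_gradient B v x))\<^sup>2 / (1 + \<bar>v x\<bar>) powr (2 * \<theta>)) \<partial>lebesgue_on B)"

text \<open>A function of \<open>W1 q B\<close> need not have finite \<open>L\<^sup>p\<close> norm when \<open>p\<close> is large, and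
  \<^const>\<open>Lp_norm_on\<close> is meaningful only on \<^const>\<open>Lp_on\<close>; hence the membership in \<open>Lp_on p B\<close>
  that \<open>\<parallel>v\<parallel> = 1\<close> tacitly includes.\<close>

definition normalized :: "real \<Rightarrow> 'a::euclidean_space set \<Rightarrow> ('a \<Rightarrow> real) set" where
  "normalized p B = {v. \<not> (AE x in lebesgue_on B. v x = 0) \<and>
     (LINT x|lebesgue_on B. v x) = 0 \<and> v \<in> Lp_on p B \<and> Lp_norm_on p B v = 1}"

definition lambda :: "real \<Rightarrow> real \<Rightarrow> real \<Rightarrow> (real^2) set \<Rightarrow> ennreal" where
  "lambda \<theta> q p B = (INF v \<in> W1 q B \<inter> normalized p B. energy \<theta> B v)"

definition lambda_as :: "real \<Rightarrow> real \<Rightarrow> real \<Rightarrow> (real^2) set \<Rightarrow> ennreal" where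
  "lambda_as \<theta> q p B = (INF v \<in> W1_as q B \<inter> normalized p B. energy \<theta> B v)"

definition is_minimizer :: "real \<Rightarrow> real \<Rightarrow> real \<Rightarrow> (real^2) set \<Rightarrow> (real^2 \<Rightarrow> real) \<Rightarrow> bool" where
  "is_minimizer \<theta> q p B v \<longleftrightarrow>
     v \<in> W1 q B \<inter> normalized p B \<and> energy \<theta> B v = lambda \<theta> q p B"

end

theory Submission
  imports Defs
begin

text \<open>
  Why the theorem holds. Let \<open>v\<close> be antisymmetric and admissible. Put \<open>w = v\<close> on the upper half of the
  ball and \<open>w = 0\<close> on the lower half. Antisymmetry makes the trace of \<open>v\<close> on the axis vanish, so \<open>w\<close>
  is again a Sobolev function, its gradient is that of \<open>v\<close> cut off, its energy is half of that of \<open>v\<close>,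
  and \<open>\<integral>\<bar>w\<bar>\<^sup>p = 1/2\<close> (\<open>half_weak_gradient\<close>, \<open>nn_integral_half\<close>). To obtain a competitor for the
  problem without symmetry, subtract the mean \<open>c\<close> of \<open>w\<close> and multiply by the constant \<open>t\<close> that
  restores the norm. Since \<open>2\<^bsup>1/p\<^esup> \<rightarrow> 1\<close>, the constant \<open>t\<close> costs little when \<open>p\<close> is large and \<open>c\<close> is
  small, and the weight changes by at most the factor \<open>(1 + \<bar>c\<bar>)\<^bsup>2\<theta>\<^esup>\<close>. Thus about one half of the energy
  of \<open>v\<close>, and certainly at most \<open>4/5\<close> of it, suffices (\<open>one_sided_competitor\<close>).

  It remains to know that \<open>c\<close> is small and that \<open>\<lambda>\<^sub>a\<^sub>s\<close> is positive, for otherwise the factor \<open>4/5\<close> would not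
  give a strict inequality.

  A point of the plane has capacity zero. Hence there are antisymmetric functions of arbitrarily small
  Dirichlet energy that are at least \<open>1\<close> in absolute value on some disk
  (\<open>small_energy_antisymmetric_function\<close>). As \<open>p\<close> grows their \<open>L\<^sup>p\<close> norm is at least \<open>1/2\<close>, so \<open>\<lambda>\<^sub>a\<^sub>s \<rightarrow> 0\<close>
  (\<open>lambda_as_tendsto_0\<close>), and only functions \<open>v\<close> of small energy \<open>E\<close> matter. For these the Cauchy-Schwarz
  inequality gives \<open>(\<integral>\<bar>\<nabla>v\<bar>)\<^sup>2 \<le> E \<integral>(1 + \<bar>v\<bar>)\<^bsup>2\<theta>\<^esup>\<close>, where the last integral is bounded because \<open>2\<theta> \<le> 1\<close>, and
  a Poincare inequality bounds \<open>\<bar>c\<bar>\<close> by a multiple of \<open>E\<^bsup>1/2\<^esup>\<close> (\<open>L1_bound_on_normalized\<close>).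

  Positivity of the infimum for fixed \<open>p\<close> is a subcritical Sobolev inequality with a weight
  (\<open>energy_bounded_below_on_normalized\<close>). Both it and the Poincare inequality follow from the potential
  estimate \<open>\<bar>v(x)\<bar> \<le> C \<integral>\<bar>\<nabla>v(z)\<bar> / \<bar>z - x\<bar> dz\<close> for functions of mean zero
  (\<open>mean_zero_potential_estimate\<close>): the kernel is integrable to every power below \<open>2\<close>, and this leaves
  room for the factor \<open>(1 + \<bar>v\<bar>)\<^sup>\<theta>\<close> by which \<open>\<bar>\<nabla>v\<bar>\<close> exceeds the square root of the energy density, because
  \<open>2\<theta> < 1\<close>. The estimate itself is obtained by integrating the weak gradient along segments, which
  becomes legitimate after testing with translates of test functions (\<open>weak_gradient_line_integral\<close>).
\<close>

section \<open>Differentiability classes and a smooth step function\<close>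

lemma C_k_SucD: "C_k (Suc k) f \<Longrightarrow> C_k k f"
proof (induction k arbitrary: f)
  case 0
  then show ?case
    by (auto simp: continuous_on_eq_continuous_at intro: differentiable_imp_continuous_within)
next
  case (Suc k)
  then show ?case by (metis C_k.simps(2))
qed

lemma C_k_imp_continuous: "C_k k f \<Longrightarrow> continuous_on UNIV f"
proof (cases k)
  case (Suc n)
  moreover assume "C_k k f"
  ultimately show ?thesis
    by (auto simp: continuous_on_eq_continuous_at intro: differentiable_imp_continuous_within)
qed auto

lemma C_k_SucI:
  assumes "\<And>x. (f has_derivative f' x) (at x)"
    and "\<And>b. b \<in> Basis \<Longrightarrow> C_k k (\<lambda>x. f' x b)"
  shows "C_k (Suc k) f"
proof -
  have "frechet_derivative f (at x) = f' x" for x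
    using frechet_derivative_at[OF assms(1)] by simp
  then show ?thesis using assms by (auto simp: differentiable_def)
qed

lemma C_k_SucE:
  assumes "C_k (Suc k) f"
  shows "(f has_derivative frechet_derivative f (at x)) (at x)"
    and "b \<in> Basis \<Longrightarrow> C_k k (\<lambda>x. frechet_derivative f (at x) b)"
  using assms frechet_derivative_works by auto

lemma C_k_const: "C_k k (\<lambda>_. c)"
proof (induction k arbitrary: c)
  case (Suc k)
  show ?case by (rule C_k_SucI[where f' = "\<lambda>_ _. 0"]) (auto simp: Suc)
qed auto

lemma C_k_inner: "C_k k (\<lambda>x. x \<bullet> a)"
proof (cases k)
  case 0
  then show ?thesis by (auto intro!: continuous_intros)
next
  case (Suc n)
  show ?thesis unfolding Suc
    by (rule C_k_SucI[where f' = "\<lambda>_ h. h \<bullet> a"])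
       (auto simp: C_k_const intro!: derivative_eq_intros)
qed

lemma C_k_add: "C_k k f \<Longrightarrow> C_k k g \<Longrightarrow> C_k k (\<lambda>x. f x + g x)"
proof (induction k arbitrary: f g)
  case 0
  then show ?case by (auto intro!: continuous_intros)
next
  case (Suc k)
  show ?case
    by (rule C_k_SucI, rule has_derivative_add[OF C_k_SucE(1)[OF Suc.prems(1)] C_k_SucE(1)[OF Suc.prems(2)]])
       (intro Suc.IH C_k_SucE(2)[OF Suc.prems(1)] C_k_SucE(2)[OF Suc.prems(2)])
qed

lemma C_k_mult: "C_k k f \<Longrightarrow> C_k k g \<Longrightarrow> C_k k (\<lambda>x. f x * g x)"
proof (induction k arbitrary: f g)
  case 0
  then show ?case by (auto intro!: continuous_intros)
next
  case (Suc k)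
  show ?case
    by (rule C_k_SucI, rule has_derivative_mult[OF C_k_SucE(1)[OF Suc.prems(1)] C_k_SucE(1)[OF Suc.prems(2)]])
       (intro C_k_add Suc.IH C_k_SucE(2)[OF Suc.prems(1)] C_k_SucE(2)[OF Suc.prems(2)]
          C_k_SucD[OF Suc.prems(1)] C_k_SucD[OF Suc.prems(2)])
qed

lemma C_k_diff: "C_k k f \<Longrightarrow> C_k k g \<Longrightarrow> C_k k (\<lambda>x. f x - g x)"
  using C_k_add[of k f "\<lambda>x. (-1) * g x"] C_k_mult[OF C_k_const[of k "-1"], of g] by simp

lemma C_k_sum: "(\<And>i. i \<in> I \<Longrightarrow> C_k k (f i)) \<Longrightarrow> C_k k (\<lambda>x. \<Sum>i\<in>I. f i x)"
proof (induction I rule: infinite_finite_induct)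
  case (insert i I)
  then have "C_k k (\<lambda>x. f i x + (\<Sum>i\<in>I. f i x))"
    by (intro C_k_add) auto
  then show ?case using insert by simp
qed (simp_all add: C_k_const)

lemma C_k_prod: "(\<And>i. i \<in> I \<Longrightarrow> C_k k (f i)) \<Longrightarrow> C_k k (\<lambda>x. \<Prod>i\<in>I. f i x)"
proof (induction I rule: infinite_finite_induct)
  case (insert i I)
  then have "C_k k (\<lambda>x. f i x * (\<Prod>i\<in>I. f i x))"
    by (intro C_k_mult) auto
  then show ?case using insert by simp
qed (simp_all add: C_k_const)

lemma frechet_derivative_expand:
  fixes f :: "'a::euclidean_space \<Rightarrow> real"
  assumes "f differentiable at x"
  shows "frechet_derivative f (at x) h = (\<Sum>b\<in>Basis. (h \<bullet> b) * frechet_derivative f (at x) b)"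
proof -
  interpret bounded_linear "frechet_derivative f (at x)"
    using assms has_derivative_bounded_linear frechet_derivative_works by blast
  show ?thesis
    by (subst (1) euclidean_representation[of h, symmetric]) (simp add: sum scaleR)
qed

text \<open>The chain rule expresses a partial derivative of \<open>f \<circ> L\<close> through all partial derivatives of \<open>f\<close>, which are
  again of the form treated by the induction. Translations and reflections are instances.\<close>

lemma C_k_affine:
  assumes "bounded_linear L"
  shows "C_k k f \<Longrightarrow> C_k k (\<lambda>x. f (L x + a))"
proof (induction k arbitrary: f)
  case 0
  then have "continuous_on UNIV (f \<circ> (\<lambda>x. L x + a))"
    using linear_continuous_on[OF assms, of UNIV]
    by (intro continuous_on_compose continuous_intros) (auto elim: continuous_on_subset)
  then show ?case by (simp add: o_def)
next
  case (Suc k)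
  have L: "((\<lambda>x. L x + a) has_derivative L) (at x)" for x
    using bounded_linear_imp_has_derivative[OF assms] by (auto intro!: derivative_eq_intros)
  show ?case
  proof (rule C_k_SucI)
    show "((\<lambda>x. f (L x + a)) has_derivative (\<lambda>h. frechet_derivative f (at (L x + a)) (L h))) (at x)" for x
      using has_derivative_compose[OF L C_k_SucE(1)[OF Suc.prems]] by simp
    fix b :: 'a
    have eq: "frechet_derivative f (at y) (L b) =
        (\<Sum>b'\<in>Basis. (L b \<bullet> b') * frechet_derivative f (at y) b')" for y
      using Suc.prems by (intro frechet_derivative_expand) auto
    show "C_k k (\<lambda>x. frechet_derivative f (at (L x + a)) (L b))"
      unfolding eq
      by (intro C_k_sum C_k_mult C_k_const Suc.IH C_k_SucE(2)[OF Suc.prems])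
  qed
qed

text \<open>The sequence \<open>D\<close> lists the outer function and all its derivatives. The induction over \<open>k\<close> needs the
  statement for every member of the sequence at once.\<close>

lemma C_k_compose_real:
  fixes D :: "nat \<Rightarrow> real \<Rightarrow> real"
  assumes D: "\<And>n t. (D n has_real_derivative D (Suc n) t) (at t)"
  shows "C_k k u \<Longrightarrow> C_k k (\<lambda>x. D n (u x))"
proof (induction k arbitrary: n)
  case 0
  have "continuous_on UNIV (D n)"
    using D by (meson DERIV_continuous continuous_at_imp_continuous_on)
  then show ?case using 0 by (auto intro: continuous_on_compose2)
next
  case (Suc k)
  show ?case
  proof (rule C_k_SucI)
    show "((\<lambda>x. D n (u x)) has_derivative
        (\<lambda>h. D (Suc n) (u x) * frechet_derivative u (at x) h)) (at x)" for x
      using has_derivative_compose[OF C_k_SucE(1)[OF Suc.prems]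
          D[of n "u x", unfolded has_field_derivative_def]] by simp
    show "C_k k (\<lambda>x. D (Suc n) (u x) * frechet_derivative u (at x) b)" if "b \<in> Basis" for b
      by (intro C_k_mult Suc.IH C_k_SucE(2)[OF Suc.prems] C_k_SucD[OF Suc.prems] that)
  qed
qed

text \<open>The functions \<open>P(1/t) exp(-1/t)\<close>, extended by zero to \<open>t \<le> 0\<close>, with \<open>P\<close> a polynomial. Differentiation maps
  this class into itself, which is why its members are smooth, also at the origin.\<close>

definition flat_exp :: "real poly \<Rightarrow> real \<Rightarrow> real" where
  "flat_exp P t = (if t > 0 then poly P (1 / t) * exp (- (1 / t)) else 0)"

lemma poly_times_exp_neg_tendsto_0:
  fixes P :: "real poly"
  shows "((\<lambda>s. poly P s * exp (- s)) \<longlongrightarrow> 0) at_top"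
proof -
  have "((\<lambda>s. \<Sum>i\<le>degree P. coeff P i * (s ^ i / exp s)) \<longlongrightarrow> (\<Sum>i\<le>degree P. coeff P i * 0)) at_top"
    by (intro tendsto_sum tendsto_mult tendsto_const tendsto_power_div_exp_0)
  then show ?thesis
    by (simp add: poly_altdef exp_minus sum_distrib_right divide_inverse mult.assoc)
qed

lemma flat_exp_deriv:
  "(flat_exp P has_real_derivative flat_exp ((P - pderiv P) * monom 1 2) t) (at t)"
proof -
  consider "t > 0" | "t < 0" | "t = 0" by linarith
  then show ?thesis
  proof cases
    case 1
    have "((\<lambda>t. poly P (1 / t) * exp (- (1 / t))) has_real_derivative
        flat_exp ((P - pderiv P) * monom 1 2) t) (at t)"
      using 1
      by (auto intro!: derivative_eq_intros DERIV_chain2[where f = "poly P", OF poly_DERIV]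
            simp: flat_exp_def poly_monom field_simps power2_eq_square)
    then show ?thesis
      by (rule has_field_derivative_transform_within_open[where S = "{0<..}"])
         (auto simp: 1 flat_exp_def)
  next
    case 2
    have "((\<lambda>t. 0) has_real_derivative flat_exp ((P - pderiv P) * monom 1 2) t) (at t)"
      using 2 by (simp add: flat_exp_def)
    then show ?thesis
      by (rule has_field_derivative_transform_within_open[where S = "{..<0}"])
         (auto simp: 2 flat_exp_def)
  next
    case 3
    have "((\<lambda>s. poly (P * monom 1 1) s * exp (- s)) \<longlongrightarrow> 0) at_top"
      by (rule poly_times_exp_neg_tendsto_0)
    then have "((\<lambda>t. poly (P * monom 1 1) (inverse t) * exp (- inverse t)) \<longlongrightarrow> 0) (at_right 0)"
      by (rule filterlim_compose[OF _ filterlim_inverse_at_top_right])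
    then have "((\<lambda>h. (flat_exp P (0 + h) - flat_exp P 0) / h) \<longlongrightarrow> 0) (at_right 0)"
      by (rule tendsto_cong[THEN iffD1, rotated])
         (auto simp: eventually_at_filter flat_exp_def poly_monom field_simps)
    moreover have "((\<lambda>h. (flat_exp P (0 + h) - flat_exp P 0) / h) \<longlongrightarrow> 0) (at_left 0)"
      by (rule tendsto_eventually) (auto simp: eventually_at_filter flat_exp_def)
    ultimately show ?thesis
      using 3 by (simp add: DERIV_def filterlim_split_at flat_exp_def)
  qed
qed

text \<open>The standard smooth function that vanishes exactly on \<open>t \<le> 0\<close>. Its dilations \<open>step (n t)\<close> increase to the
  indicator of \<open>t > 0\<close>, so that it serves both for bump functions and for cut-offs.\<close>

definition step :: "real \<Rightarrow> real" where
  "step t = (if t > 0 then exp (- (1 / t)) else 0)"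

lemma step_eq_flat_exp: "step = flat_exp 1"
  by (auto simp: fun_eq_iff step_def flat_exp_def)

lemma step_deriv:
  "(step has_real_derivative (if t > 0 then exp (- (1 / t)) / t\<^sup>2 else 0)) (at t)"
  using flat_exp_deriv[of 1 t]
  by (simp add: step_eq_flat_exp pderiv_1 flat_exp_def poly_monom power_divide cong: if_cong)

lemma C_k_step: "C_k k u \<Longrightarrow> C_k k (\<lambda>x. step (u x))"
  using C_k_compose_real[where D = "\<lambda>n. flat_exp (((\<lambda>P. (P - pderiv P) * monom 1 2) ^^ n) 1)"
      and n = 0, of k u] flat_exp_deriv
  by (simp add: step_eq_flat_exp)

lemma step_bounds: "0 \<le> step t" "step t \<le> 1" "step t \<noteq> 0 \<longleftrightarrow> t > 0"
  by (auto simp: step_def)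

lemma step_dilation_tendsto: "(\<lambda>n. step (real n * t)) \<longlonglongrightarrow> (if t > 0 then 1 else 0)"
proof (cases "t > 0")
  case True
  have "(\<lambda>n. exp (- (1 / t) * (1 / real n))) \<longlonglongrightarrow> exp (- (1 / t) * 0)"
    by (intro tendsto_intros lim_1_over_n)
  moreover have "\<forall>\<^sub>F n in sequentially. exp (- (1 / t) * (1 / real n)) = step (real n * t)"
    using eventually_gt_at_top[of 0] by eventually_elim (use True in \<open>simp add: step_def\<close>)
  ultimately have "(\<lambda>n. step (real n * t)) \<longlonglongrightarrow> 1"
    using Lim_transform_eventually by fastforce
  then show ?thesis using True by simp
next
  case False
  then have "step (real n * t) = 0" for n
    by (auto simp: step_def zero_less_mult_iff)
  then show ?thesis using False by simp
qed

section \<open>Test functions and the du Bois-Reymond lemma\<close>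

lemma test_functionsI:
  assumes "\<And>k. C_k k \<phi>" "compact K" "K \<subseteq> S" "\<And>x. x \<notin> K \<Longrightarrow> \<phi> x = 0"
  shows "\<phi> \<in> test_functions S"
proof -
  have "closure {x. \<phi> x \<noteq> 0} \<subseteq> K"
    using assms by (intro closure_minimal) (auto intro: compact_imp_closed)
  moreover have "compact (closure {x. \<phi> x \<noteq> 0})"
    using calculation assms(2) closed_closure compact_Int_closed[of K "closure {x. \<phi> x \<noteq> 0}"]
    by (simp add: Int_absorb1)
  ultimately show ?thesis using assms unfolding test_functions_def by auto
qed

lemma test_functionsE:
  assumes "\<phi> \<in> test_functions S"
  obtains K where "compact K" "K \<subseteq> S" "\<And>x. x \<notin> K \<Longrightarrow> \<phi> x = 0"
proof
  show "compact (closure {x. \<phi> x \<noteq> 0})" "closure {x. \<phi> x \<noteq> 0} \<subseteq> S"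
    using assms by (auto simp: test_functions_def)
  show "\<phi> x = 0" if "x \<notin> closure {x. \<phi> x \<noteq> 0}" for x
    using that closure_subset[of "{x. \<phi> x \<noteq> 0}"] by auto
qed

lemma test_functions_C_k: "\<phi> \<in> test_functions S \<Longrightarrow> C_k k \<phi>"
  by (auto simp: test_functions_def)

lemma test_functions_has_derivative:
  "\<phi> \<in> test_functions S \<Longrightarrow> (\<phi> has_derivative frechet_derivative \<phi> (at x)) (at x)"
  using C_k_SucE(1) test_functions_C_k by blast

lemma test_functions_derivative:
  assumes "\<phi> \<in> test_functions S"
  shows "(\<lambda>x. frechet_derivative \<phi> (at x) h) \<in> test_functions S"
proof -
  obtain K where K: "compact K" "K \<subseteq> S" "\<And>x. x \<notin> K \<Longrightarrow> \<phi> x = 0"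
    using test_functionsE[OF assms] by metis
  have eq: "frechet_derivative \<phi> (at x) h = (\<Sum>b\<in>Basis. (h \<bullet> b) * frechet_derivative \<phi> (at x) b)" for x
    using test_functions_has_derivative[OF assms]
    by (intro frechet_derivative_expand) (auto simp: differentiable_def)
  show ?thesis
  proof (rule test_functionsI[OF _ K(1,2)])
    show "C_k k (\<lambda>x. frechet_derivative \<phi> (at x) h)" for k
      unfolding eq
      by (intro C_k_sum C_k_mult C_k_const C_k_SucE(2)[OF test_functions_C_k[OF assms]])
    fix x assume "x \<notin> K"
    have "(\<phi> has_derivative (\<lambda>_. 0)) (at x)"
      by (rule has_derivative_transform_within_open[where f = "\<lambda>_. 0" and s = "- K"])
         (use K \<open>x \<notin> K\<close> in \<open>auto simp: compact_imp_closed open_Compl\<close>)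
    then show "frechet_derivative \<phi> (at x) h = 0"
      using frechet_derivative_at by metis
  qed
qed

lemma test_functions_continuous: "\<phi> \<in> test_functions S \<Longrightarrow> continuous_on T \<phi>"
  using C_k_imp_continuous continuous_on_subset test_functions_C_k by blast

lemma test_functions_measurable: "\<phi> \<in> test_functions S \<Longrightarrow> \<phi> \<in> borel_measurable borel"
  by (simp add: borel_measurable_continuous_onI test_functions_continuous)

lemma test_functions_bounded:
  assumes "\<phi> \<in> test_functions S"
  obtains C where "C > 0" "\<And>x. \<bar>\<phi> x\<bar> \<le> C"
proof -
  obtain K where K: "compact K" "\<And>x. x \<notin> K \<Longrightarrow> \<phi> x = 0"
    using test_functionsE[OF assms] by metis
  have "bounded (\<phi> ` K)"
    using K(1) test_functions_continuous[OF assms] compact_continuous_image compact_imp_bounded by blast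
  then obtain C where "C > 0" "\<forall>x\<in>K. \<bar>\<phi> x\<bar> \<le> C"
    by (auto simp: bounded_pos)
  then show ?thesis using K(2) by (intro that[of C]) force+
qed

lemma test_functions_affine:
  assumes "\<phi> \<in> test_functions S" "bounded_linear L" "bounded_linear L'"
    and inv: "\<And>x. L (L' x) = x" "\<And>x. L' (L x) = x"
    and "\<And>x. x \<in> closure {x. \<phi> x \<noteq> 0} \<Longrightarrow> L' (x - a) \<in> T"
  shows "(\<lambda>x. \<phi> (L x + a)) \<in> test_functions T"
proof (rule test_functionsI)
  let ?K = "closure {x. \<phi> x \<noteq> 0}"
  show "C_k k (\<lambda>x. \<phi> (L x + a))" for k
    using assms(1,2) by (intro C_k_affine test_functions_C_k)
  have "continuous_on ?K (\<lambda>x. L' (x - a))"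
    by (intro bounded_linear.continuous_on[OF assms(3)] continuous_intros)
  then show "compact ((\<lambda>x. L' (x - a)) ` ?K)"
    using assms(1) by (intro compact_continuous_image) (auto simp: test_functions_def)
  show "(\<lambda>x. L' (x - a)) ` ?K \<subseteq> T" using assms(6) by auto
  fix x assume *: "x \<notin> (\<lambda>x. L' (x - a)) ` ?K"
  have "L x + a \<notin> ?K"
  proof
    assume "L x + a \<in> ?K"
    then have "L' (L x + a - a) \<in> (\<lambda>x. L' (x - a)) ` ?K" by (rule imageI)
    then show False using * inv by simp
  qed
  then show "\<phi> (L x + a) = 0"
    using closure_subset[of "{x. \<phi> x \<noteq> 0}"] by auto
qed

lemma integrable_times_test_function:
  fixes v :: "'a::euclidean_space \<Rightarrow> real"
  assumes "open S" "\<And>K. compact K \<Longrightarrow> K \<subseteq> S \<Longrightarrow> v absolutely_integrable_on K"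
    and "\<phi> \<in> test_functions S"
  shows "integrable (lebesgue_on S) (\<lambda>x. v x * \<phi> x)"
proof -
  obtain K where K: "compact K" "K \<subseteq> S" "\<And>x. x \<notin> K \<Longrightarrow> \<phi> x = 0"
    using test_functionsE[OF assms(3)] by metis
  obtain C where C: "C > 0" "\<And>x. \<bar>\<phi> x\<bar> \<le> C"
    using test_functions_bounded[OF assms(3)] by metis
  have int: "integrable lebesgue (\<lambda>x. indicator K x *\<^sub>R v x)"
    using assms(2)[OF K(1,2)] by (simp add: set_integrable_def)
  have [measurable]: "\<phi> \<in> borel_measurable lebesgue"
    using test_functions_measurable[OF assms(3)] by (auto intro: measurable_completion)
  have "integrable lebesgue (\<lambda>x. (indicator K x *\<^sub>R v x) * \<phi> x)"
  proof (rule Bochner_Integration.integrable_bound[of _ "\<lambda>x. C * (indicator K x *\<^sub>R v x)"])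
    show "AE x in lebesgue. norm ((indicator K x *\<^sub>R v x) * \<phi> x) \<le> norm (C * (indicator K x *\<^sub>R v x))"
    proof (rule AE_I2)
      fix x
      have "\<bar>indicator K x * v x\<bar> * \<bar>\<phi> x\<bar> \<le> \<bar>indicator K x * v x\<bar> * C"
        using C by (intro mult_left_mono) auto
      then show "norm ((indicator K x *\<^sub>R v x) * \<phi> x) \<le> norm (C * (indicator K x *\<^sub>R v x))"
        using C(1) by (simp add: abs_mult mult_ac)
    qed
  qed (use int in auto)
  also have "(\<lambda>x. (indicator K x *\<^sub>R v x) * \<phi> x) = (\<lambda>x. indicator S x *\<^sub>R (v x * \<phi> x))"
    using K(2,3) by (auto simp: indicator_def fun_eq_iff)
  finally show ?thesis
    using assms(1) by (simp add: integrable_restrict_space)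
qed

text \<open>Smooth approximations of the indicator of a box, as products of dilated steps in the coordinates.\<close>

lemma box_test_function:
  fixes a b :: "'a::euclidean_space"
  assumes "cbox a b \<subseteq> S"
  defines "\<phi> \<equiv> \<lambda>n x. \<Prod>i\<in>Basis. step (real n * (x \<bullet> i - a \<bullet> i)) * step (real n * (b \<bullet> i - x \<bullet> i))"
  shows "\<phi> n \<in> test_functions S" and "0 \<le> \<phi> n x" and "\<phi> n x \<le> 1"
    and "(\<lambda>n. \<phi> n x) \<longlonglongrightarrow> indicator (box a b) x" and "x \<notin> cbox a b \<Longrightarrow> \<phi> n x = 0"
proof -
  show *: "\<phi> n x = 0" if out: "x \<notin> cbox a b" for n x
  proof -
    obtain i where "i \<in> Basis" "x \<bullet> i < a \<bullet> i \<or> b \<bullet> i < x \<bullet> i"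
      using out by (force simp: mem_box)
    then have "step (real n * (x \<bullet> i - a \<bullet> i)) * step (real n * (b \<bullet> i - x \<bullet> i)) = 0"
      by (auto simp: step_def zero_less_mult_iff)
    then show ?thesis
      unfolding \<phi>_def using \<open>i \<in> Basis\<close> by (intro prod_zero) auto
  qed
  show "\<phi> n \<in> test_functions S"
  proof (rule test_functionsI[OF _ compact_cbox assms(1)])
    show "C_k k (\<phi> n)" for k
      unfolding \<phi>_def by (intro C_k_prod C_k_mult C_k_step C_k_diff C_k_inner C_k_const)
  qed (use * in auto)
  show "0 \<le> \<phi> n x" unfolding \<phi>_def by (intro prod_nonneg mult_nonneg_nonneg step_bounds ballI)
  show "\<phi> n x \<le> 1" unfolding \<phi>_def by (intro prod_le_1) (auto simp: step_bounds mult_le_one)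
  have "(\<lambda>n. \<phi> n x) \<longlonglongrightarrow> (\<Prod>i\<in>Basis. (if x \<bullet> i - a \<bullet> i > 0 then 1 else 0) * (if b \<bullet> i - x \<bullet> i > 0 then 1 else 0))"
    unfolding \<phi>_def by (intro tendsto_prod tendsto_mult step_dilation_tendsto)
  also have "(\<Prod>i\<in>Basis. (if x \<bullet> i - a \<bullet> i > 0 then 1 else 0) * (if b \<bullet> i - x \<bullet> i > 0 then 1 else 0))
      = (indicator (box a b) x :: real)"
  proof (cases "x \<in> box a b")
    case True
    then show ?thesis by (auto simp: mem_box intro!: prod.neutral)
  next
    case False
    then obtain i where "i \<in> Basis" "\<not> (a \<bullet> i < x \<bullet> i \<and> x \<bullet> i < b \<bullet> i)" by (auto simp: mem_box)
    then show ?thesis using False by (auto intro!: prod_zero)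
  qed
  finally show "(\<lambda>n. \<phi> n x) \<longlonglongrightarrow> indicator (box a b) x" .
qed

text \<open>By Lebesgue differentiation, \<open>h\<close> is almost everywhere the limit of its averages over small cubes.\<close>

lemma negligible_nonzero_if_box_integrals_zero:
  fixes h :: "'a::euclidean_space \<Rightarrow> real"
  assumes "h absolutely_integrable_on cbox c d"
    and zero: "\<And>a b. cbox a b \<subseteq> cbox c d \<Longrightarrow> integral (cbox a b) h = 0"
  shows "negligible {x \<in> cbox c d. h x \<noteq> 0}"
proof -
  define f where "f x = (if x \<in> cbox c d then h x else 0)" for x
  have "f integrable_on UNIV"
    using assms(1) unfolding f_def absolutely_integrable_on_def
    by (simp add: integrable_restrict_UNIV)
  then have "f integrable_on cbox a b" for a b
    using integrable_on_subcbox by blast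
  then obtain N where N: "negligible N"
    "\<And>x e. \<lbrakk>x \<notin> N; 0 < e\<rbrakk> \<Longrightarrow> \<exists>d>0. \<forall>t. 0 < t \<and> t < d \<longrightarrow>
        norm (integral (cbox x (x + t *\<^sub>R One)) f /\<^sub>R t ^ DIM('a) - f x) < e"
    using integrable_ccontinuous_explicit[of f] by metis
  have "h x = 0" if xN: "x \<notin> N" and xb: "x \<in> box c d" for x
  proof (rule ccontr)
    assume "h x \<noteq> 0"
    then have "0 < \<bar>h x\<bar>" by simp
    then obtain t0 where t0: "t0 > 0" "\<And>t. 0 < t \<Longrightarrow> t < t0 \<Longrightarrow>
        norm (integral (cbox x (x + t *\<^sub>R One)) f /\<^sub>R t ^ DIM('a) - f x) < \<bar>h x\<bar>"
      using N(2)[OF xN] by blast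
    obtain e where e: "e > 0" "\<And>i. i \<in> Basis \<Longrightarrow> e \<le> d \<bullet> i - x \<bullet> i"
    proof
      show "Min ((\<lambda>i. d \<bullet> i - x \<bullet> i) ` Basis) > 0"
        using xb by (auto simp: mem_box)
    qed auto
    define t where "t = min e (t0 / 2)"
    have t: "0 < t" "t < t0" "t \<le> e" using e(1) t0(1) by (auto simp: t_def)
    have sub: "cbox x (x + t *\<^sub>R One) \<subseteq> cbox c d"
      using xb e(2) t(3) unfolding subset_box mem_box
      by (fastforce simp: inner_add_left)
    have "integral (cbox x (x + t *\<^sub>R One)) f = integral (cbox x (x + t *\<^sub>R One)) h"
      using sub by (intro integral_cong) (auto simp: f_def)
    also have "\<dots> = 0" using zero[OF sub] .
    finally have "\<bar>f x\<bar> < \<bar>h x\<bar>" using t0(2)[OF t(1,2)] by simp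
    then show False using xb box_subset_cbox[of c d] by (auto simp: f_def)
  qed
  then have "{x \<in> cbox c d. h x \<noteq> 0} \<subseteq> N \<union> (cbox c d - box c d)" by auto
  moreover have "negligible (N \<union> (cbox c d - box c d))"
    using N(1) negligible_frontier_interval by (simp add: negligible_Un)
  ultimately show ?thesis using negligible_subset by blast
qed

text \<open>Approximating indicators of boxes by test functions shows that all box integrals of \<open>h\<close> vanish.\<close>

lemma du_Bois_Reymond:
  fixes h :: "'a::euclidean_space \<Rightarrow> real"
  assumes "open S" and int: "\<And>K. compact K \<Longrightarrow> K \<subseteq> S \<Longrightarrow> h absolutely_integrable_on K"
    and zero: "\<And>\<phi>. \<phi> \<in> test_functions S \<Longrightarrow> (LINT x|lebesgue_on S. h x * \<phi> x) = 0"
  shows "AE x in lebesgue_on S. h x = 0"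
proof -
  have box0: "integral (cbox a b) h = 0" if sub: "cbox a b \<subseteq> S" for a b
  proof -
    define \<phi> where "\<phi> n x = (\<Prod>i\<in>Basis. step (real n * (x \<bullet> i - a \<bullet> i)) * step (real n * (b \<bullet> i - x \<bullet> i)))"
      for n and x :: 'a
    note \<phi> = box_test_function[OF sub, folded \<phi>_def]
    have hint: "integrable lebesgue (\<lambda>x. indicator (cbox a b) x *\<^sub>R h x)"
      using int[OF compact_cbox sub] by (simp add: set_integrable_def)
    have [measurable]: "\<phi> n \<in> borel_measurable lebesgue" for n
      using test_functions_measurable[OF \<phi>(1)] by (auto intro: measurable_completion)
    have "(\<lambda>n. LINT x|lebesgue. (indicator (cbox a b) x *\<^sub>R h x) * \<phi> n x) \<longlonglongrightarrow>
        (LINT x|lebesgue. (indicator (cbox a b) x *\<^sub>R h x) * indicator (box a b) x)"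
    proof (rule integral_dominated_convergence[where w = "\<lambda>x. \<bar>indicator (cbox a b) x *\<^sub>R h x\<bar>"])
      show "AE x in lebesgue. norm ((indicator (cbox a b) x *\<^sub>R h x) * \<phi> n x) \<le> \<bar>indicator (cbox a b) x *\<^sub>R h x\<bar>" for n
        using \<phi>(2,3)[of n] by (intro AE_I2) (auto simp: abs_mult intro!: mult_left_le)
      show "AE x in lebesgue. (\<lambda>n. (indicator (cbox a b) x *\<^sub>R h x) * \<phi> n x) \<longlonglongrightarrow>
          (indicator (cbox a b) x *\<^sub>R h x) * indicator (box a b) x"
        by (intro AE_I2 tendsto_mult tendsto_const \<phi>(4))
      show "(\<lambda>x. (indicator (cbox a b) x *\<^sub>R h x) * indicator (box a b) x) \<in> borel_measurable lebesgue"
        "(\<lambda>x. (indicator (cbox a b) x *\<^sub>R h x) * \<phi> n x) \<in> borel_measurable lebesgue" for n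
        using test_functions_measurable[OF \<phi>(1)]
        by (intro borel_measurable_times borel_measurable_indicator hint[THEN borel_measurable_integrable];
            auto intro: measurable_completion)+
    qed (use hint in auto)
    moreover have "(LINT x|lebesgue. (indicator (cbox a b) x *\<^sub>R h x) * \<phi> n x) = 0" for n
    proof -
      have "(LINT x|lebesgue. (indicator (cbox a b) x *\<^sub>R h x) * \<phi> n x) =
          (LINT x|lebesgue. indicator S x *\<^sub>R (h x * \<phi> n x))"
        using sub \<phi>(5)[of _ n] by (intro Bochner_Integration.integral_cong) (auto simp: indicator_def)
      also have "\<dots> = (LINT x|lebesgue_on S. h x * \<phi> n x)"
        using assms(1) by (simp add: integral_restrict_space)
      finally show ?thesis using zero[OF \<phi>(1)] by simp
    qed
    ultimately have "(\<lambda>n::nat. 0::real) \<longlonglongrightarrow> (LINT x|lebesgue. (indicator (cbox a b) x *\<^sub>R h x) * indicator (box a b) x)"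
      by (simp only:)
    then have "(LINT x|lebesgue. (indicator (cbox a b) x *\<^sub>R h x) * indicator (box a b) x) = 0"
      by (rule LIMSEQ_unique[OF _ tendsto_const])
    also have "(\<lambda>x. (indicator (cbox a b) x *\<^sub>R h x) * indicator (box a b) x) = (\<lambda>x. indicator (box a b) x *\<^sub>R h x)"
      using box_subset_cbox[of a b] by (auto simp: indicator_def fun_eq_iff)
    finally have "set_lebesgue_integral lebesgue (box a b) h = 0"
      by (simp only: set_lebesgue_integral_def)
    moreover have "h absolutely_integrable_on box a b"
      by (rule set_integrable_subset[OF int[OF compact_cbox sub]]) (auto simp: box_subset_cbox)
    ultimately have "integral (box a b) h = 0"
      by (simp add: set_lebesgue_integral_eq_integral)
    then show ?thesis by (simp add: integral_open_interval)
  qed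
  obtain D where D: "countable D" "D \<subseteq> Pow S" "\<And>X. X \<in> D \<Longrightarrow> \<exists>a b. X = cbox a b" "\<Union>D = S"
    using open_countable_Union_open_cbox[OF assms(1)] by metis
  have "negligible {x \<in> X. h x \<noteq> 0}" if "X \<in> D" for X
  proof -
    obtain c d where X: "X = cbox c d" using D(3)[OF \<open>X \<in> D\<close>] by auto
    then have "cbox c d \<subseteq> S" using D(2) that by auto
    then show ?thesis unfolding X
      by (intro negligible_nonzero_if_box_integrals_zero int box0) auto
  qed
  then have "negligible (\<Union>X\<in>D. {x \<in> X. h x \<noteq> 0})"
    using D(1) by (intro negligible_countable_Union) auto
  moreover have "(\<Union>X\<in>D. {x \<in> X. h x \<noteq> 0}) = {x \<in> S. h x \<noteq> 0}" using D(4) by auto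
  ultimately have "{x \<in> S. h x \<noteq> 0} \<in> null_sets lebesgue"
    by (simp add: negligible_iff_null_sets)
  then have "AE x in lebesgue. x \<in> S \<longrightarrow> h x = 0"
    by (rule AE_I') auto
  then show ?thesis using assms(1) by (simp add: AE_restrict_space_iff)
qed

section \<open>Weak gradients\<close>

lemma has_weak_gradient_onD:
  assumes "has_weak_gradient_on v g S"
  shows "compact K \<Longrightarrow> K \<subseteq> S \<Longrightarrow> v absolutely_integrable_on K"
    and "compact K \<Longrightarrow> K \<subseteq> S \<Longrightarrow> (\<lambda>x. g x \<bullet> h) absolutely_integrable_on K"
proof -
  show "v absolutely_integrable_on K" if "compact K" "K \<subseteq> S"
    using assms that by (auto simp: has_weak_gradient_on_def)
  assume "compact K" "K \<subseteq> S"
  then have "integrable lebesgue (\<lambda>x. indicator K x *\<^sub>R g x)"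
    using assms by (auto simp: has_weak_gradient_on_def set_integrable_def)
  then have "integrable lebesgue (\<lambda>x. (indicator K x *\<^sub>R g x) \<bullet> h)"
    by (rule integrable_inner_left)
  then show "(\<lambda>x. g x \<bullet> h) absolutely_integrable_on K"
    by (simp add: set_integrable_def)
qed

lemma weak_gradient_integrable_products:
  assumes "has_weak_gradient_on v g S" "open S" "\<phi> \<in> test_functions S"
  shows "integrable (lebesgue_on S) (\<lambda>x. v x * \<phi> x)"
    and "integrable (lebesgue_on S) (\<lambda>x. v x * frechet_derivative \<phi> (at x) h)"
    and "integrable (lebesgue_on S) (\<lambda>x. (g x \<bullet> h) * \<phi> x)"
  using assms test_functions_derivative
  by (auto intro!: integrable_times_test_function has_weak_gradient_onD)

text \<open>The defining identity concerns coordinate directions only; it is linear in the direction.\<close>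

lemma weak_gradient_direction:
  assumes "has_weak_gradient_on v g S" "open S" "\<phi> \<in> test_functions S"
  shows "(LINT x|lebesgue_on S. v x * frechet_derivative \<phi> (at x) h) =
    - (LINT x|lebesgue_on S. (g x \<bullet> h) * \<phi> x)"
proof -
  note int = weak_gradient_integrable_products[OF assms]
  have "frechet_derivative \<phi> (at x) h = (\<Sum>b\<in>Basis. (h \<bullet> b) * frechet_derivative \<phi> (at x) b)" for x
    using test_functions_has_derivative[OF assms(3)]
    by (intro frechet_derivative_expand) (auto simp: differentiable_def)
  then have "(LINT x|lebesgue_on S. v x * frechet_derivative \<phi> (at x) h) =
      (LINT x|lebesgue_on S. (\<Sum>b\<in>Basis. (h \<bullet> b) * (v x * frechet_derivative \<phi> (at x) b)))"
    by (simp add: sum_distrib_left mult_ac)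
  also have "\<dots> = (\<Sum>b\<in>Basis. (h \<bullet> b) * (LINT x|lebesgue_on S. v x * frechet_derivative \<phi> (at x) b))"
    using int(2) by (simp add: Bochner_Integration.integral_sum)
  also have "\<dots> = (\<Sum>b\<in>Basis. (h \<bullet> b) * - (LINT x|lebesgue_on S. (g x \<bullet> b) * \<phi> x))"
    using assms by (intro sum.cong) (auto simp: has_weak_gradient_on_def)
  also have "\<dots> = - (LINT x|lebesgue_on S. (\<Sum>b\<in>Basis. (h \<bullet> b) * ((g x \<bullet> b) * \<phi> x)))"
    using int(3) by (simp add: Bochner_Integration.integral_sum sum_negf)
  also have "(\<lambda>x. \<Sum>b\<in>Basis. (h \<bullet> b) * ((g x \<bullet> b) * \<phi> x)) = (\<lambda>x. (g x \<bullet> h) * \<phi> x)"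
  proof
    fix x
    show "(\<Sum>b\<in>Basis. (h \<bullet> b) * ((g x \<bullet> b) * \<phi> x)) = (g x \<bullet> h) * \<phi> x"
      by (simp add: euclidean_inner[of "g x" h] sum_distrib_left mult_ac)
  qed
  finally show ?thesis .
qed

lemma has_weak_gradient_onI:
  assumes "open S" "integrable (lebesgue_on S) v" "integrable (lebesgue_on S) g"
    and "\<And>\<phi> b. \<phi> \<in> test_functions S \<Longrightarrow> b \<in> Basis \<Longrightarrow>
      (LINT x|lebesgue_on S. v x * frechet_derivative \<phi> (at x) b) =
      - (LINT x|lebesgue_on S. (g x \<bullet> b) * \<phi> x)"
  shows "has_weak_gradient_on v g S"
proof -
  have "v absolutely_integrable_on K \<and> g absolutely_integrable_on K" if "compact K" "K \<subseteq> S" for K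
    using that assms(1-3) set_integrable_subset[of lebesgue S v K] set_integrable_subset[of lebesgue S g K]
    by (auto simp: set_integrable_def integrable_restrict_space lmeasurable_compact fmeasurableD)
  then show ?thesis using assms(4) by (auto simp: has_weak_gradient_on_def)
qed

lemma has_weak_gradient_on_unique:
  assumes "open S" and g: "has_weak_gradient_on v g S" "has_weak_gradient_on v g' S"
  shows "AE x in lebesgue_on S. g x = g' x"
proof -
  have "AE x in lebesgue_on S. g x \<bullet> b - g' x \<bullet> b = 0" if "b \<in> Basis" for b
  proof (rule du_Bois_Reymond[OF assms(1)])
    fix \<phi> :: "'a \<Rightarrow> real" assume \<phi>: "\<phi> \<in> test_functions S"
    note i = weak_gradient_integrable_products(3)[OF _ assms(1) \<phi>]
    show "(LINT x|lebesgue_on S. (g x \<bullet> b - g' x \<bullet> b) * \<phi> x) = 0"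
      using weak_gradient_direction[OF g(1) assms(1) \<phi>, of b] weak_gradient_direction[OF g(2) assms(1) \<phi>, of b]
        i[OF g(1), of b] i[OF g(2), of b]
      by (simp add: left_diff_distrib)
  qed (intro set_integral_diff(1) has_weak_gradient_onD[OF g(1)] has_weak_gradient_onD[OF g(2)]; assumption)
  then have "AE x in lebesgue_on S. \<forall>b\<in>Basis. g x \<bullet> b - g' x \<bullet> b = 0"
    by (intro AE_finite_allI) auto
  then show ?thesis by eventually_elim (auto intro: euclidean_eqI)
qed

section \<open>Continuously differentiable functions\<close>

text \<open>The integral of a difference quotient vanishes by translation invariance, and difference quotients
  of a continuously differentiable function of compact support converge boundedly to the derivative.\<close>

lemma integral_directional_derivative_eq_0:
  fixes \<psi> :: "'a::euclidean_space \<Rightarrow> real"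
  assumes der: "\<And>x. (\<psi> has_derivative \<psi>' x) (at x)"
    and cont: "continuous_on UNIV (\<lambda>x. \<psi>' x b)"
    and K: "compact K" "\<And>x. x \<notin> K \<Longrightarrow> \<psi> x = 0"
  shows "(LINT x|lborel. \<psi>' x b) = 0"
proof -
  have ray: "((\<lambda>s. \<psi> (x + s *\<^sub>R b)) has_real_derivative \<psi>' (x + t *\<^sub>R b) b) (at t)" for x t
  proof -
    interpret bounded_linear "\<psi>' (x + t *\<^sub>R b)" using der has_derivative_bounded_linear by blast
    have "((\<lambda>s. x + s *\<^sub>R b) has_derivative (\<lambda>s. s *\<^sub>R b)) (at t)"
      by (auto intro!: derivative_eq_intros)
    from has_derivative_compose[OF this der]
    show ?thesis by (simp add: has_field_derivative_def scaleR mult_commute_abs)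
  qed
  have D0: "\<psi>' x b = 0" if "x \<notin> K" for x
  proof -
    have "(\<psi> has_derivative (\<lambda>_. 0)) (at x)"
      by (rule has_derivative_transform_within_open[where f = "\<lambda>_. 0" and s = "- K"])
         (use K that in \<open>auto simp: compact_imp_closed open_Compl\<close>)
    from has_derivative_unique[OF der this] show ?thesis by simp
  qed
  have "bounded ((\<lambda>x. \<psi>' x b) ` K)"
    by (intro compact_imp_bounded compact_continuous_image continuous_on_subset[OF cont] K(1)) auto
  then obtain C where C: "C > 0" "\<And>x. x \<in> K \<Longrightarrow> \<bar>\<psi>' x b\<bar> \<le> C" by (auto simp: bounded_pos)
  then have C': "\<bar>\<psi>' x b\<bar> \<le> C" for x using D0[of x] by (cases "x \<in> K") auto
  obtain R where R: "\<And>x. x \<in> K \<Longrightarrow> norm x \<le> R"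
    using compact_imp_bounded[OF K(1)] by (auto simp: bounded_iff)
  define q where "q n x = (\<psi> (x + (1 / real (Suc n)) *\<^sub>R b) - \<psi> x) * real (Suc n)" for n x
  have cont\<psi>: "continuous_on UNIV \<psi>"
    by (intro continuous_at_imp_continuous_on ballI has_derivative_continuous[OF der])
  have [measurable]: "\<psi> \<in> borel_measurable borel" "(\<lambda>x. \<psi>' x b) \<in> borel_measurable borel"
    using cont\<psi> cont by (auto intro: borel_measurable_continuous_onI)
  have \<psi>int: "integrable lborel \<psi>"
  proof -
    have "integrable lborel (\<lambda>x. indicator K x *\<^sub>R \<psi> x)"
      using borel_integrable_compact[OF K(1) continuous_on_subset[OF cont\<psi>]] by (simp add: indicator_def if_distrib cong: if_cong)
    also have "(\<lambda>x. indicator K x *\<^sub>R \<psi> x) = \<psi>" using K(2) by (auto simp: indicator_def fun_eq_iff)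
    finally show ?thesis .
  qed
  have q_bound: "\<bar>q n x\<bar> \<le> C * indicator (cball 0 (R + norm b)) x" for n x
  proof (cases "x \<in> cball 0 (R + norm b)")
    case True
    have "\<exists>z>0. z < 1 / real (Suc n) \<and> \<psi> (x + (1 / real (Suc n)) *\<^sub>R b) - \<psi> (x + 0 *\<^sub>R b)
        = (1 / real (Suc n) - 0) * \<psi>' (x + z *\<^sub>R b) b"
      by (rule MVT2) (auto intro: ray)
    then obtain z where "q n x = \<psi>' (x + z *\<^sub>R b) b" unfolding q_def by auto
    then show ?thesis using C'[of "x + z *\<^sub>R b"] True by simp
  next
    case False
    have "norm ((1 / real (Suc n)) *\<^sub>R b) \<le> norm b" by (simp add: field_simps)
    then have "norm (x + (1 / real (Suc n)) *\<^sub>R b) > R"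
      using False norm_diff_ineq[of x "(1 / real (Suc n)) *\<^sub>R b"] by simp
    moreover have "norm x > R" using False norm_ge_zero[of b] by (simp del: norm_ge_zero)
    ultimately have "x \<notin> K" "x + (1 / real (Suc n)) *\<^sub>R b \<notin> K" using R by fastforce+
    then show ?thesis using K(2) False by (simp add: q_def)
  qed
  have q_lim: "(\<lambda>n. q n x) \<longlonglongrightarrow> \<psi>' x b" for x
  proof -
    have "((\<lambda>h. (\<psi> (x + (0 + h) *\<^sub>R b) - \<psi> (x + 0 *\<^sub>R b)) / h) \<longlongrightarrow> \<psi>' (x + 0 *\<^sub>R b) b) (at 0)"
      using ray[of x 0] unfolding DERIV_def .
    then have "((\<lambda>h. (\<psi> (x + h *\<^sub>R b) - \<psi> x) / h) \<longlongrightarrow> \<psi>' x b) (at 0)" by simp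
    moreover have "filterlim (\<lambda>n. 1 / real (Suc n)) (at 0) sequentially"
      using LIMSEQ_inverse_real_of_nat by (auto simp: filterlim_at inverse_eq_divide)
    ultimately have "(\<lambda>n. (\<psi> (x + (1 / real (Suc n)) *\<^sub>R b) - \<psi> x) / (1 / real (Suc n))) \<longlonglongrightarrow> \<psi>' x b"
      by (rule filterlim_compose)
    then show ?thesis by (simp add: q_def)
  qed
  have "(\<lambda>n. LINT x|lborel. q n x) \<longlonglongrightarrow> (LINT x|lborel. \<psi>' x b)"
  proof (rule integral_dominated_convergence[where w = "\<lambda>x. C * indicator (cball 0 (R + norm b)) x"])
    show "q n \<in> borel_measurable lborel" for n unfolding q_def by measurable
    show "integrable lborel (\<lambda>x::'a. C * indicator (cball 0 (R + norm b)) x :: real)"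
      using emeasure_bounded_finite[of "cball 0 (R + norm b) :: 'a set"] by (intro integrable_mult_right integrable_real_indicator) auto
  qed (use q_bound q_lim in auto)
  moreover have "(LINT x|lborel. q n x) = 0" for n
  proof -
    let ?c = "(1 / real (Suc n)) *\<^sub>R b"
    have eq: "(LINT x|lborel. \<psi> (?c + x)) = (LINT x|lborel. \<psi> x)"
      using integral_distr[of "(+) ?c" lborel borel \<psi>] by (simp add: lborel_distr_plus)
    have "integrable lborel (\<lambda>x. \<psi> (?c + x))"
      using integrable_distr_eq[of "(+) ?c" lborel borel \<psi>] \<psi>int by (simp add: lborel_distr_plus)
    then show ?thesis using \<psi>int eq by (simp add: q_def add.commute)
  qed
  ultimately have "(\<lambda>n::nat. 0::real) \<longlonglongrightarrow> (LINT x|lborel. \<psi>' x b)" by (simp only:)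
  then show ?thesis by (rule LIMSEQ_unique[OF _ tendsto_const])
qed

lemma continuous_imp_absolutely_integrable_on_compact:
  fixes f :: "'a::euclidean_space \<Rightarrow> 'b::euclidean_space"
  assumes "continuous_on UNIV f" "compact K"
  shows "f absolutely_integrable_on K"
proof -
  obtain a where "K \<subseteq> cbox (-a) a"
    using bounded_subset_cbox_symmetric[OF compact_imp_bounded[OF assms(2)]] by metis
  moreover have "f absolutely_integrable_on cbox (-a) a"
    using assms(1) by (intro absolutely_integrable_continuous) (rule continuous_on_subset, auto)
  ultimately show ?thesis
    using assms(2) set_integrable_subset[of lebesgue "cbox (-a) a" f K]
    by (auto simp: lmeasurable_compact fmeasurableD)
qed

lemma has_weak_gradient_on_C1:
  fixes v :: "'a::euclidean_space \<Rightarrow> real"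
  assumes "open S" and der: "\<And>x. (v has_derivative (\<lambda>h. G x \<bullet> h)) (at x)"
    and G: "continuous_on UNIV G"
  shows "has_weak_gradient_on v G S"
  unfolding has_weak_gradient_on_def
proof (intro conjI allI ballI impI)
  have v: "continuous_on UNIV v"
    by (intro continuous_at_imp_continuous_on ballI has_derivative_continuous[OF der])
  show abs: "v absolutely_integrable_on K" "G absolutely_integrable_on K" if "compact K \<and> K \<subseteq> S" for K
    using v G that by (auto intro: continuous_imp_absolutely_integrable_on_compact)
  fix \<phi> and b :: 'a assume \<phi>: "\<phi> \<in> test_functions S" and "b \<in> Basis"
  obtain K where K: "compact K" "K \<subseteq> S" "\<And>x. x \<notin> K \<Longrightarrow> \<phi> x = 0"
    using test_functionsE[OF \<phi>] by metis
  let ?D = "\<lambda>x. frechet_derivative \<phi> (at x) b"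
  have D: "?D \<in> test_functions S" using \<phi> by (rule test_functions_derivative)
  have D0: "?D x = 0" if "x \<notin> S" for x
    using D that closure_subset[of "{x. ?D x \<noteq> 0}"] by (auto simp: test_functions_def)
  have "(\<lambda>x. G x \<bullet> b) absolutely_integrable_on K" if "compact K" for K
    using that G by (intro continuous_imp_absolutely_integrable_on_compact continuous_intros)
  then have int: "integrable (lebesgue_on S) (\<lambda>x. v x * ?D x)" "integrable (lebesgue_on S) (\<lambda>x. (G x \<bullet> b) * \<phi> x)"
    by (auto intro!: integrable_times_test_function assms(1) D \<phi> abs)
  have cont: "continuous_on UNIV (\<lambda>x. v x * ?D x + (G x \<bullet> b) * \<phi> x)"
    using v G test_functions_continuous[OF D] test_functions_continuous[OF \<phi>]
    by (intro continuous_intros) auto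
  have "0 = (LINT x|lborel. v x * ?D x + (G x \<bullet> b) * \<phi> x)"
    using integral_directional_derivative_eq_0[OF has_derivative_mult[OF der test_functions_has_derivative[OF \<phi>]] cont K(1)] K(3)
    by simp
  also have "\<dots> = (LINT x|lebesgue. v x * ?D x + (G x \<bullet> b) * \<phi> x)"
    by (rule integral_completion[symmetric]) (use cont in \<open>auto intro: borel_measurable_continuous_onI\<close>)
  also have "\<dots> = (LINT x|lebesgue_on S. v x * ?D x + (G x \<bullet> b) * \<phi> x)"
    using D0 K(3)[OF contra_subsetD[OF K(2)]] assms(1)
    by (subst integral_restrict_space) (auto simp: indicator_def intro!: Bochner_Integration.integral_cong)
  also have "\<dots> = (LINT x|lebesgue_on S. v x * ?D x) + (LINT x|lebesgue_on S. (G x \<bullet> b) * \<phi> x)"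
    using int by simp
  finally show "(LINT x|lebesgue_on S. v x * ?D x) = - (LINT x|lebesgue_on S. (G x \<bullet> b) * \<phi> x)" by simp
qed

lemma has_weak_gradient_on_scale_shift:
  assumes "open S" and v: "has_weak_gradient_on v g S"
  shows "has_weak_gradient_on (\<lambda>x. t * (v x - c)) (\<lambda>x. t *\<^sub>R g x) S"
  unfolding has_weak_gradient_on_def
proof (intro conjI allI ballI impI)
  have const: "has_weak_gradient_on (\<lambda>_. c) (\<lambda>_. 0) S"
    by (rule has_weak_gradient_on_C1[OF assms(1)]) auto
  show "(\<lambda>x. t * (v x - c)) absolutely_integrable_on K" if "compact K \<and> K \<subseteq> S" for K
    using that by (intro set_integrable_mult_right set_integral_diff(1) has_weak_gradient_onD[OF v] has_weak_gradient_onD[OF const]) auto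
  show "(\<lambda>x. t *\<^sub>R g x) absolutely_integrable_on K" if "compact K \<and> K \<subseteq> S" for K
    using that v by (intro absolutely_integrable_scaleR_left) (auto simp: has_weak_gradient_on_def)
  fix \<phi> and b :: 'a assume \<phi>: "\<phi> \<in> test_functions S" and "b \<in> Basis"
  let ?D = "\<lambda>x. frechet_derivative \<phi> (at x) b"
  have "(LINT x|lebesgue_on S. t * (v x - c) * ?D x) = (LINT x|lebesgue_on S. t * (v x * ?D x - c * ?D x))"
    by (simp add: algebra_simps)
  also have "\<dots> = t * ((LINT x|lebesgue_on S. v x * ?D x) - (LINT x|lebesgue_on S. c * ?D x))"
    using weak_gradient_integrable_products(2)[OF v assms(1) \<phi>]
      weak_gradient_integrable_products(2)[OF const assms(1) \<phi>] by simp
  also have "\<dots> = - (LINT x|lebesgue_on S. t *\<^sub>R ((g x \<bullet> b) * \<phi> x))"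
    using weak_gradient_direction[OF v assms(1) \<phi>, of b] weak_gradient_direction[OF const assms(1) \<phi>, of b]
    by (simp del: Bochner_Integration.integral_mult_right_zero add: Bochner_Integration.integral_mult_right_zero[of _ t])
  finally show "(LINT x|lebesgue_on S. t * (v x - c) * ?D x) = - (LINT x|lebesgue_on S. (t *\<^sub>R g x \<bullet> b) * \<phi> x)"
    by (simp add: mult.assoc)
qed

section \<open>Restriction of an antisymmetric function to a half space\<close>

text \<open>The reflection in the hyperplane orthogonal to the unit vector \<open>e\<close>.\<close>

definition mirror :: "'a::euclidean_space \<Rightarrow> 'a \<Rightarrow> 'a" where
  "mirror e x = x - (2 * (x \<bullet> e)) *\<^sub>R e"

lemma bounded_linear_mirror: "bounded_linear (mirror e)"
  unfolding mirror_def
  by (intro bounded_linear_sub bounded_linear_ident bounded_linear_scaleR_left[THEN bounded_linear_compose]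
      bounded_linear_const_mult bounded_linear_inner_left)

context
  fixes e :: "'a::euclidean_space"
  assumes e: "e \<in> Basis"
begin

lemma mirror_inner: "mirror e x \<bullet> e = - (x \<bullet> e)"
  using e by (simp add: mirror_def inner_diff_left)

lemma mirror_mirror [simp]: "mirror e (mirror e x) = x"
  using e by (simp add: mirror_def inner_diff_left algebra_simps flip: scaleR_left_distrib)

lemma mirror_inner_swap: "mirror e x \<bullet> y = x \<bullet> mirror e y"
  by (simp add: mirror_def inner_diff_left inner_diff_right inner_commute mult_ac)

lemma norm_mirror [simp]: "norm (mirror e x) = norm x"
  by (simp add: norm_eq_sqrt_inner mirror_inner_swap)

text \<open>The coordinate form in which the transformation rule of Lebesgue measure applies.\<close>

lemma mirror_eq_sum: "mirror e = (\<lambda>x. 0 + (\<Sum>j\<in>Basis. ((if j = e then -1 else 1) * (x \<bullet> j)) *\<^sub>R j))"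
proof
  fix x :: 'a
  have "x = (\<Sum>j\<in>Basis. (x \<bullet> j) *\<^sub>R j)" by (simp add: euclidean_representation)
  moreover have "(2 * (x \<bullet> e)) *\<^sub>R e = (\<Sum>j\<in>Basis. (if j = e then 2 * (x \<bullet> e) else 0) *\<^sub>R j)"
    using e by (simp add: if_distrib[of "\<lambda>c. c *\<^sub>R _"] cong: if_cong)
  ultimately have "mirror e x = (\<Sum>j\<in>Basis. (x \<bullet> j) *\<^sub>R j - (if j = e then 2 * (x \<bullet> e) else 0) *\<^sub>R j)"
    unfolding mirror_def sum_subtractf by metis
  also have "\<dots> = (\<Sum>j\<in>Basis. ((if j = e then -1 else 1) * (x \<bullet> j)) *\<^sub>R j)"
    by (intro sum.cong) (auto simp: algebra_simps simp flip: scaleR_left_distrib)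
  finally show "mirror e x = 0 + (\<Sum>j\<in>Basis. ((if j = e then -1 else 1) * (x \<bullet> j)) *\<^sub>R j)" by simp
qed

lemma mirror_measurable [measurable]: "mirror e \<in> lebesgue \<rightarrow>\<^sub>M lebesgue"
  unfolding mirror_eq_sum by (rule lebesgue_affine_measurable) auto

lemma mirror_distr: "distr lebesgue lebesgue (mirror e) = lebesgue"
  using lebesgue_affine_euclidean[of "\<lambda>j. if j = e then -1 else 1" 0]
  unfolding mirror_eq_sum[symmetric] by (simp add: if_distrib[of abs] density_1 cong: if_cong)

lemma mirror_integrable:
  fixes f :: "'a \<Rightarrow> 'b::euclidean_space"
  assumes "open S" "\<And>x. x \<in> S \<Longrightarrow> mirror e x \<in> S" "integrable (lebesgue_on S) f"
  shows "integrable (lebesgue_on S) (\<lambda>x. f (mirror e x))"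
    and "(LINT x|lebesgue_on S. f (mirror e x)) = (LINT x|lebesgue_on S. f x)"
proof -
  let ?f = "\<lambda>x. indicator S x *\<^sub>R f x"
  have f: "integrable lebesgue ?f" using assms by (simp add: integrable_restrict_space)
  have eq: "?f (mirror e x) = indicator S x *\<^sub>R f (mirror e x)" for x
    using assms(2)[of x] assms(2)[of "mirror e x"] by (auto simp: indicator_def)
  have "integrable lebesgue (\<lambda>x. ?f (mirror e x))"
    using f by (subst integrable_distr_eq[symmetric, where N = lebesgue]) (auto simp: mirror_distr)
  then show "integrable (lebesgue_on S) (\<lambda>x. f (mirror e x))"
    unfolding eq using assms(1) by (simp add: integrable_restrict_space)
  have "(LINT x|lebesgue. ?f (mirror e x)) = (LINT x|lebesgue. ?f x)"
    using f integral_distr[of "mirror e" lebesgue lebesgue ?f] by (simp add: mirror_distr)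
  then show "(LINT x|lebesgue_on S. f (mirror e x)) = (LINT x|lebesgue_on S. f x)"
    unfolding eq using assms(1) by (simp add: integral_restrict_space)
qed

lemma AE_off_mirror_axis: "open S \<Longrightarrow> AE x in lebesgue_on S. x \<bullet> e \<noteq> 0"
proof -
  assume "open S"
  have "e \<noteq> 0" using e by auto
  then have "{x. e \<bullet> x = 0} \<in> null_sets lebesgue"
    using negligible_hyperplane[of e 0] by (simp add: negligible_iff_null_sets)
  then have "AE x in lebesgue. x \<bullet> e \<noteq> 0"
    by (rule AE_I') (auto simp: inner_commute)
  then show ?thesis using \<open>open S\<close> by (auto simp: AE_restrict_space_iff elim: eventually_mono)
qed

lemma half_indicator_measurable:
  "open S \<Longrightarrow> {x. x \<bullet> e > 0} \<inter> space (lebesgue_on S) \<in> sets (lebesgue_on S)"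
proof -
  assume "open S"
  moreover have "open {x. x \<bullet> e > 0}" by (intro open_Collect_less continuous_intros)
  ultimately have "{x. x \<bullet> e > 0} \<inter> S \<in> sets borel" by auto
  then have "{x. x \<bullet> e > 0} \<inter> S \<in> sets lebesgue" by simp
  then show ?thesis using \<open>open S\<close> by (auto simp: sets_restrict_space_iff space_restrict_space)
qed

lemma half_integrable:
  fixes f :: "'a \<Rightarrow> 'b::euclidean_space"
  assumes "open S" "integrable (lebesgue_on S) f"
  shows "integrable (lebesgue_on S) (\<lambda>x. if x \<bullet> e > 0 then f x else 0)"
proof -
  have "(\<lambda>x. indicator ({x. x \<bullet> e > 0} \<inter> space (lebesgue_on S)) x *\<^sub>R f x) \<in> borel_measurable (lebesgue_on S)"
    using half_indicator_measurable[OF assms(1)] assms(2)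
    by (intro borel_measurable_scaleR borel_measurable_indicator) auto
  then have "(\<lambda>x. if x \<bullet> e > 0 then f x else 0) \<in> borel_measurable (lebesgue_on S)"
    by (rule measurable_cong[THEN iffD1, rotated]) (auto simp: indicator_def)
  then show ?thesis
    by (intro Bochner_Integration.integrable_bound[OF assms(2)]) auto
qed

text \<open>The half \<open>x \<bullet> e \<le> 0\<close> is reflected onto the other one; the axis itself has measure zero.\<close>

lemma integral_fold_mirror:
  fixes f fm :: "'a \<Rightarrow> real"
  assumes S: "open S" "\<And>x. x \<in> S \<Longrightarrow> mirror e x \<in> S"
    and f: "integrable (lebesgue_on S) f" and fm: "integrable (lebesgue_on S) fm"
    and eq: "AE x in lebesgue_on S. f (mirror e x) = fm x"
  shows "(LINT x|lebesgue_on S. f x) = (LINT x|lebesgue_on S. (if x \<bullet> e > 0 then f x else 0)) +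
    (LINT x|lebesgue_on S. (if x \<bullet> e > 0 then fm x else 0))"
proof -
  let ?N = "\<lambda>x. if x \<bullet> e > 0 then 0 else f x"
  have P: "integrable (lebesgue_on S) (\<lambda>x. if x \<bullet> e > 0 then f x else 0)"
    using half_integrable[OF S(1) f] .
  have N_eq: "?N = (\<lambda>x. f x - (if x \<bullet> e > 0 then f x else 0))" by auto
  have N: "integrable (lebesgue_on S) ?N" unfolding N_eq using f P by simp
  have "(LINT x|lebesgue_on S. f x) = (LINT x|lebesgue_on S. (if x \<bullet> e > 0 then f x else 0) + ?N x)"
    by (intro Bochner_Integration.integral_cong) auto
  also have "\<dots> = (LINT x|lebesgue_on S. (if x \<bullet> e > 0 then f x else 0)) + (LINT x|lebesgue_on S. ?N (mirror e x))"
    using P N mirror_integrable(2)[OF S N] by simp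
  also have "(LINT x|lebesgue_on S. ?N (mirror e x)) = (LINT x|lebesgue_on S. (if x \<bullet> e > 0 then fm x else 0))"
  proof (rule integral_cong_AE)
    show "AE x in lebesgue_on S. ?N (mirror e x) = (if x \<bullet> e > 0 then fm x else 0)"
      using AE_off_mirror_axis[OF S(1)] eq by eventually_elim (auto simp: mirror_inner)
  qed (use mirror_integrable(1)[OF S N] half_integrable[OF S(1) fm] in auto)
  finally show ?thesis .
qed

lemma test_functions_mirror:
  assumes "\<And>x. x \<in> S \<Longrightarrow> mirror e x \<in> S" "\<phi> \<in> test_functions S"
  shows "(\<lambda>x. \<phi> (mirror e x)) \<in> test_functions S"
    and "frechet_derivative (\<lambda>x. \<phi> (mirror e x)) (at x) h = frechet_derivative \<phi> (at (mirror e x)) (mirror e h)"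
proof -
  have "closure {x. \<phi> x \<noteq> 0} \<subseteq> S" using assms(2) by (auto simp: test_functions_def)
  then show "(\<lambda>x. \<phi> (mirror e x)) \<in> test_functions S"
    using test_functions_affine[OF assms(2) bounded_linear_mirror[of e] bounded_linear_mirror[of e], of 0 S] assms(1)
    by auto
  have "((\<lambda>x. \<phi> (mirror e x)) has_derivative (\<lambda>h. frechet_derivative \<phi> (at (mirror e x)) (mirror e h))) (at x)"
    by (rule has_derivative_compose[OF bounded_linear_imp_has_derivative[OF bounded_linear_mirror] test_functions_has_derivative[OF assms(2)]])
  from frechet_derivative_at[OF this]
  show "frechet_derivative (\<lambda>x. \<phi> (mirror e x)) (at x) h = frechet_derivative \<phi> (at (mirror e x)) (mirror e h)"
    by metis
qed

text \<open>Reflecting the integral identity shows that \<open>- mirror e (g (mirror e x))\<close> is another weak gradient of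
  the antisymmetric function \<open>v\<close>, and weak gradients are unique.\<close>

lemma weak_gradient_mirror:
  assumes S: "open S" "\<And>x. x \<in> S \<Longrightarrow> mirror e x \<in> S"
    and int: "integrable (lebesgue_on S) v" "integrable (lebesgue_on S) g"
    and v: "has_weak_gradient_on v g S" and anti: "AE x in lebesgue_on S. v (mirror e x) = - v x"
  shows "AE x in lebesgue_on S. g (mirror e x) = - mirror e (g x)"
proof -
  have [measurable]: "v \<in> borel_measurable (lebesgue_on S)" "g \<in> borel_measurable (lebesgue_on S)"
    using int by auto
  have lin: "bounded_linear (\<lambda>y. - mirror e y)"
    using bounded_linear_minus[OF bounded_linear_mirror] .
  have gint: "integrable (lebesgue_on S) (\<lambda>x. - mirror e (g (mirror e x)))"
    using integrable_bounded_linear[OF lin mirror_integrable(1)[OF S int(2)]] .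
  have "has_weak_gradient_on v (\<lambda>x. - mirror e (g (mirror e x))) S"
  proof (rule has_weak_gradient_onI[OF S(1) int(1) gint])
    fix \<phi> and b :: 'a assume \<phi>: "\<phi> \<in> test_functions S" and "b \<in> Basis"
    note \<phi>m = test_functions_mirror[OF S(2) \<phi>]
    note prod = weak_gradient_integrable_products[OF v S(1)]
    have "(LINT x|lebesgue_on S. v x * frechet_derivative \<phi> (at x) b) =
        (LINT x|lebesgue_on S. v (mirror e x) * frechet_derivative \<phi> (at (mirror e x)) b)"
      by (rule mirror_integrable(2)[OF S prod(2)[OF \<phi>], symmetric])
    also have "\<dots> = (LINT x|lebesgue_on S. - (v x * frechet_derivative (\<lambda>x. \<phi> (mirror e x)) (at x) (mirror e b)))"
    proof (rule integral_cong_AE)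
      show "AE x in lebesgue_on S. v (mirror e x) * frechet_derivative \<phi> (at (mirror e x)) b =
          - (v x * frechet_derivative (\<lambda>x. \<phi> (mirror e x)) (at x) (mirror e b))"
        using anti by eventually_elim (simp add: \<phi>m(2))
      show "(\<lambda>x. v (mirror e x) * frechet_derivative \<phi> (at (mirror e x)) b) \<in> borel_measurable (lebesgue_on S)"
        using mirror_integrable(1)[OF S prod(2)[OF \<phi>]] by auto
      show "(\<lambda>x. - (v x * frechet_derivative (\<lambda>x. \<phi> (mirror e x)) (at x) (mirror e b))) \<in> borel_measurable (lebesgue_on S)"
        using prod(2)[OF \<phi>m(1), of "mirror e b"] by auto
    qed
    also have "\<dots> = (LINT x|lebesgue_on S. (g x \<bullet> mirror e b) * \<phi> (mirror e x))"
      using weak_gradient_direction[OF v S(1) \<phi>m(1), of "mirror e b"] by simp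
    also have "\<dots> = (LINT x|lebesgue_on S. (g (mirror e x) \<bullet> mirror e b) * \<phi> (mirror e (mirror e x)))"
      by (rule mirror_integrable(2)[OF S prod(3)[OF \<phi>m(1)], symmetric])
    also have "\<dots> = - (LINT x|lebesgue_on S. (- mirror e (g (mirror e x)) \<bullet> b) * \<phi> x)"
      by (simp add: mirror_inner_swap)
    finally show "(LINT x|lebesgue_on S. v x * frechet_derivative \<phi> (at x) b) =
        - (LINT x|lebesgue_on S. (- mirror e (g (mirror e x)) \<bullet> b) * \<phi> x)" .
  qed
  from has_weak_gradient_on_unique[OF S(1) v this] show ?thesis
  proof eventually_elim
    case (elim x)
    then have "mirror e (g x) = mirror e (- mirror e (g (mirror e x)))" by (rule arg_cong)
    also have "\<dots> = - mirror e (mirror e (g (mirror e x)))"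
      using bounded_linear_mirror[of e] by (simp add: linear_simps)
    finally show ?case by simp
  qed
qed

text \<open>Multiply \<open>\<psi>\<close> by a cut-off \<open>\<eta>\<^sub>n\<close> that increases to the indicator of the half space. Differentiating the
  cut-off produces an extra term with a factor of size \<open>n\<close> near the axis. The assumption on \<open>\<psi>\<close> makes
  it vanish in the limit: either the derivative is tangential, or \<open>\<psi>\<close> vanishes on the axis.\<close>

lemma half_weak_gradient_aux:
  assumes "open S" and int: "integrable (lebesgue_on S) v" "integrable (lebesgue_on S) g"
    and v: "has_weak_gradient_on v g S"
    and \<psi>: "\<psi> \<in> test_functions S" "\<And>x. \<bar>(h \<bullet> e) * \<psi> x\<bar> \<le> C * \<bar>x \<bullet> e\<bar>"
  shows "(LINT x|lebesgue_on S. (if x \<bullet> e > 0 then v x * frechet_derivative \<psi> (at x) h else 0)) =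
    - (LINT x|lebesgue_on S. (if x \<bullet> e > 0 then (g x \<bullet> h) * \<psi> x else 0))"
proof -
  let ?D = "\<lambda>x. frechet_derivative \<psi> (at x) h"
  define \<eta> where "\<eta> n x = step (real n * (x \<bullet> e))" for n and x :: 'a
  define \<eta>' where "\<eta>' n x = (if real n * (x \<bullet> e) > 0 then exp (- (1 / (real n * (x \<bullet> e)))) / (real n * (x \<bullet> e))\<^sup>2 else 0) * real n"
    for n and x :: 'a
  note prod = weak_gradient_integrable_products[OF v assms(1) \<psi>(1)]
  have C_k_\<eta>: "C_k k (\<eta> n)" for k n
    using C_k_step[OF C_k_inner[of k "real n *\<^sub>R e"]] by (simp add: \<eta>_def[abs_def])
  have \<eta>_der: "(\<eta> n has_derivative (\<lambda>h. \<eta>' n x * (h \<bullet> e))) (at x)" for n x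
  proof -
    have "((\<lambda>x. real n * (x \<bullet> e)) has_derivative (\<lambda>h. real n * (h \<bullet> e))) (at x)"
      by (auto intro!: derivative_eq_intros)
    from has_derivative_compose[OF this step_deriv[unfolded has_field_derivative_def]]
    show ?thesis by (simp add: \<eta>_def[abs_def] \<eta>'_def mult.assoc)
  qed
  have \<eta>_meas[measurable]: "\<eta> n \<in> borel_measurable (lebesgue_on S)" for n
    using C_k_imp_continuous[OF C_k_\<eta>[of 0 n]]
    by (auto intro!: measurable_restrict_space1 measurable_completion borel_measurable_continuous_onI)
  have test: "(\<lambda>x. \<eta> n x * \<psi> x) \<in> test_functions S" for n
  proof -
    obtain K where "compact K" "K \<subseteq> S" "\<And>x. x \<notin> K \<Longrightarrow> \<psi> x = 0"
      using test_functionsE[OF \<psi>(1)] by metis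
    then show ?thesis
      by (intro test_functionsI[of _ K] C_k_mult C_k_\<eta> test_functions_C_k[OF \<psi>(1)]) auto
  qed
  have test_der: "frechet_derivative (\<lambda>x. \<eta> n x * \<psi> x) (at x) h = \<eta> n x * ?D x + \<eta>' n x * ((h \<bullet> e) * \<psi> x)" for n x
    by (subst frechet_derivative_at[OF has_derivative_mult[OF \<eta>_der[of n x] test_functions_has_derivative[OF \<psi>(1)]], symmetric])
       (simp add: mult.assoc)
  have lim: "(\<lambda>n. LINT x|lebesgue_on S. \<eta> n x * f x) \<longlonglongrightarrow> (LINT x|lebesgue_on S. (if x \<bullet> e > 0 then f x else 0))"
    and int\<eta>: "integrable (lebesgue_on S) (\<lambda>x. \<eta> n x * f x)"
    if f: "integrable (lebesgue_on S) f" for f n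
  proof -
    have b: "norm (\<eta> n x * f x) \<le> \<bar>f x\<bar>" for n x
      by (auto simp: \<eta>_def abs_mult step_bounds intro!: mult_left_le_one_le)
    show "integrable (lebesgue_on S) (\<lambda>x. \<eta> n x * f x)"
      using b f by (intro Bochner_Integration.integrable_bound[OF integrable_abs[OF f]]) auto
    show "(\<lambda>n. LINT x|lebesgue_on S. \<eta> n x * f x) \<longlonglongrightarrow> (LINT x|lebesgue_on S. (if x \<bullet> e > 0 then f x else 0))"
    proof (rule integral_dominated_convergence[where w = "\<lambda>x. \<bar>f x\<bar>"])
      show "AE x in lebesgue_on S. (\<lambda>n. \<eta> n x * f x) \<longlonglongrightarrow> (if x \<bullet> e > 0 then f x else 0)"
      proof (rule AE_I2)
        fix x
        have "(\<lambda>n. \<eta> n x * f x) \<longlonglongrightarrow> (if x \<bullet> e > 0 then 1 else 0) * f x"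
          unfolding \<eta>_def by (intro tendsto_mult step_dilation_tendsto tendsto_const)
        then show "(\<lambda>n. \<eta> n x * f x) \<longlonglongrightarrow> (if x \<bullet> e > 0 then f x else 0)"
          by (auto split: if_splits)
      qed
    qed (use f b half_integrable[OF assms(1) f] in auto)
  qed
  \<comment> \<open>With \<open>y = n (x \<bullet> e)\<close> the extra term is bounded by a multiple of \<open>exp(-1/y) / y\<close>, which is at most \<open>1\<close>
    and tends to \<open>0\<close> as \<open>y\<close> grows.\<close>
  have cut: "\<bar>\<eta>' n x * ((h \<bullet> e) * \<psi> x)\<bar> \<le> \<bar>C\<bar>" and cut_lim: "(\<lambda>n. \<eta>' n x * ((h \<bullet> e) * \<psi> x)) \<longlonglongrightarrow> 0" for n x
  proof -
    have bound: "\<bar>\<eta>' n x * ((h \<bullet> e) * \<psi> x)\<bar> \<le> \<bar>C\<bar> * (if real n * (x \<bullet> e) > 0 then exp (- (1 / (real n * (x \<bullet> e)))) / (real n * (x \<bullet> e)) else 0)" for n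
    proof (cases "real n * (x \<bullet> e) > 0")
      case True
      then have pos: "x \<bullet> e > 0" "real n > 0" by (auto simp: zero_less_mult_iff)
      have "\<bar>\<eta>' n x * ((h \<bullet> e) * \<psi> x)\<bar> = \<eta>' n x * \<bar>(h \<bullet> e) * \<psi> x\<bar>"
        using True by (simp add: \<eta>'_def abs_mult)
      also have "\<dots> \<le> \<eta>' n x * (\<bar>C\<bar> * \<bar>x \<bullet> e\<bar>)"
      proof (rule mult_left_mono)
        show "\<bar>(h \<bullet> e) * \<psi> x\<bar> \<le> \<bar>C\<bar> * \<bar>x \<bullet> e\<bar>"
          by (rule order_trans[OF \<psi>(2)]) (intro mult_right_mono; simp)
      qed (use True in \<open>simp add: \<eta>'_def\<close>)
      also have "\<dots> = \<bar>C\<bar> * (exp (- (1 / (real n * (x \<bullet> e)))) / (real n * (x \<bullet> e)))"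
        using True pos by (simp add: \<eta>'_def power2_eq_square field_simps)
      finally show ?thesis using True by simp
    qed (simp add: \<eta>'_def)
    have "exp (- (1 / t)) / t \<le> 1" if "t > 0" for t :: real
    proof -
      have "1 / t \<le> exp (1 / t)" using exp_ge_add_one_self[of "1 / t"] by linarith
      then show ?thesis using that by (simp add: exp_minus field_simps)
    qed
    then have "\<bar>C\<bar> * (if real n * (x \<bullet> e) > 0 then exp (- (1 / (real n * (x \<bullet> e)))) / (real n * (x \<bullet> e)) else 0) \<le> \<bar>C\<bar> * 1"
      by (intro mult_left_mono) auto
    then show "\<bar>\<eta>' n x * ((h \<bullet> e) * \<psi> x)\<bar> \<le> \<bar>C\<bar>" using bound[of n] by linarith
    have "(\<lambda>n. \<bar>C\<bar> * (if real n * (x \<bullet> e) > 0 then exp (- (1 / (real n * (x \<bullet> e)))) / (real n * (x \<bullet> e)) else 0)) \<longlonglongrightarrow> 0"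
    proof (cases "x \<bullet> e > 0")
      case True
      have "(\<lambda>n. \<bar>C\<bar> * (step (real n * (x \<bullet> e)) * ((1 / real n) * (1 / (x \<bullet> e))))) \<longlonglongrightarrow> \<bar>C\<bar> * ((if x \<bullet> e > 0 then 1 else 0) * (0 * (1 / (x \<bullet> e))))"
        by (intro tendsto_mult tendsto_const step_dilation_tendsto lim_1_over_n)
      moreover have "(\<lambda>n. \<bar>C\<bar> * (step (real n * (x \<bullet> e)) * ((1 / real n) * (1 / (x \<bullet> e))))) =
          (\<lambda>n. \<bar>C\<bar> * (if real n * (x \<bullet> e) > 0 then exp (- (1 / (real n * (x \<bullet> e)))) / (real n * (x \<bullet> e)) else 0))"
        by (auto simp: step_def fun_eq_iff)
      ultimately show ?thesis by (simp only: mult_zero_left mult_zero_right)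
    next
      case False
      then have "\<not> real n * (x \<bullet> e) > 0" for n by (simp add: zero_less_mult_iff)
      then show ?thesis by simp
    qed
    then show "(\<lambda>n. \<eta>' n x * ((h \<bullet> e) * \<psi> x)) \<longlonglongrightarrow> 0"
      by (rule Lim_null_comparison[rotated]) (use bound in auto)
  qed
  have prodn: "integrable (lebesgue_on S) (\<lambda>x. v x * frechet_derivative (\<lambda>x. \<eta> n x * \<psi> x) (at x) h)" for n
    using weak_gradient_integrable_products(2)[OF v assms(1) test] .
  have intc: "integrable (lebesgue_on S) (\<lambda>x. v x * (\<eta>' n x * ((h \<bullet> e) * \<psi> x)))" for n
  proof -
    have "integrable (lebesgue_on S) (\<lambda>x. v x * frechet_derivative (\<lambda>x. \<eta> n x * \<psi> x) (at x) h - \<eta> n x * (v x * ?D x))"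
      by (intro Bochner_Integration.integrable_diff prodn int\<eta> prod)
    moreover have "v x * frechet_derivative (\<lambda>x. \<eta> n x * \<psi> x) (at x) h - \<eta> n x * (v x * ?D x) =
        v x * (\<eta>' n x * ((h \<bullet> e) * \<psi> x))" for x
      unfolding test_der by (simp add: algebra_simps)
    ultimately show ?thesis by (simp only:)
  qed
  have "(\<lambda>n. LINT x|lebesgue_on S. v x * (\<eta>' n x * ((h \<bullet> e) * \<psi> x))) \<longlonglongrightarrow> (LINT x|lebesgue_on S. 0)"
  proof (rule integral_dominated_convergence[where w = "\<lambda>x. \<bar>C\<bar> * \<bar>v x\<bar>"])
    show "AE x in lebesgue_on S. (\<lambda>n. v x * (\<eta>' n x * ((h \<bullet> e) * \<psi> x))) \<longlonglongrightarrow> 0"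
      using cut_lim tendsto_mult_right_zero by blast
    show "AE x in lebesgue_on S. norm (v x * (\<eta>' n x * ((h \<bullet> e) * \<psi> x))) \<le> \<bar>C\<bar> * \<bar>v x\<bar>" for n
    proof (rule AE_I2)
      fix x
      show "norm (v x * (\<eta>' n x * ((h \<bullet> e) * \<psi> x))) \<le> \<bar>C\<bar> * \<bar>v x\<bar>"
        using mult_left_mono[OF cut[of n x] abs_ge_zero[of "v x"]] by (simp add: abs_mult mult_ac)
    qed
  qed (use int intc in auto)
  then have "(\<lambda>n. (LINT x|lebesgue_on S. \<eta> n x * (v x * ?D x)) + (LINT x|lebesgue_on S. v x * (\<eta>' n x * ((h \<bullet> e) * \<psi> x))))
      \<longlonglongrightarrow> (LINT x|lebesgue_on S. (if x \<bullet> e > 0 then v x * ?D x else 0)) + (LINT x|lebesgue_on S. 0)"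
    by (intro tendsto_add lim prod)
  moreover have "(LINT x|lebesgue_on S. \<eta> n x * (v x * ?D x)) + (LINT x|lebesgue_on S. v x * (\<eta>' n x * ((h \<bullet> e) * \<psi> x))) =
      - (LINT x|lebesgue_on S. \<eta> n x * ((g x \<bullet> h) * \<psi> x))" for n
  proof -
    have "(LINT x|lebesgue_on S. \<eta> n x * (v x * ?D x)) + (LINT x|lebesgue_on S. v x * (\<eta>' n x * ((h \<bullet> e) * \<psi> x))) =
        (LINT x|lebesgue_on S. v x * frechet_derivative (\<lambda>x. \<eta> n x * \<psi> x) (at x) h)"
      unfolding test_der distrib_left mult.left_commute[of "v _" "\<eta> n _"]
      by (rule Bochner_Integration.integral_add[symmetric, OF int\<eta>[OF prod(2)] intc])
    also have "\<dots> = - (LINT x|lebesgue_on S. \<eta> n x * ((g x \<bullet> h) * \<psi> x))"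
      using weak_gradient_direction[OF v assms(1) test] by (simp add: mult_ac)
    finally show ?thesis .
  qed
  ultimately have "(\<lambda>n. - (LINT x|lebesgue_on S. \<eta> n x * ((g x \<bullet> h) * \<psi> x))) \<longlonglongrightarrow>
      (LINT x|lebesgue_on S. (if x \<bullet> e > 0 then v x * ?D x else 0))" by simp
  from LIMSEQ_unique[OF this tendsto_minus[OF lim[OF prod(3)]]] show ?thesis .
qed

text \<open>In a direction tangential to the axis any test function satisfies the assumption of the auxiliary
  lemma. In the normal direction split the test function into its even and its odd part. The odd part
  vanishes on the axis, so the auxiliary lemma applies. For the even part the identity on the half
  space is half of the identity on the whole domain, because \<open>v\<close> is odd and the normal component of
  its gradient is even.\<close>

lemma half_weak_gradient:
  assumes S: "open S" "\<And>x. x \<in> S \<Longrightarrow> mirror e x \<in> S"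
    and int: "integrable (lebesgue_on S) v" "integrable (lebesgue_on S) g"
    and v: "has_weak_gradient_on v g S" and anti: "AE x in lebesgue_on S. v (mirror e x) = - v x"
  shows "has_weak_gradient_on (\<lambda>x. if x \<bullet> e > 0 then v x else 0) (\<lambda>x. if x \<bullet> e > 0 then g x else 0) S"
proof (rule has_weak_gradient_onI[OF S(1) half_integrable[OF S(1) int(1)] half_integrable[OF S(1) int(2)]])
  fix \<phi> and b :: 'a assume \<phi>: "\<phi> \<in> test_functions S" and b: "b \<in> Basis"
  let ?A = "\<lambda>\<phi>. LINT x|lebesgue_on S. (if x \<bullet> e > 0 then v x * frechet_derivative \<phi> (at x) b else 0)"
  let ?B = "\<lambda>\<phi>. LINT x|lebesgue_on S. (if x \<bullet> e > 0 then (g x \<bullet> b) * \<phi> x else 0)"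
  note prod = weak_gradient_integrable_products[OF v S(1)]
  have "?A \<phi> = - ?B \<phi>"
  proof (cases "b = e")
    case False
    then have "b \<bullet> e = 0" using e b by (simp add: inner_Basis)
    then show ?thesis by (intro half_weak_gradient_aux[OF S(1) int v \<phi>, of _ 0]) simp
  next
    case True
    let ?\<phi>m = "\<lambda>x. \<phi> (mirror e x)"
    note \<phi>m = test_functions_mirror[OF S(2) \<phi>]
    have be: "mirror e b = - b" using e True by (simp add: mirror_def scaleR_2)
    have der_m: "frechet_derivative ?\<phi>m (at x) b = - frechet_derivative \<phi> (at (mirror e x)) b" for x
      using has_derivative_bounded_linear[OF test_functions_has_derivative[OF \<phi>]]
      by (simp add: \<phi>m(2) be linear_simps)
    have diff_test: "(\<lambda>x. \<phi> x - ?\<phi>m x) \<in> test_functions S"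
    proof -
      obtain K K' where "compact K" "K \<subseteq> S" "\<And>x. x \<notin> K \<Longrightarrow> \<phi> x = 0" "compact K'" "K' \<subseteq> S" "\<And>x. x \<notin> K' \<Longrightarrow> ?\<phi>m x = 0"
        using test_functionsE[OF \<phi>] test_functionsE[OF \<phi>m(1)] by metis
      then show ?thesis
        by (intro test_functionsI[of _ "K \<union> K'"] C_k_diff test_functions_C_k[OF \<phi>] test_functions_C_k[OF \<phi>m(1)]) auto
    qed
    have diff_der: "frechet_derivative (\<lambda>x. \<phi> x - ?\<phi>m x) (at x) b =
        frechet_derivative \<phi> (at x) b - frechet_derivative ?\<phi>m (at x) b" for x
      using frechet_derivative_at[OF has_derivative_diff[OF test_functions_has_derivative[OF \<phi>] test_functions_has_derivative[OF \<phi>m(1)]], of x]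
      by metis
    \<comment> \<open>The odd part of the test function vanishes on the axis, at a linear rate.\<close>
    have odd: "?A (\<lambda>x. \<phi> x - ?\<phi>m x) = - ?B (\<lambda>x. \<phi> x - ?\<phi>m x)"
    proof -
      obtain C where C: "C > 0" "\<And>x. \<bar>frechet_derivative \<phi> (at x) e\<bar> \<le> C"
        using test_functions_bounded[OF test_functions_derivative[OF \<phi>]] by metis
      have "\<bar>\<phi> x - \<phi> (mirror e x)\<bar> \<le> (2 * C) * \<bar>x \<bullet> e\<bar>" for x
      proof -
        have "((\<lambda>s. \<phi> (mirror e x + s *\<^sub>R e)) has_real_derivative frechet_derivative \<phi> (at (mirror e x + s *\<^sub>R e)) e) (at s within UNIV)" for s
        proof -
          have "((\<lambda>s. mirror e x + s *\<^sub>R e) has_derivative (\<lambda>s. s *\<^sub>R e)) (at s)"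
            by (auto intro!: derivative_eq_intros)
          from has_derivative_compose[OF this test_functions_has_derivative[OF \<phi>]]
          show ?thesis
            using has_derivative_bounded_linear[OF test_functions_has_derivative[OF \<phi>]]
            by (simp add: has_field_derivative_def linear_simps mult_commute_abs)
        qed
        then have "norm (\<phi> (mirror e x + (2 * (x \<bullet> e)) *\<^sub>R e) - \<phi> (mirror e x + 0 *\<^sub>R e)) \<le> C * norm (2 * (x \<bullet> e) - 0)"
          by (rule field_differentiable_bound[of UNIV, rotated]) (use C in auto)
        then show ?thesis by (simp add: mirror_def abs_mult)
      qed
      then show ?thesis
        using e True by (intro half_weak_gradient_aux[OF S(1) int v diff_test, of _ "2 * C"]) (simp add: abs_mult)
    qed
    have "?A (\<lambda>x. \<phi> x - ?\<phi>m x) = (LINT x|lebesgue_on S. (if x \<bullet> e > 0 then v x * frechet_derivative \<phi> (at x) b else 0) -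
        (if x \<bullet> e > 0 then v x * frechet_derivative ?\<phi>m (at x) b else 0))"
      by (intro Bochner_Integration.integral_cong) (auto simp: diff_der algebra_simps)
    also have "\<dots> = ?A \<phi> - ?A ?\<phi>m"
      by (intro Bochner_Integration.integral_diff half_integrable[OF S(1)] prod(2) \<phi> \<phi>m(1))
    finally have A: "?A (\<lambda>x. \<phi> x - ?\<phi>m x) = ?A \<phi> - ?A ?\<phi>m" .
    have "?B (\<lambda>x. \<phi> x - ?\<phi>m x) = (LINT x|lebesgue_on S. (if x \<bullet> e > 0 then (g x \<bullet> b) * \<phi> x else 0) -
        (if x \<bullet> e > 0 then (g x \<bullet> b) * ?\<phi>m x else 0))"
      by (intro Bochner_Integration.integral_cong) (auto simp: algebra_simps)
    also have "\<dots> = ?B \<phi> - ?B ?\<phi>m"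
      by (intro Bochner_Integration.integral_diff half_integrable[OF S(1)] prod(3) \<phi> \<phi>m(1))
    finally have B: "?B (\<lambda>x. \<phi> x - ?\<phi>m x) = ?B \<phi> - ?B ?\<phi>m" .
    \<comment> \<open>For the even part, fold the identity on the whole domain onto the half space.\<close>
    have A': "(LINT x|lebesgue_on S. v x * frechet_derivative \<phi> (at x) b) = ?A \<phi> + ?A ?\<phi>m"
    proof (rule integral_fold_mirror[OF S(1) _ prod(2)[OF \<phi>] prod(2)[OF \<phi>m(1)]])
      show "AE x in lebesgue_on S. v (mirror e x) * frechet_derivative \<phi> (at (mirror e x)) b =
          v x * frechet_derivative ?\<phi>m (at x) b"
        using anti by eventually_elim (simp add: der_m)
    qed (rule S(2))
    have g_mirror: "AE x in lebesgue_on S. g (mirror e x) = - mirror e (g x)"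
      by (rule weak_gradient_mirror[OF S(1) _ int v anti]) (rule S(2))
    have B': "(LINT x|lebesgue_on S. (g x \<bullet> b) * \<phi> x) = ?B \<phi> + ?B ?\<phi>m"
    proof (rule integral_fold_mirror[OF S(1) _ prod(3)[OF \<phi>] prod(3)[OF \<phi>m(1)]])
      show "AE x in lebesgue_on S. (g (mirror e x) \<bullet> b) * \<phi> (mirror e x) = (g x \<bullet> b) * ?\<phi>m x"
        using g_mirror by eventually_elim (simp add: True mirror_inner)
    qed (rule S(2))
    from odd A B A' B' weak_gradient_direction[OF v S(1) \<phi>, of b] show ?thesis by linarith
  qed
  moreover have "(\<lambda>x. (if x \<bullet> e > 0 then v x else 0) * frechet_derivative \<phi> (at x) b) =
      (\<lambda>x. if x \<bullet> e > 0 then v x * frechet_derivative \<phi> (at x) b else 0)" by auto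
  moreover have "(\<lambda>x. ((if x \<bullet> e > 0 then g x else 0) \<bullet> b) * \<phi> x) =
      (\<lambda>x. if x \<bullet> e > 0 then (g x \<bullet> b) * \<phi> x else 0)" by auto
  ultimately show "(LINT x|lebesgue_on S. (if x \<bullet> e > 0 then v x else 0) * frechet_derivative \<phi> (at x) b) =
      - (LINT x|lebesgue_on S. ((if x \<bullet> e > 0 then g x else 0) \<bullet> b) * \<phi> x)"
    by (simp only:)
qed

end

section \<open>Potential estimate for functions of mean zero\<close>

text \<open>Compositions such as \<open>g (x + s *\<^sub>R h)\<close> need not be measurable when \<open>g\<close> is only Lebesgue measurable, so the
  integrations along segments below use Borel representatives.\<close>

lemma borel_representative_on:
  fixes f :: "'a::euclidean_space \<Rightarrow> 'b::euclidean_space"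
  assumes "open S" "f \<in> borel_measurable (lebesgue_on S)"
  obtains f0 where "f0 \<in> borel_measurable borel" "\<And>x. x \<notin> S \<Longrightarrow> f0 x = 0"
    "AE x in lebesgue_on S. f x = f0 x"
proof -
  have "\<exists>k. k \<in> borel_measurable lborel \<and> (AE x in lborel. indicator S x *\<^sub>R f x \<bullet> b = k x)" for b
  proof -
    have "(\<lambda>x. indicator S x *\<^sub>R f x) \<in> borel_measurable lebesgue"
      using assms by (simp add: borel_measurable_restrict_space_iff)
    then have "(\<lambda>x. indicator S x *\<^sub>R f x \<bullet> b) \<in> borel_measurable lebesgue"
      by (intro borel_measurable_inner) auto
    then show ?thesis using completion_ex_borel_measurable_real by blast
  qed
  then obtain k where k: "\<And>b. k b \<in> borel_measurable lborel" "\<And>b. AE x in lborel. indicator S x *\<^sub>R f x \<bullet> b = k b x"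
    by metis
  show ?thesis
  proof
    let ?f0 = "\<lambda>x. indicator S x *\<^sub>R (\<Sum>b\<in>Basis. k b x *\<^sub>R b)"
    have [measurable]: "k b \<in> borel_measurable borel" for b using k(1)[of b] by simp
    have [measurable]: "S \<in> sets borel" using assms(1) by simp
    show "?f0 \<in> borel_measurable borel" by measurable
    show "?f0 x = 0" if "x \<notin> S" for x using that by simp
    have "AE x in lborel. \<forall>b\<in>Basis. indicator S x *\<^sub>R f x \<bullet> b = k b x"
      using k(2) by (intro AE_finite_allI) auto
    then have "AE x in lborel. x \<in> S \<longrightarrow> f x = ?f0 x"
    proof eventually_elim
      case (elim x)
      show ?case
      proof
        assume "x \<in> S"
        then have "(\<Sum>b\<in>Basis. k b x *\<^sub>R b) = (\<Sum>b\<in>Basis. (f x \<bullet> b) *\<^sub>R b)"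
          using elim by (intro sum.cong) auto
        then show "f x = ?f0 x" using \<open>x \<in> S\<close> by (simp add: euclidean_representation)
      qed
    qed
    then have "AE x in lebesgue. x \<in> S \<longrightarrow> f x = ?f0 x"
      by (simp add: AE_completion_iff)
    then show "AE x in lebesgue_on S. f x = ?f0 x"
      using assms(1) by (simp add: AE_restrict_space_iff)
  qed
qed

lemma lborel_translation:
  fixes f :: "'a::euclidean_space \<Rightarrow> 'b::{banach, second_countable_topology}"
  assumes "f \<in> borel_measurable borel"
  shows "(LINT x|lborel. f (x + a)) = (LINT x|lborel. f x)"
    and "integrable lborel (\<lambda>x. f (x + a)) \<longleftrightarrow> integrable lborel f"
  using assms integral_distr[of "(+) a" lborel borel f] integrable_distr_eq[of "(+) a" lborel borel f]
  by (auto simp: lborel_distr_plus add.commute)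

lemma lborel_nn_translation:
  fixes f :: "'a::euclidean_space \<Rightarrow> ennreal"
  assumes "f \<in> borel_measurable borel"
  shows "(\<integral>\<^sup>+x. f (x + a) \<partial>lborel) = (\<integral>\<^sup>+x. f x \<partial>lborel)"
  using assms nn_integral_distr[of "(+) a" lborel borel f]
  by (auto simp: lborel_distr_plus add.commute)

lemma lborel_nn_dilation:
  fixes f :: "'a::euclidean_space \<Rightarrow> ennreal"
  assumes [measurable]: "f \<in> borel_measurable borel" and "s > 0"
  shows "(\<integral>\<^sup>+x. f x \<partial>lborel) = ennreal (s ^ DIM('a)) * (\<integral>\<^sup>+x. f (t + s *\<^sub>R x) \<partial>lborel)"
  using assms(2) by (subst lborel_affine[of s t])
    (simp_all add: nn_integral_density nn_integral_distr nn_integral_cmult)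

lemma integrable_unit_interval_pair:
  fixes f :: "real \<Rightarrow> 'a::euclidean_space \<Rightarrow> real"
  assumes [measurable]: "case_prod f \<in> borel_measurable (lborel \<Otimes>\<^sub>M lborel)"
    and "\<And>s. (\<integral>\<^sup>+x. ennreal \<bar>f s x\<bar> \<partial>lborel) \<le> ennreal C * indicator {0..1} s"
  shows "integrable (lborel \<Otimes>\<^sub>M lborel) (case_prod f)"
proof -
  have "(\<integral>\<^sup>+z. ennreal (norm (case_prod f z)) \<partial>(lborel \<Otimes>\<^sub>M lborel)) = (\<integral>\<^sup>+s. (\<integral>\<^sup>+x. ennreal \<bar>f s x\<bar> \<partial>lborel) \<partial>lborel)"
    by (subst lborel.nn_integral_fst[symmetric]) auto
  also have "\<dots> \<le> (\<integral>\<^sup>+s. ennreal C * indicator {0..1} s \<partial>(lborel :: real measure))"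
    by (rule nn_integral_mono) (rule assms(2))
  also have "\<dots> = ennreal C" by (simp add: nn_integral_cmult)
  also have "\<dots> < \<infinity>" by simp
  finally show ?thesis by (intro integrableI_bounded) auto
qed

text \<open>Test the difference of both sides with \<open>\<phi>\<close>. The integral of \<open>\<phi>(x) g(x + s h) \<bullet> h\<close> is, after a translation, one of
  \<open>g \<bullet> h\<close> against the test function \<open>\<phi>(x - s h)\<close>, whose support stays in \<open>S\<close> by convexity. The weak identity
  turns it into an integral of \<open>v\<close> against a derivative in \<open>s\<close>, and integrating over \<open>s\<close> gives the
  corresponding integral of \<open>v (x + h) - v x\<close>. The lemma of du Bois-Reymond concludes.\<close>

lemma weak_gradient_line_integral:
  fixes v :: "'a::euclidean_space \<Rightarrow> real" and h :: 'a
  assumes S: "open S" "convex S"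
    and v: "v \<in> borel_measurable borel" "integrable lborel v"
    and g: "g \<in> borel_measurable borel" "integrable lborel g"
    and weak: "\<And>\<phi>. \<phi> \<in> test_functions S \<Longrightarrow>
      (LINT x|lborel. v x * frechet_derivative \<phi> (at x) h) = - (LINT x|lborel. (g x \<bullet> h) * \<phi> x)"
  shows "AE x in lborel. x \<in> S \<and> x + h \<in> S \<longrightarrow>
    v (x + h) - v x = (LINT s|lborel. indicator {0..1} s * (g (x + s *\<^sub>R h) \<bullet> h))"
proof -
  note [measurable] = v(1) g(1)
  define U where "U = {x. x \<in> S \<and> x + h \<in> S}"
  have "U = S \<inter> (\<lambda>x. x + h) -` S" by (auto simp: U_def)
  then have "open U"
    using S(1) by (auto intro!: open_Int open_vimage continuous_intros)
  define G where "G s x = indicator {0..1} s * (g (x + s *\<^sub>R h) \<bullet> h)" for s :: real and x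
  have G_meas[measurable]: "case_prod G \<in> borel_measurable (lborel \<Otimes>\<^sub>M lborel)"
    unfolding G_def by measurable
  have gh: "integrable lborel (\<lambda>x. g x \<bullet> h)" using g(2) by (rule integrable_inner_left)
  have G_int: "integrable (lborel \<Otimes>\<^sub>M lborel) (case_prod G)"
  proof (rule integrable_unit_interval_pair[OF G_meas])
    fix s :: real
    have "(\<integral>\<^sup>+x. ennreal \<bar>G s x\<bar> \<partial>lborel) = (\<integral>\<^sup>+x. indicator {0..1} s * ennreal \<bar>g (x + s *\<^sub>R h) \<bullet> h\<bar> \<partial>lborel)"
      by (intro nn_integral_cong) (auto simp: G_def abs_mult indicator_def)
    also have "\<dots> = indicator {0..1} s * (\<integral>\<^sup>+x. ennreal \<bar>g (x + s *\<^sub>R h) \<bullet> h\<bar> \<partial>lborel)"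
      by (rule nn_integral_cmult) measurable
    also have "(\<integral>\<^sup>+x. ennreal \<bar>g (x + s *\<^sub>R h) \<bullet> h\<bar> \<partial>lborel) = (\<integral>\<^sup>+x. ennreal \<bar>g x \<bullet> h\<bar> \<partial>lborel)"
      by (rule lborel_nn_translation[of "\<lambda>x. ennreal \<bar>g x \<bullet> h\<bar>"]) measurable
    also have "\<dots> = ennreal (LINT x|lborel. \<bar>g x \<bullet> h\<bar>)"
      using gh by (intro nn_integral_eq_integral) auto
    finally show "(\<integral>\<^sup>+x. ennreal \<bar>G s x\<bar> \<partial>lborel) \<le> ennreal (LINT x|lborel. \<bar>g x \<bullet> h\<bar>) * indicator {0..1} s"
      by (simp add: mult.commute)
  qed
  define k where "k x = (v (x + h) - v x) - (LINT s|lborel. G s x)" for x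
  have intG: "integrable lborel (\<lambda>x. LINT s|lborel. G s x)"
    using lborel_pair.integrable_fst'[OF lborel_pair.integrable_product_swap[OF G_int]] by simp
  have vh: "integrable lborel (\<lambda>x. v (x + h))"
    using v lborel_translation(2)[of v h] by simp
  have k_int: "integrable lborel k" unfolding k_def
    by (intro Bochner_Integration.integrable_diff vh v(2) intG)
  have "AE x in lebesgue_on U. k x = 0"
  proof (rule du_Bois_Reymond[OF \<open>open U\<close>])
    show "k absolutely_integrable_on K" if "compact K" for K
    proof -
      have "set_integrable lebesgue UNIV k"
        using k_int by (simp add: set_integrable_def integrable_completion borel_measurable_integrable)
      then show ?thesis
        by (rule set_integrable_subset) (use that in \<open>auto simp: lmeasurable_compact fmeasurableD\<close>)
    qed
    fix \<phi> assume \<phi>: "\<phi> \<in> test_functions U"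
    obtain C where C: "C > 0" "\<And>x. \<bar>\<phi> x\<bar> \<le> C"
      using test_functions_bounded[OF \<phi>] by metis
    let ?D = "\<lambda>x. frechet_derivative \<phi> (at x) h"
    have D: "?D \<in> test_functions U" using \<phi> by (rule test_functions_derivative)
    let ?V = "\<lambda>(s::real) x. indicator {0..1} s * (v x * ?D (x - s *\<^sub>R h))"
    obtain C' where C': "C' > 0" "\<And>x. \<bar>?D x\<bar> \<le> C'"
      using test_functions_bounded[OF D] by metis
    note [measurable] = test_functions_measurable[OF \<phi>] test_functions_measurable[OF D]
    have shift: "(\<lambda>x. \<phi> (x - s *\<^sub>R h)) \<in> test_functions S" if "s \<in> {0..1}" for s
    proof -
      have "closure {x. \<phi> x \<noteq> 0} \<subseteq> U" using \<phi> by (auto simp: test_functions_def)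
      moreover have "x + s *\<^sub>R h \<in> S" if "x \<in> U" for x
      proof -
        have "(1 - s) *\<^sub>R x + s *\<^sub>R (x + h) \<in> S"
          using S(2) \<open>x \<in> U\<close> \<open>s \<in> {0..1}\<close> by (intro convexD) (auto simp: U_def)
        then show ?thesis by (simp add: algebra_simps)
      qed
      ultimately have "(\<lambda>x. \<phi> (x + (- (s *\<^sub>R h)))) \<in> test_functions S"
        by (intro test_functions_affine[OF \<phi> bounded_linear_ident bounded_linear_ident]) auto
      then show ?thesis by simp
    qed
    have shift_der: "frechet_derivative (\<lambda>x. \<phi> (x - s *\<^sub>R h)) (at x) h = ?D (x - s *\<^sub>R h)" for s x
    proof -
      have "((\<lambda>x. x - s *\<^sub>R h) has_derivative (\<lambda>h. h)) (at x)" by (auto intro!: derivative_eq_intros)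
      from frechet_derivative_at[OF has_derivative_compose[OF this test_functions_has_derivative[OF \<phi>]]]
      show ?thesis by metis
    qed
    have bounded_int: "integrable lborel (\<lambda>x. f x * \<psi> x)"
      if "integrable lborel f" "\<psi> \<in> borel_measurable borel" "\<And>x. \<bar>\<psi> x\<bar> \<le> c" for f \<psi> :: "'a \<Rightarrow> real" and c
    proof (rule Bochner_Integration.integrable_bound[of _ "\<lambda>x. c * f x"])
      show "AE x in lborel. norm (f x * \<psi> x) \<le> norm (c * f x)"
      proof (rule AE_I2)
        fix x
        have "\<bar>f x\<bar> * \<bar>\<psi> x\<bar> \<le> \<bar>f x\<bar> * \<bar>c\<bar>"
          using that(3)[of x] by (intro mult_left_mono) auto
        then show "norm (f x * \<psi> x) \<le> norm (c * f x)" by (simp add: abs_mult mult.commute)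
      qed
    qed (use that in auto)
    \<comment> \<open>The line integral, tested against \<open>\<phi>\<close> and moved over to translates of \<open>\<phi>\<close>.\<close>
    have "(LINT x|lborel. (LINT s|lborel. G s x) * \<phi> x) = (LINT x|lborel. LINT s|lborel. G s x * \<phi> x)"
      by simp
    also have "\<dots> = (LINT s|lborel. LINT x|lborel. G s x * \<phi> x)"
    proof (rule lborel_pair.Fubini_integral)
      show "integrable (lborel \<Otimes>\<^sub>M lborel) (\<lambda>(s, x). G s x * \<phi> x)"
      proof (rule Bochner_Integration.integrable_bound[of _ "\<lambda>(s, x). C * G s x"])
        show "integrable (lborel \<Otimes>\<^sub>M lborel) (\<lambda>(s, x). C * G s x)"
          using integrable_mult_right[OF G_int, of C] by (simp add: case_prod_beta')
        show "AE z in lborel \<Otimes>\<^sub>M lborel. norm (case z of (s, x) \<Rightarrow> G s x * \<phi> x) \<le> norm (case z of (s, x) \<Rightarrow> C * G s x)"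
        proof (rule AE_I2, clarify)
          fix s x
          have "\<bar>G s x\<bar> * \<bar>\<phi> x\<bar> \<le> \<bar>G s x\<bar> * C"
            using C(2)[of x] by (intro mult_left_mono) auto
          then show "norm (G s x * \<phi> x) \<le> norm (C * G s x)" using C(1) by (simp add: abs_mult mult.commute)
        qed
      qed measurable
    qed
    also have "\<dots> = (LINT s|lborel. - (LINT x|lborel. ?V s x))"
    proof (intro Bochner_Integration.integral_cong refl)
      fix s :: real
      show "(LINT x|lborel. G s x * \<phi> x) = - (LINT x|lborel. ?V s x)"
      proof (cases "s \<in> {0..1}")
        case True
        have "(LINT x|lborel. G s x * \<phi> x) = (LINT x|lborel. (g (x + s *\<^sub>R h) \<bullet> h) * \<phi> (x + s *\<^sub>R h - s *\<^sub>R h))"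
          using True by (simp add: G_def)
        also have "\<dots> = (LINT x|lborel. (g x \<bullet> h) * \<phi> (x - s *\<^sub>R h))"
          by (rule lborel_translation(1)[of "\<lambda>x. (g x \<bullet> h) * \<phi> (x - s *\<^sub>R h)"]) measurable
        also have "\<dots> = - (LINT x|lborel. v x * ?D (x - s *\<^sub>R h))"
          using weak[OF shift[OF True]] by (simp add: shift_der)
        finally show ?thesis using True by simp
      qed (simp add: G_def)
    qed
    also have "\<dots> = - (LINT x|lborel. LINT s|lborel. ?V s x)"
    proof -
      have "integrable (lborel \<Otimes>\<^sub>M lborel) (\<lambda>(s, x). ?V s x)"
      proof (rule integrable_unit_interval_pair[where C = "LINT x|lborel. \<bar>v x * C'\<bar>"])
        show "(\<lambda>(s, x). ?V s x) \<in> borel_measurable (lborel \<Otimes>\<^sub>M lborel)"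
          by measurable
        fix s :: real
        have "(\<integral>\<^sup>+x. ennreal \<bar>?V s x\<bar> \<partial>lborel) \<le>
          (\<integral>\<^sup>+x. ennreal \<bar>v x * C'\<bar> * indicator {0..1} s \<partial>lborel)"
        proof (rule nn_integral_mono)
          fix x
          have "\<bar>v x\<bar> * \<bar>?D (x - s *\<^sub>R h)\<bar> \<le> \<bar>v x\<bar> * C'"
            using C'(2)[of "x - s *\<^sub>R h"] by (intro mult_left_mono) auto
          then show "ennreal \<bar>?V s x\<bar> \<le> ennreal \<bar>v x * C'\<bar> * indicator {0..1} s"
            using C'(1) by (auto simp: indicator_def abs_mult intro!: ennreal_leI)
        qed
        also have "\<dots> = (\<integral>\<^sup>+x. ennreal \<bar>v x * C'\<bar> \<partial>lborel) * indicator {0..1} s"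
          by (rule nn_integral_multc) measurable
        also have "(\<integral>\<^sup>+x. ennreal \<bar>v x * C'\<bar> \<partial>lborel) = ennreal (LINT x|lborel. \<bar>v x * C'\<bar>)"
          using v(2) by (intro nn_integral_eq_integral) auto
        finally show "(\<integral>\<^sup>+x. ennreal \<bar>?V s x\<bar> \<partial>lborel) \<le>
          ennreal (LINT x|lborel. \<bar>v x * C'\<bar>) * indicator {0..1} s" .
      qed
      from lborel_pair.Fubini_integral[OF this] show ?thesis by simp
    qed
    also have "\<dots> = - (LINT x|lborel. v x * (\<phi> x - \<phi> (x - h)))"
    proof -
      have "(LINT s|lborel. ?V s x) = v x * (\<phi> x - \<phi> (x - h))" for x
      proof -
        have der: "((\<lambda>s. - \<phi> (x - s *\<^sub>R h)) has_real_derivative ?D (x - s *\<^sub>R h)) (at s)" for s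
        proof -
          have lin: "bounded_linear (frechet_derivative \<phi> (at (x - s *\<^sub>R h)))"
            using has_derivative_bounded_linear[OF test_functions_has_derivative[OF \<phi>]] .
          have "((\<lambda>s. x - s *\<^sub>R h) has_derivative (\<lambda>t. - (t *\<^sub>R h))) (at s)"
            by (auto intro!: derivative_eq_intros)
          from has_derivative_minus[OF has_derivative_compose[OF this test_functions_has_derivative[OF \<phi>]]]
          show ?thesis using lin by (simp add: has_field_derivative_def linear_simps mult_commute_abs)
        qed
        have "(LINT s|lborel. ?D (x - s *\<^sub>R h) * indicator {0..1} s) = - \<phi> (x - 1 *\<^sub>R h) - - \<phi> (x - 0 *\<^sub>R h)"
        proof (rule integral_FTC_Icc_real[where F = "\<lambda>s. - \<phi> (x - s *\<^sub>R h)"])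
          show "isCont (\<lambda>s. ?D (x - s *\<^sub>R h)) s" for s
          proof (rule isCont_o2[where f = "\<lambda>s. x - s *\<^sub>R h"])
            show "isCont (\<lambda>s. x - s *\<^sub>R h) s" by (intro continuous_intros)
            show "isCont ?D (x - s *\<^sub>R h)"
              using test_functions_continuous[OF D, of UNIV] by (simp add: continuous_on_eq_continuous_at)
          qed
        qed (use der in auto)
        then have "(LINT s|lborel. v x * (?D (x - s *\<^sub>R h) * indicator {0..1} s)) = v x * (\<phi> x - \<phi> (x - h))"
          by simp
        then show ?thesis by (simp add: mult_ac)
      qed
      then show ?thesis by simp
    qed
    finally have line: "(LINT x|lborel. (LINT s|lborel. G s x) * \<phi> x) = - (LINT x|lborel. v x * (\<phi> x - \<phi> (x - h)))" .
    have "(LINT x|lborel. v (x + h) * \<phi> (x + h - h)) = (LINT x|lborel. v x * \<phi> (x - h))"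
      by (rule lborel_translation(1)[of "\<lambda>x. v x * \<phi> (x - h)"]) measurable
    then have trans: "(LINT x|lborel. v (x + h) * \<phi> x) = (LINT x|lborel. v x * \<phi> (x - h))" by simp
    have i1: "integrable lborel (\<lambda>x. v (x + h) * \<phi> x)" "integrable lborel (\<lambda>x. v x * \<phi> x)"
      "integrable lborel (\<lambda>x. v x * \<phi> (x - h))" "integrable lborel (\<lambda>x. (LINT s|lborel. G s x) * \<phi> x)"
      using C(2) by (intro bounded_int vh v(2) intG; auto)+
    have "(LINT x|lborel. k x * \<phi> x) = (LINT x|lborel. v (x + h) * \<phi> x - v x * \<phi> x - (LINT s|lborel. G s x) * \<phi> x)"
      by (simp add: k_def left_diff_distrib)
    also have "\<dots> = (LINT x|lborel. v (x + h) * \<phi> x) - (LINT x|lborel. v x * \<phi> x) - (LINT x|lborel. (LINT s|lborel. G s x) * \<phi> x)"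
      using i1 by (simp only: Bochner_Integration.integral_diff Bochner_Integration.integrable_diff)
    also have "\<dots> = 0" unfolding trans line using i1(2,3) by (simp add: right_diff_distrib)
    finally have zero: "(LINT x|lborel. k x * \<phi> x) = 0" .
    have \<phi>0: "\<phi> x = 0" if "x \<notin> U" for x
      using \<phi> that closure_subset[of "{x. \<phi> x \<noteq> 0}"] by (auto simp: test_functions_def)
    have "(LINT x|lebesgue_on U. k x * \<phi> x) = (LINT x|lebesgue. indicator U x *\<^sub>R (k x * \<phi> x))"
      using \<open>open U\<close> by (subst integral_restrict_space) auto
    also have "\<dots> = (LINT x|lebesgue. k x * \<phi> x)"
      using \<phi>0 by (intro Bochner_Integration.integral_cong) (auto simp: indicator_def)
    also have "\<dots> = (LINT x|lborel. k x * \<phi> x)"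
      using k_int by (intro integral_completion) (auto intro: borel_measurable_times)
    finally show "(LINT x|lebesgue_on U. k x * \<phi> x) = 0" using zero by simp
  qed
  then have "AE x in lebesgue. x \<in> U \<longrightarrow> k x = 0"
    using \<open>open U\<close> by (simp add: AE_restrict_space_iff)
  then have "AE x in lborel. x \<in> U \<longrightarrow> k x = 0"
    by (simp add: AE_completion_iff)
  then show ?thesis by eventually_elim (auto simp: U_def k_def G_def)
qed

lemma ennreal_norm_integral_le:
  fixes f :: "'a \<Rightarrow> 'b::{banach, second_countable_topology}"
  shows "ennreal (norm (LINT x|M. f x)) \<le> (\<integral>\<^sup>+x. ennreal (norm (f x)) \<partial>M)"
  by (cases "integrable M f") (auto intro: integral_norm_bound_ennreal simp: not_integrable_integral_eq)

lemma nn_integral_inverse_square_le: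
  assumes "a > 0"
  shows "(\<integral>\<^sup>+s. ennreal (1 / s\<^sup>2) * (if a \<le> s \<and> s \<le> 1 then 1 else 0) \<partial>lborel) \<le> ennreal (1 / a)"
proof -
  have "(\<integral>\<^sup>+s. ennreal (1 / s\<^sup>2) * (if a \<le> s \<and> s \<le> 1 then 1 else 0) \<partial>lborel) =
      (\<integral>\<^sup>+s. ennreal (1 / s\<^sup>2) * indicator {a..1} s \<partial>lborel)"
    by (intro nn_integral_cong) (auto simp: indicator_def)
  also have "\<dots> \<le> ennreal (1 / a)"
  proof (cases "a \<le> 1")
    case True
    have "(\<integral>\<^sup>+s. ennreal (1 / s\<^sup>2) * indicator {a..1} s \<partial>lborel) = ennreal (- (1 / 1) - - (1 / a))"
      by (rule nn_integral_FTC_Icc[where F = "\<lambda>s. - (1 / s)"])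
         (use assms True in \<open>auto intro!: derivative_eq_intros simp: power2_eq_square\<close>)
    also have "\<dots> \<le> ennreal (1 / a)" by (rule ennreal_leI) simp
    finally show ?thesis .
  qed auto
  finally show ?thesis .
qed

text \<open>As \<open>v\<close> has mean zero, \<open>v x\<close> is the mean of \<open>v x - v y\<close> over the ball. Bound each difference by the
  integral of \<open>\<bar>g\<bar>\<close> over the segment from \<open>x\<close> to \<open>y = x + h\<close>, substitute \<open>z = x + s h\<close> for fixed \<open>s\<close>, and integrate
  the Jacobian \<open>s\<^bsup>-2\<^esup>\<close> over the values \<open>s \<ge> \<bar>z - x\<bar> / 2r\<close> that can reach \<open>z\<close>.\<close>

lemma mean_zero_potential_estimate:
  fixes v :: "'a::euclidean_space \<Rightarrow> real"
  assumes dim: "DIM('a) = 2" and r: "r > 0"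
    and v: "v \<in> borel_measurable borel" "integrable lborel v" "\<And>x. norm x \<ge> r \<Longrightarrow> v x = 0"
    and g: "g \<in> borel_measurable borel" "integrable lborel g"
    and weak: "\<And>\<phi> h. \<phi> \<in> test_functions (ball 0 r) \<Longrightarrow>
      (LINT x|lborel. v x * frechet_derivative \<phi> (at x) h) = - (LINT x|lborel. (g x \<bullet> h) * \<phi> x)"
    and mean: "(LINT x|lborel. v x) = 0"
  shows "AE x in lborel. norm x < r \<longrightarrow> ennreal (measure lborel (ball 0 r :: 'a set) * \<bar>v x\<bar>) \<le>
    ennreal (4 * r\<^sup>2) * (\<integral>\<^sup>+z. ennreal (norm (g z) / norm (z - x)) \<partial>lborel)"
proof -
  note [measurable] = v(1) g(1)
  have [measurable]: "ball 0 r \<in> sets (borel :: 'a measure)" by simp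
  define P where "P h x \<longleftrightarrow> (norm x < r \<and> norm (x + h) < r \<longrightarrow>
      ennreal \<bar>v (x + h) - v x\<bar> \<le> (\<integral>\<^sup>+s. ennreal (indicator {0..1} s * (norm (g (x + s *\<^sub>R h)) * norm h)) \<partial>(lborel :: real measure)))"
    for h x
  have "AE x in lborel. P h x" for h
  proof -
    have "AE x in lborel. x \<in> ball 0 r \<and> x + h \<in> ball 0 r \<longrightarrow>
        v (x + h) - v x = (LINT s|lborel. indicator {0..1} s * (g (x + s *\<^sub>R h) \<bullet> h))"
      by (rule weak_gradient_line_integral[OF _ _ v(1,2) g weak]) auto
    then show ?thesis
    proof eventually_elim
      case (elim x)
      show ?case unfolding P_def
      proof
        assume "norm x < r \<and> norm (x + h) < r"
        then have "ennreal \<bar>v (x + h) - v x\<bar> \<le> (\<integral>\<^sup>+s. ennreal (norm (indicator {0..1} s * (g (x + s *\<^sub>R h) \<bullet> h))) \<partial>(lborel :: real measure))"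
          using elim ennreal_norm_integral_le[of lborel "\<lambda>s::real. indicator {0..1} s * (g (x + s *\<^sub>R h) \<bullet> h)"] by simp
        also have "\<dots> \<le> (\<integral>\<^sup>+s. ennreal (indicator {0..1} s * (norm (g (x + s *\<^sub>R h)) * norm h)) \<partial>lborel)"
          by (intro nn_integral_mono ennreal_leI) (auto simp: abs_mult indicator_def Cauchy_Schwarz_ineq2)
        finally show "ennreal \<bar>v (x + h) - v x\<bar> \<le> (\<integral>\<^sup>+s. ennreal (indicator {0..1} s * (norm (g (x + s *\<^sub>R h)) * norm h)) \<partial>lborel)" .
      qed
    qed
  qed
  then have "AE h in lborel. AE x in lborel. P h x" by simp
  moreover have "{z \<in> space (lborel \<Otimes>\<^sub>M lborel). P (fst z) (snd z)} \<in> sets (lborel \<Otimes>\<^sub>M lborel)"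
    unfolding P_def by measurable
  ultimately have "AE x in lborel. AE h in lborel. P h x"
    using lborel_pair.AE_commute by blast
  then show ?thesis
  proof eventually_elim
    case (elim x)
    show ?case
    proof
      assume x: "norm x < r"
      let ?B = "ball 0 r :: 'a set"
      let ?j = "\<lambda>(s::real) h. indicator {0..1} s * (ennreal (2 * r * norm (g (x + s *\<^sub>R h))) * indicator {h. norm h \<le> 2 * r} h)"
      let ?k = "\<lambda>(s::real) z. ennreal (2 * r * norm (g z)) * (ennreal (1 / s\<^sup>2) * (if norm (z - x) / (2 * r) \<le> s \<and> s \<le> 1 then 1 else 0))"
      have fin: "emeasure lborel ?B < \<infinity>" using emeasure_bounded_finite[of ?B] by simp
      then have Bint: "integrable lborel (\<lambda>y. indicator ?B y * v x)"
        by (intro integrable_mult_left integrable_real_indicator) auto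
      have "(LINT y|lborel. indicator ?B y * v x - v y) = measure lborel ?B * v x"
        using Bint v(2) mean by simp
      then have "ennreal (measure lborel ?B * \<bar>v x\<bar>) = ennreal (norm (LINT y|lborel. indicator ?B y * v x - v y))"
        by (simp add: abs_mult)
      also have "\<dots> \<le> (\<integral>\<^sup>+y. ennreal (norm (indicator ?B y * v x - v y)) \<partial>lborel)"
        by (rule ennreal_norm_integral_le)
      also have "\<dots> = (\<integral>\<^sup>+y. indicator ?B y * ennreal \<bar>v y - v x\<bar> \<partial>lborel)"
        using v(3) by (intro nn_integral_cong) (auto simp: indicator_def abs_minus_commute)
      also have "\<dots> = (\<integral>\<^sup>+h. indicator ?B (h + x) * ennreal \<bar>v (h + x) - v x\<bar> \<partial>lborel)"
        by (rule lborel_nn_translation[of "\<lambda>y. indicator ?B y * ennreal \<bar>v y - v x\<bar>", symmetric]) measurable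
      also have "\<dots> \<le> (\<integral>\<^sup>+h. (\<integral>\<^sup>+s. ?j s h \<partial>(lborel :: real measure)) \<partial>lborel)"
      proof (rule nn_integral_mono_AE)
        from elim show "AE h in lborel. indicator ?B (h + x) * ennreal \<bar>v (h + x) - v x\<bar> \<le>
          (\<integral>\<^sup>+s. ?j s h \<partial>(lborel :: real measure))"
        proof eventually_elim
          case (elim h)
          show ?case
          proof (cases "norm (x + h) < r")
            case True
            have nh: "norm h \<le> 2 * r"
              using norm_triangle_ineq4[of "x + h" x] True x by simp
            have "ennreal \<bar>v (x + h) - v x\<bar> \<le> (\<integral>\<^sup>+s. ennreal (indicator {0..1} s * (norm (g (x + s *\<^sub>R h)) * norm h)) \<partial>(lborel :: real measure))"
              using elim x True by (auto simp: P_def)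
            also have "\<dots> \<le> (\<integral>\<^sup>+s. ?j s h \<partial>lborel)"
              using nh by (intro nn_integral_mono) (auto simp: indicator_def mult.commute intro!: ennreal_leI mult_right_mono)
            finally show ?thesis using True by (simp add: indicator_def add.commute)
          qed (simp add: indicator_def add.commute)
        qed
      qed
      also have "\<dots> = (\<integral>\<^sup>+s. (\<integral>\<^sup>+h. ?j s h \<partial>lborel) \<partial>(lborel :: real measure))"
        by (rule lborel_pair.Fubini') measurable
      also have "\<dots> \<le> (\<integral>\<^sup>+s. (\<integral>\<^sup>+z. ?k s z \<partial>lborel) \<partial>lborel)"
      proof (rule nn_integral_mono_AE)
        have "AE s in lborel. s \<noteq> (0::real)" by (rule AE_lborel_singleton)
        then show "AE s in lborel. (\<integral>\<^sup>+h. ?j s h \<partial>lborel)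
          \<le> (\<integral>\<^sup>+z. ?k s z \<partial>lborel)"
        proof eventually_elim
          case (elim s)
          show ?case
          proof (cases "s \<in> {0..1}")
            case True
            then have s: "s > 0" "s \<le> 1" using elim by auto
            let ?f = "?k s"
            have "(\<integral>\<^sup>+z. ?f z \<partial>lborel) = ennreal (s ^ 2) * (\<integral>\<^sup>+h. ?f (x + s *\<^sub>R h) \<partial>lborel)"
              using lborel_nn_dilation[of ?f s x] s dim by simp
            also have "\<dots> = (\<integral>\<^sup>+h. ennreal (s ^ 2) * ?f (x + s *\<^sub>R h) \<partial>lborel)"
              by (rule nn_integral_cmult[symmetric]) measurable
            also have "\<dots> = (\<integral>\<^sup>+h. ?j s h \<partial>lborel)"
            proof (rule nn_integral_cong)
              fix h :: 'a
              have "norm (s *\<^sub>R h) / (2 * r) \<le> s \<longleftrightarrow> norm h \<le> 2 * r"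
                using s r by (simp add: field_simps)
              moreover have "ennreal (s ^ 2) * (a * (ennreal (1 / s\<^sup>2) * b)) = a * b" for a b
              proof -
                have "ennreal (s ^ 2) * ennreal (1 / s\<^sup>2) = 1"
                  using s by (simp flip: ennreal_mult)
                moreover have "ennreal (s ^ 2) * (a * (ennreal (1 / s\<^sup>2) * b)) = (ennreal (s ^ 2) * ennreal (1 / s\<^sup>2)) * (a * b)"
                  by (simp only: mult_ac)
                ultimately show ?thesis by (simp only: mult_1)
              qed
              ultimately show "ennreal (s ^ 2) * ?f (x + s *\<^sub>R h) = ?j s h"
                using s by (simp add: indicator_def)
            qed
            finally show ?thesis by simp
          qed simp
        qed
      qed
      also have "\<dots> = (\<integral>\<^sup>+z. (\<integral>\<^sup>+s. ?k s z \<partial>lborel) \<partial>lborel)"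
        by (rule lborel_pair.Fubini') measurable
      also have "\<dots> \<le> (\<integral>\<^sup>+z. ennreal (4 * r\<^sup>2) * ennreal (norm (g z) / norm (z - x)) \<partial>lborel)"
      proof (rule nn_integral_mono_AE)
        have "AE z in lborel. z \<noteq> x" by (rule AE_lborel_singleton)
        then show "AE z in lborel. (\<integral>\<^sup>+s. ?k s z \<partial>lborel)
            \<le> ennreal (4 * r\<^sup>2) * ennreal (norm (g z) / norm (z - x))"
        proof eventually_elim
          case (elim z)
          have "(\<integral>\<^sup>+s. ?k s z \<partial>lborel) =
              ennreal (2 * r * norm (g z)) * (\<integral>\<^sup>+s. ennreal (1 / s\<^sup>2) * (if norm (z - x) / (2 * r) \<le> s \<and> s \<le> 1 then 1 else 0) \<partial>lborel)"
            by (rule nn_integral_cmult) measurable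
          also have "\<dots> \<le> ennreal (2 * r * norm (g z)) * ennreal (1 / (norm (z - x) / (2 * r)))"
            using elim r by (intro mult_left_mono nn_integral_inverse_square_le) auto
          also have "\<dots> = ennreal (4 * r\<^sup>2) * ennreal (norm (g z) / norm (z - x))"
            using r by (simp add: power2_eq_square mult_ac flip: ennreal_mult)
          finally show ?case .
        qed
      qed
      also have "\<dots> = ennreal (4 * r\<^sup>2) * (\<integral>\<^sup>+z. ennreal (norm (g z) / norm (z - x)) \<partial>lborel)"
        by (rule nn_integral_cmult) measurable
      finally show "ennreal (measure lborel ?B * \<bar>v x\<bar>) \<le>
        ennreal (4 * r\<^sup>2) * (\<integral>\<^sup>+z. ennreal (norm (g z) / norm (z - x)) \<partial>lborel)" .
    qed
  qed
qed

section \<open>Integrals of the Riesz kernel\<close>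

text \<open>A bound for the integral of \<open>\<bar>x\<bar>\<^bsup>-\<beta>\<^esup>\<close> over the plane disk of radius \<open>R\<close>, as the geometric series over dyadic
  annuli yields it. It is of order \<open>1 / (2 - \<beta>)\<close> as \<open>\<beta> \<rightarrow> 2\<close>, and the functions of small energy rely on that rate.\<close>

definition riesz_bound :: "real \<Rightarrow> real \<Rightarrow> real" where
  "riesz_bound \<beta> R = 4 * unit_ball_vol 2 * R powr (2 - \<beta>) / (1 - 2 powr (\<beta> - 2))"

lemma riesz_bound_nonneg: "\<beta> < 2 \<Longrightarrow> 0 \<le> riesz_bound \<beta> R"
proof -
  assume "\<beta> < 2"
  then have "2 powr (\<beta> - 2) < 2 powr (0::real)" by (intro powr_less_mono) auto
  then show ?thesis by (simp add: riesz_bound_def)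
qed

lemma nn_integral_riesz_kernel:
  assumes dim: "DIM('a::euclidean_space) = 2" and \<beta>: "0 \<le> \<beta>" "\<beta> < 2" and R: "R > 0"
  shows "(\<integral>\<^sup>+x. ennreal (norm x powr - \<beta>) * indicator (ball 0 R) x \<partial>(lborel :: 'a measure)) \<le> ennreal (riesz_bound \<beta> R)"
proof -
  let ?t = "\<lambda>k x. ennreal ((R / 2 ^ Suc k) powr - \<beta>) * indicator (ball 0 (R / 2 ^ k) :: 'a set) x"
  have dyadic: "ennreal (norm x powr - \<beta>) * indicator (ball 0 R) x \<le> (\<Sum>k. ?t k x)" if "x \<noteq> 0" for x :: 'a
  proof (cases "norm x < R")
    case True
    have "\<exists>n. R / 2 ^ n \<le> norm x"
    proof -
      obtain n where "R / norm x < 2 ^ n" using real_arch_pow[of 2 "R / norm x"] by auto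
      then show ?thesis using that by (intro exI[of _ n]) (simp add: field_simps)
    qed
    then obtain n where n: "R / 2 ^ n \<le> norm x" "\<And>m. m < n \<Longrightarrow> \<not> R / 2 ^ m \<le> norm x"
      using exists_least_iff[of "\<lambda>n. R / 2 ^ n \<le> norm x"] by auto
    obtain k where k: "n = Suc k" using n(1) True by (cases n) auto
    have "norm x powr - \<beta> \<le> (R / 2 ^ Suc k) powr - \<beta>"
      using n(1) k R \<beta> that by (intro powr_mono2') auto
    moreover have "norm x < R / 2 ^ k" using n(2)[of k] k by simp
    ultimately have "ennreal (norm x powr - \<beta>) * indicator (ball 0 R) x \<le> ?t k x"
      using True by (simp add: indicator_def ennreal_leI)
    moreover have "f k \<le> suminf f" if "\<And>j. 0 \<le> f j" for f :: "nat \<Rightarrow> ennreal"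
      using sum_le_suminf[of f "{k}"] that by simp
    then have "?t k x \<le> (\<Sum>j. ?t j x)" by simp
    ultimately show ?thesis by (rule order_trans)
  qed (simp add: indicator_def)
  define c where "c = unit_ball_vol 2 * R powr (2 - \<beta>) * 2 powr \<beta>"
  define \<rho> where "\<rho> = 2 powr (\<beta> - 2)"
  have \<rho>: "0 < \<rho>" "\<rho> < 1"
    using \<beta> powr_less_mono[of "\<beta> - 2" 0 2] by (auto simp: \<rho>_def)
  have "(\<integral>\<^sup>+x. ennreal (norm x powr - \<beta>) * indicator (ball 0 R) x \<partial>(lborel :: 'a measure)) \<le> (\<integral>\<^sup>+x. (\<Sum>k. ?t k x) \<partial>lborel)"
    using AE_lborel_singleton[of "0 :: 'a"] dyadic
    by (intro nn_integral_mono_AE) (auto elim!: eventually_mono)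
  also have "\<dots> = (\<Sum>k. \<integral>\<^sup>+x. ?t k x \<partial>lborel)"
    by (intro nn_integral_suminf borel_measurable_times_ennreal borel_measurable_indicator borel_measurable_const) simp
  also have "\<dots> = (\<Sum>k. ennreal (c * \<rho> ^ k))"
  proof (rule suminf_cong)
    fix k
    have e: "emeasure lborel (ball 0 (R / 2 ^ k) :: 'a set) = ennreal (unit_ball_vol 2 * (R / 2 ^ k)\<^sup>2)"
      using R emeasure_ball[of "R / 2 ^ k" "0 :: 'a"] dim by simp
    have "(\<integral>\<^sup>+x. ?t k x \<partial>lborel) = ennreal ((R / 2 ^ Suc k) powr - \<beta> * (unit_ball_vol 2 * (R / 2 ^ k)\<^sup>2))"
      by (subst nn_integral_cmult_indicator) (simp_all add: e ennreal_mult'')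
    also have "(R / 2 ^ Suc k) powr - \<beta> * (unit_ball_vol 2 * (R / 2 ^ k)\<^sup>2) = c * \<rho> ^ k"
    proof -
      have p: "(2::real) ^ j = 2 powr (real j)" for j by (simp add: powr_realpow)
      have R2: "R\<^sup>2 = R powr 2" using R by (simp add: powr_numeral)
      have "(R / 2 ^ Suc k) powr - \<beta> * (R / 2 ^ k)\<^sup>2 = R powr (2 - \<beta>) * (2 powr \<beta> * \<rho> ^ k)"
      proof -
        have "(R / 2 ^ Suc k) powr - \<beta> = R powr - \<beta> * 2 powr (\<beta> * (k + 1))"
        proof -
          have "(R / 2 ^ Suc k) powr - \<beta> = R powr - \<beta> / (2 powr real (Suc k)) powr - \<beta>"
            using R by (simp add: powr_divide p del: power_Suc)
          also have "(2 powr real (Suc k)) powr - \<beta> = 2 powr - (\<beta> * (k + 1))"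
            by (simp add: powr_powr algebra_simps)
          finally show ?thesis by (simp only: powr_minus divide_inverse inverse_inverse_eq)
        qed
        moreover have "(R / 2 ^ k)\<^sup>2 = R powr 2 * 2 powr (- 2 * real k)"
        proof -
          have "((2::real) ^ k)\<^sup>2 = 2 ^ (2 * k)" by (rule power_even_eq[symmetric])
          also have "\<dots> = 2 powr (2 * real k)" using p[of "2 * k"] by simp
          finally have "((2::real) ^ k)\<^sup>2 = 2 powr (2 * real k)" .
          then have "(R / 2 ^ k)\<^sup>2 = R powr 2 / 2 powr (2 * real k)" by (simp only: power_divide R2)
          then show ?thesis by (simp only: powr_minus mult_minus_left divide_inverse)
        qed
        moreover have "\<rho> ^ k = 2 powr ((\<beta> - 2) * k)"
          using powr_realpow[of \<rho> k] \<rho> by (simp add: \<rho>_def powr_powr)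
        moreover have "R powr - \<beta> * R powr 2 = R powr (2 - \<beta>)"
          by (simp flip: powr_add)
        moreover have "2 powr (\<beta> * (k + 1)) * 2 powr (- 2 * real k) = 2 powr \<beta> * 2 powr ((\<beta> - 2) * k)"
          by (simp add: algebra_simps flip: powr_add)
        moreover have "X * Y = a * (b * p)" if "X = x1 * x2" "Y = y1 * y2" "p = q" "x1 * y1 = a" "x2 * y2 = b * q"
          for X Y a b p q x1 x2 y1 y2 :: real
        proof -
          have "X * Y = (x1 * y1) * (x2 * y2)" unfolding that(1,2) by (simp only: mult_ac)
          then show ?thesis unfolding that(3-5) .
        qed
        ultimately show ?thesis by blast
      qed
      then show ?thesis by (simp add: c_def mult_ac)
    qed
    finally show "(\<integral>\<^sup>+x. ?t k x \<partial>lborel) = ennreal (c * \<rho> ^ k)" .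
  qed
  also have "\<dots> = ennreal (\<Sum>k. c * \<rho> ^ k)"
    using \<rho> by (intro suminf_ennreal2) (auto simp: c_def intro!: summable_mult summable_geometric)
  also have "(\<Sum>k. c * \<rho> ^ k) = c / (1 - \<rho>)"
    using \<rho> suminf_geometric[of \<rho>] by (subst suminf_mult) (auto intro!: summable_geometric)
  also have "ennreal (c / (1 - \<rho>)) \<le> ennreal (riesz_bound \<beta> R)"
  proof (rule ennreal_leI)
    have "2 powr \<beta> \<le> 2 powr (2::real)" using \<beta> by (intro powr_mono) auto
    then have "2 powr \<beta> \<le> 4" by (simp add: powr_numeral)
    then have "unit_ball_vol 2 * R powr (2 - \<beta>) * 2 powr \<beta> \<le> unit_ball_vol 2 * R powr (2 - \<beta>) * 4"
      by (intro mult_left_mono) auto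
    then show "c / (1 - \<rho>) \<le> riesz_bound \<beta> R"
      using \<rho> unfolding riesz_bound_def c_def \<rho>_def by (intro divide_right_mono) (auto simp: mult_ac)
  qed
  finally show ?thesis .
qed

lemma nn_integral_riesz_kernel_shifted:
  assumes dim: "DIM('a::euclidean_space) = 2" and \<beta>: "0 \<le> \<beta>" "\<beta> < 2" and z: "norm z < r"
  shows "(\<integral>\<^sup>+x. ennreal (norm (z - x) powr - \<beta>) * indicator (ball 0 r) x \<partial>(lborel :: 'a measure)) \<le> ennreal (riesz_bound \<beta> (2 * r))"
proof -
  have [measurable]: "ball 0 r \<in> sets (borel :: 'a measure)" by simp
  have "(\<integral>\<^sup>+x. ennreal (norm (z - x) powr - \<beta>) * indicator (ball 0 r) x \<partial>(lborel :: 'a measure)) =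
      (\<integral>\<^sup>+x. ennreal (norm (z - (x + z)) powr - \<beta>) * indicator (ball 0 r) (x + z) \<partial>(lborel :: 'a measure))"
    by (rule lborel_nn_translation[of "\<lambda>x. ennreal (norm (z - x) powr - \<beta>) * indicator (ball 0 r) x", symmetric]) measurable
  also have "\<dots> \<le> (\<integral>\<^sup>+x. ennreal (norm x powr - \<beta>) * indicator (ball 0 (2 * r)) x \<partial>(lborel :: 'a measure))"
  proof (rule nn_integral_mono)
    fix x :: 'a
    have "norm x < 2 * r" if "norm (x + z) < r"
      using norm_triangle_ineq4[of "x + z" z] that z by simp
    then show "ennreal (norm (z - (x + z)) powr - \<beta>) * indicator (ball 0 r) (x + z) \<le> ennreal (norm x powr - \<beta>) * indicator (ball 0 (2 * r)) x"
      by (auto simp: indicator_def)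
  qed
  also have "\<dots> \<le> ennreal (riesz_bound \<beta> (2 * r))"
    using z norm_ge_zero[of z] by (intro nn_integral_riesz_kernel dim \<beta>) linarith
  finally show ?thesis .
qed

section \<open>Power means\<close>

text \<open>Jensen's inequality for \<open>t\<^sup>n\<close> and the measure of density \<open>w\<close>, of total mass \<open>E\<close>: integrate the tangent
  inequality \<open>n s\<^bsup>n-1\<^esup> t \<le> t\<^sup>n + (n - 1) s\<^sup>n\<close> and take for \<open>s\<close> the mean value of \<open>u\<close>.\<close>

lemma nn_integral_power_mean:
  fixes u :: "'a \<Rightarrow> real"
  assumes [measurable]: "u \<in> borel_measurable M" "w \<in> borel_measurable M"
    and u: "\<And>x. 0 \<le> u x" and n: "n \<ge> 1"
    and E: "(\<integral>\<^sup>+x. w x \<partial>M) = ennreal E" "E \<ge> 0"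
  shows "(\<integral>\<^sup>+x. ennreal (u x) * w x \<partial>M) ^ n \<le> ennreal E ^ (n - 1) * (\<integral>\<^sup>+x. ennreal (u x ^ n) * w x \<partial>M)"
proof -
  let ?U = "\<integral>\<^sup>+x. ennreal (u x) * w x \<partial>M" and ?V = "\<integral>\<^sup>+x. ennreal (u x ^ n) * w x \<partial>M"
  have tangent: "real n * s ^ (n - 1) * t \<le> t ^ n + (real n - 1) * s ^ n" if "s > 0" "t \<ge> 0" for s t :: real
  proof -
    have "1 + real n * (t / s - 1) \<le> (1 + (t / s - 1)) ^ n"
      using that by (intro Bernoulli_inequality) auto
    then have "(1 + real n * (t / s - 1)) * s ^ n \<le> (t / s) ^ n * s ^ n"
      using that by (intro mult_right_mono) auto
    moreover have "s ^ n = s * s ^ (n - 1)" using n by (simp add: power_eq_if)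
    moreover have "(1 + real n * (t / s - 1)) * (s * s ^ (n - 1)) = s * s ^ (n - 1) + real n * (t - s) * s ^ (n - 1)"
      using that by (simp add: field_simps)
    moreover have "(t / s) ^ n * s ^ n = t ^ n" using that by (simp add: power_divide)
    ultimately show ?thesis by (simp add: algebra_simps)
  qed
  have key: "ennreal (real n * s ^ (n - 1)) * ?U \<le> ?V + ennreal ((real n - 1) * s ^ n) * ennreal E" if "s > 0" for s
  proof -
    have "ennreal (real n * s ^ (n - 1)) * ?U = (\<integral>\<^sup>+x. ennreal (real n * s ^ (n - 1)) * (ennreal (u x) * w x) \<partial>M)"
      by (rule nn_integral_cmult[symmetric]) measurable
    also have "\<dots> \<le> (\<integral>\<^sup>+x. ennreal (u x ^ n) * w x + ennreal ((real n - 1) * s ^ n) * w x \<partial>M)"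
    proof (rule nn_integral_mono)
      fix x
      have "ennreal (real n * s ^ (n - 1) * u x) \<le> ennreal (u x ^ n + (real n - 1) * s ^ n)"
        by (intro ennreal_leI tangent that u)
      also have "\<dots> = ennreal (u x ^ n) + ennreal ((real n - 1) * s ^ n)"
        using u n that by (intro ennreal_plus) auto
      finally have "ennreal (real n * s ^ (n - 1) * u x) * w x \<le> (ennreal (u x ^ n) + ennreal ((real n - 1) * s ^ n)) * w x"
        by (intro mult_right_mono) auto
      then show "ennreal (real n * s ^ (n - 1)) * (ennreal (u x) * w x) \<le> ennreal (u x ^ n) * w x + ennreal ((real n - 1) * s ^ n) * w x"
        using that u[of x] by (simp add: ennreal_mult distrib_right mult.assoc)
    qed
    also have "\<dots> = ?V + ennreal ((real n - 1) * s ^ n) * (\<integral>\<^sup>+x. w x \<partial>M)"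
      by (subst nn_integral_add) (auto simp: nn_integral_cmult)
    finally show ?thesis using E by simp
  qed
  show ?thesis
  proof (cases "E = 0")
    case True
    then have "AE x in M. w x = 0" using E by (simp add: nn_integral_0_iff_AE)
    then have "AE x in M. ennreal (u x) * w x = 0" by eventually_elim simp
    then have "?U = 0" by (simp add: nn_integral_0_iff_AE)
    then show ?thesis using n by (simp add: zero_power)
  next
    case False
    then have Epos: "E > 0" using E by simp
    show ?thesis
    proof (cases "?V = \<infinity>")
      case True
      then show ?thesis using Epos by (simp add: ennreal_mult_top ennreal_power)
    next
      case False
      then obtain V where V: "?V = ennreal V" "V \<ge> 0" by (cases ?V) auto
      have "ennreal (real n) * ?U \<le> ennreal V + ennreal (real n - 1) * ennreal E"
        using key[of 1] V by simp
      also have "\<dots> < \<infinity>" using n E V by (simp add: ennreal_mult_less_top)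
      finally have "?U \<noteq> \<infinity>" using n by (auto simp: ennreal_mult_top)
      then obtain U where U: "?U = ennreal U" "U \<ge> 0" by (cases ?U) auto
      have "U ^ n \<le> E ^ (n - 1) * V"
      proof (cases "U = 0")
        case True
        then show ?thesis using n V E by (simp add: power_0_left)
      next
        case False
        define s where "s = U / E"
        have s: "s > 0" using False U Epos by (simp add: s_def)
        have nE: "(real n - 1) * s ^ n \<ge> 0" using n s by simp
        have "ennreal (real n * s ^ (n - 1) * U) \<le> ennreal (V + (real n - 1) * s ^ n * E)"
          using key[OF s] U V E n s nE by (simp add: ennreal_mult ennreal_plus)
        then have "real n * s ^ (n - 1) * U \<le> V + (real n - 1) * s ^ n * E"
          using V nE E by (subst (asm) ennreal_le_iff) auto
        moreover have "s ^ n * E = s ^ (n - 1) * U"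
          using n Epos by (cases n) (auto simp: s_def)
        ultimately have "real n * (s ^ (n - 1) * U) \<le> V + (real n - 1) * (s ^ (n - 1) * U)"
          by (simp only: mult.assoc)
        then have "s ^ (n - 1) * U \<le> V" by (simp add: algebra_simps)
        then have "E ^ (n - 1) * (s ^ (n - 1) * U) \<le> E ^ (n - 1) * V" using Epos by (intro mult_left_mono) auto
        moreover have "E ^ (n - 1) * (s ^ (n - 1) * U) = U ^ n"
          using n Epos by (cases n) (auto simp: s_def power_divide)
        ultimately show ?thesis by simp
      qed
      then show ?thesis using U V E by (simp add: ennreal_power ennreal_leI flip: ennreal_mult)
    qed
  qed
qed

section \<open>Bounds by the energy\<close>

context
  fixes v :: "'a::euclidean_space \<Rightarrow> real" and g :: "'a \<Rightarrow> 'a" and r m :: real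
  assumes dim: "DIM('a) = 2" and r: "r > 0" and m: "m > 0"
    and v_borel: "v \<in> borel_measurable borel" and v_supp: "\<And>x. r \<le> norm x \<Longrightarrow> v x = 0"
    and g_borel: "g \<in> borel_measurable borel" and g_supp: "\<And>x. r \<le> norm x \<Longrightarrow> g x = 0"
    and potential: "AE x in lborel. norm x < r \<longrightarrow>
      ennreal (m * \<bar>v x\<bar>) \<le> ennreal (4 * r\<^sup>2) * (\<integral>\<^sup>+z. ennreal (norm (g z) / norm (z - x)) \<partial>lborel)"
begin

lemma L1_bound_of_potential:
  "(\<integral>\<^sup>+x. ennreal (m * \<bar>v x\<bar>) \<partial>lborel) \<le>
    ennreal (4 * r\<^sup>2 * riesz_bound 1 (2 * r)) * (\<integral>\<^sup>+z. ennreal (norm (g z)) \<partial>lborel)"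
proof -
  note [measurable] = v_borel g_borel
  have [measurable]: "ball 0 r \<in> sets (borel :: 'a measure)" by simp
  let ?k = "\<lambda>x z. ennreal (norm (g z)) * (ennreal (norm (z - x) powr - 1) * indicator (ball 0 r) x)"
  have "(\<integral>\<^sup>+x. ennreal (m * \<bar>v x\<bar>) \<partial>lborel) \<le>
      (\<integral>\<^sup>+x. (\<integral>\<^sup>+z. ennreal (4 * r\<^sup>2) * ?k x z \<partial>lborel) \<partial>lborel)"
  proof (rule nn_integral_mono_AE)
    show "AE x in lborel. ennreal (m * \<bar>v x\<bar>) \<le>
      (\<integral>\<^sup>+z. ennreal (4 * r\<^sup>2) * ?k x z \<partial>lborel)"
      using potential
    proof eventually_elim
      case (elim x)
      show ?case
      proof (cases "norm x < r")
        case True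
        have "(\<integral>\<^sup>+z. ennreal (4 * r\<^sup>2) * ?k x z \<partial>lborel) =
            ennreal (4 * r\<^sup>2) * (\<integral>\<^sup>+z. ?k x z \<partial>lborel)"
          by (rule nn_integral_cmult) measurable
        also have "(\<integral>\<^sup>+z. ?k x z \<partial>lborel) =
            (\<integral>\<^sup>+z. ennreal (norm (g z) / norm (z - x)) \<partial>lborel)"
          using True by (intro nn_integral_cong) (simp add: indicator_def powr_minus_divide flip: ennreal_mult)
        finally show ?thesis using elim True by simp
      qed (simp add: v_supp)
    qed
  qed
  also have "\<dots> = (\<integral>\<^sup>+z. (\<integral>\<^sup>+x. ennreal (4 * r\<^sup>2) * ?k x z \<partial>lborel) \<partial>lborel)"
    by (rule lborel_pair.Fubini') measurable
  also have "\<dots> \<le> (\<integral>\<^sup>+z. ennreal (4 * r\<^sup>2 * riesz_bound 1 (2 * r)) * ennreal (norm (g z)) \<partial>lborel)"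
  proof (rule nn_integral_mono)
    fix z
    have "(\<integral>\<^sup>+x. ennreal (4 * r\<^sup>2) * ?k x z \<partial>lborel) =
        ennreal (4 * r\<^sup>2) * (\<integral>\<^sup>+x. ?k x z \<partial>lborel)"
      by (rule nn_integral_cmult) measurable
    also have "(\<integral>\<^sup>+x. ?k x z \<partial>lborel) =
        ennreal (norm (g z)) * (\<integral>\<^sup>+x. ennreal (norm (z - x) powr - 1) * indicator (ball 0 r) x \<partial>lborel)"
      by (rule nn_integral_cmult) measurable
    also have "ennreal (4 * r\<^sup>2) * \<dots> \<le> ennreal (4 * r\<^sup>2) * (ennreal (norm (g z)) * ennreal (riesz_bound 1 (2 * r)))"
    proof (cases "norm z < r")
      case True
      then show ?thesis by (intro mult_left_mono nn_integral_riesz_kernel_shifted dim) auto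
    qed (simp add: g_supp)
    finally show "(\<integral>\<^sup>+x. ennreal (4 * r\<^sup>2) * ?k x z \<partial>lborel) \<le>
        ennreal (4 * r\<^sup>2 * riesz_bound 1 (2 * r)) * ennreal (norm (g z))"
      using riesz_bound_nonneg[of 1 "2 * r"]
      by (simp add: ennreal_mult mult_ac)
  qed
  also have "\<dots> = ennreal (4 * r\<^sup>2 * riesz_bound 1 (2 * r)) * (\<integral>\<^sup>+z. ennreal (norm (g z)) \<partial>lborel)"
    by (rule nn_integral_cmult) measurable
  finally show ?thesis .
qed

text \<open>Cauchy-Schwarz for \<open>\<bar>g\<bar> = (\<bar>g\<bar> (1 + \<bar>v\<bar>)\<^bsup>-\<theta>\<^esup>) (1 + \<bar>v\<bar>)\<^sup>\<theta>\<close>, using \<open>(1 + \<bar>v\<bar>)\<^bsup>2\<theta>\<^esup> \<le> 1 + \<bar>v\<bar>\<close>.\<close>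

lemma gradient_L1_bound_of_energy:
  assumes \<theta>: "0 \<le> \<theta>" "2 * \<theta> \<le> 1"
  shows "(\<integral>\<^sup>+z. ennreal (norm (g z)) \<partial>lborel)\<^sup>2 \<le>
    (\<integral>\<^sup>+z. ennreal ((norm (g z))\<^sup>2 / (1 + \<bar>v z\<bar>) powr (2 * \<theta>)) \<partial>lborel) *
    (emeasure lborel (ball 0 r :: 'a set) + (\<integral>\<^sup>+z. ennreal \<bar>v z\<bar> \<partial>lborel))"
proof -
  note [measurable] = v_borel g_borel
  have [measurable]: "ball 0 r \<in> sets (borel :: 'a measure)" by simp
  let ?f = "\<lambda>z. ennreal (norm (g z) / (1 + \<bar>v z\<bar>) powr \<theta>)"
    and ?h = "\<lambda>z. ennreal ((1 + \<bar>v z\<bar>) powr \<theta>) * indicator (ball 0 r) z"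
  have "(\<integral>\<^sup>+z. ennreal (norm (g z)) \<partial>lborel) = (\<integral>\<^sup>+z. ?f z * ?h z \<partial>lborel)"
  proof (rule nn_integral_cong)
    fix z
    show "ennreal (norm (g z)) = ?f z * ?h z"
      using g_supp[of z] by (cases "norm z < r") (auto simp: indicator_def simp flip: ennreal_mult)
  qed
  then have "(\<integral>\<^sup>+z. ennreal (norm (g z)) \<partial>lborel)\<^sup>2 \<le> (\<integral>\<^sup>+z. (?f z)\<^sup>2 \<partial>lborel) * (\<integral>\<^sup>+z. (?h z)\<^sup>2 \<partial>lborel)"
    using Cauchy_Schwarz_nn_integral[of ?f lborel ?h] by simp
  also have "(\<lambda>z. (?f z)\<^sup>2) = (\<lambda>z. ennreal ((norm (g z))\<^sup>2 / (1 + \<bar>v z\<bar>) powr (2 * \<theta>)))"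
    by (simp add: fun_eq_iff ennreal_power power_divide powr_power)
  also have "(\<integral>\<^sup>+z. (?h z)\<^sup>2 \<partial>lborel) \<le> (\<integral>\<^sup>+z. indicator (ball 0 r) z + ennreal \<bar>v z\<bar> \<partial>lborel)"
  proof (rule nn_integral_mono)
    fix z
    have "(1 + \<bar>v z\<bar>) powr (2 * \<theta>) \<le> (1 + \<bar>v z\<bar>) powr 1"
      using \<theta> by (intro powr_mono) auto
    then have "ennreal ((1 + \<bar>v z\<bar>) powr (2 * \<theta>)) \<le> ennreal (1 + \<bar>v z\<bar>)" by (intro ennreal_leI) simp
    then show "(?h z)\<^sup>2 \<le> indicator (ball 0 r) z + ennreal \<bar>v z\<bar>"
      by (auto simp: indicator_def power_mult_distrib ennreal_power powr_power ennreal_plus)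
  qed
  also have "\<dots> = emeasure lborel (ball 0 r :: 'a set) + (\<integral>\<^sup>+z. ennreal \<bar>v z\<bar> \<partial>lborel)"
    by (subst nn_integral_add) auto
  finally show ?thesis by (simp add: mult_left_mono)
qed

text \<open>Write the integrand of the potential as the product of \<open>\<bar>g\<bar> (1 + \<bar>v\<bar>)\<^bsup>-\<theta>\<^esup> \<bar>z - x\<bar>\<^bsup>-1/(2n)\<^esup>\<close> and
  \<open>(1 + \<bar>v\<bar>)\<^sup>\<theta> \<bar>z - x\<bar>\<^bsup>-(1 - 1/(2n))\<^esup>\<close>. The square of the second factor has an integral bounded by \<open>M\<close>, as
  \<open>v\<close> is bounded in \<open>L\<^sup>p\<close> and \<open>4 \<theta> n < p\<close>. The square of the first is the energy density times \<open>\<bar>z - x\<bar>\<^bsup>-1/n\<^esup>\<close>;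
  by the power mean inequality the \<open>n\<close>-th power of its integral costs only the kernel \<open>\<bar>z - x\<bar>\<^bsup>-1\<^esup>\<close>, which is integrable in \<open>x\<close>.\<close>

lemma L2n_bound_of_energy:
  assumes \<theta>: "0 < \<theta>" and n: "n \<ge> 1" and p: "4 * \<theta> * real n < p"
    and vp: "(\<integral>\<^sup>+x. ennreal (\<bar>v x\<bar> powr p) \<partial>lborel) \<le> 1"
    and E: "(\<integral>\<^sup>+z. ennreal ((norm (g z))\<^sup>2 / (1 + \<bar>v z\<bar>) powr (2 * \<theta>)) \<partial>lborel) = ennreal E" "E \<ge> 0"
  defines "M \<equiv> riesz_bound ((2 - 1 / real n) * (p / (p - 2 * \<theta>))) (2 * r) +
    2 powr p * (measure lborel (ball 0 r :: 'a set) + 1)"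
  shows "(\<integral>\<^sup>+x. ennreal ((m * \<bar>v x\<bar>) ^ (2 * n)) \<partial>lborel) \<le>
    ennreal ((16 * r ^ 4 * M) ^ n * E ^ n * riesz_bound 1 (2 * r))"
proof -
  note [measurable] = v_borel g_borel
  have [measurable]: "ball 0 r \<in> sets (borel :: 'a measure)" by simp
  define \<beta> where "\<beta> = (2 - 1 / real n) * (p / (p - 2 * \<theta>))"
  have n0: "real n \<ge> 1" using n by simp
  have "4 * \<theta> * 1 \<le> 4 * \<theta> * real n" using n0 \<theta> by (intro mult_left_mono) auto
  then have p0: "p > 4 * \<theta>" "p > 2 * \<theta>" "p > 0" using p \<theta> by linarith+
  have n1: "2 - 1 / real n \<ge> 1" using n0 by (simp add: field_simps)
  have \<beta>: "0 \<le> \<beta>" "\<beta> < 2"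
  proof -
    show "0 \<le> \<beta>" using n1 p0 by (simp add: \<beta>_def)
    have "(2 - 1 / real n) * p < 2 * (p - 2 * \<theta>)" using p n0 by (simp add: field_simps)
    then show "\<beta> < 2" using p0 by (simp add: \<beta>_def field_simps)
  qed
  have M: "M = riesz_bound \<beta> (2 * r) + 2 powr p * (measure lborel (ball 0 r :: 'a set) + 1)" "M \<ge> 0"
    using riesz_bound_nonneg[OF \<beta>(2)] by (auto simp: M_def \<beta>_def)
  define w where "w z = ennreal ((norm (g z))\<^sup>2 / (1 + \<bar>v z\<bar>) powr (2 * \<theta>))" for z
  have [measurable]: "w \<in> borel_measurable borel" unfolding w_def by measurable
  let ?N = "\<lambda>x. \<integral>\<^sup>+z. ennreal (norm (z - x) powr - 1) * w z \<partial>lborel"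
    and ?k = "\<lambda>x z. w z * (ennreal (norm (z - x) powr - 1) * indicator (ball 0 r) x)"
  \<comment> \<open>Young's inequality splits off the part of the kernel that stays integrable.\<close>
  have kernel: "(\<integral>\<^sup>+z. ennreal ((1 + \<bar>v z\<bar>) powr (2 * \<theta>) * norm (z - x) powr - (2 - 1 / real n)) * indicator (ball 0 r) z \<partial>lborel) \<le> ennreal M"
    if x: "norm x < r" for x
  proof -
    have "(\<integral>\<^sup>+z. ennreal ((1 + \<bar>v z\<bar>) powr (2 * \<theta>) * norm (z - x) powr - (2 - 1 / real n)) * indicator (ball 0 r) z \<partial>lborel) \<le>
      (\<integral>\<^sup>+z. ennreal (norm (x - z) powr - \<beta>) * indicator (ball 0 r) z + ennreal (2 powr p) * (indicator (ball 0 r) z + ennreal (\<bar>v z\<bar> powr p)) \<partial>lborel)"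
    proof (rule nn_integral_mono)
      fix z
      let ?a = "(1 + \<bar>v z\<bar>) powr (2 * \<theta>)" and ?b = "norm (z - x) powr - (2 - 1 / real n)"
      have "?a * ?b \<le> ?a powr (p / (2 * \<theta>)) / (p / (2 * \<theta>)) + ?b powr (p / (p - 2 * \<theta>)) / (p / (p - 2 * \<theta>))"
        using p0 \<theta> by (intro Youngs_inequality) (auto simp: field_simps)
      also have "\<dots> \<le> ?a powr (p / (2 * \<theta>)) + ?b powr (p / (p - 2 * \<theta>))"
      proof (rule add_mono)
        have le: "y / c \<le> y" if "c \<ge> 1" "y \<ge> 0" for y c :: real
          using that mult_left_mono[of 1 c y] by (simp add: field_simps)
        show "?a powr (p / (2 * \<theta>)) / (p / (2 * \<theta>)) \<le> ?a powr (p / (2 * \<theta>))"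
          by (rule le) (use p0 \<theta> in auto)
        show "?b powr (p / (p - 2 * \<theta>)) / (p / (p - 2 * \<theta>)) \<le> ?b powr (p / (p - 2 * \<theta>))"
          by (rule le) (use p0 \<theta> in auto)
      qed
      also have "?a powr (p / (2 * \<theta>)) = (1 + \<bar>v z\<bar>) powr p" using \<theta> by (simp add: powr_powr)
      also have "?b powr (p / (p - 2 * \<theta>)) = norm (x - z) powr - \<beta>"
        by (simp only: powr_powr \<beta>_def norm_minus_commute[of z x] mult_minus_left)
      also have "(1 + \<bar>v z\<bar>) powr p \<le> 2 powr p * (1 + \<bar>v z\<bar> powr p)"
      proof -
        have "(1 + \<bar>v z\<bar>) powr p \<le> (2 * max 1 \<bar>v z\<bar>) powr p" using p0 by (intro powr_mono2) auto
        also have "\<dots> = 2 powr p * max 1 \<bar>v z\<bar> powr p" by (simp add: powr_mult)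
        also have "max 1 \<bar>v z\<bar> powr p \<le> 1 + \<bar>v z\<bar> powr p" by (auto simp: max_def)
        finally show ?thesis by (simp add: mult_left_mono)
      qed
      finally have "ennreal (?a * ?b) \<le> ennreal (norm (x - z) powr - \<beta> + 2 powr p * (1 + \<bar>v z\<bar> powr p))"
        by (intro ennreal_leI) simp
      also have "\<dots> = ennreal (norm (x - z) powr - \<beta>) + ennreal (2 powr p) * (1 + ennreal (\<bar>v z\<bar> powr p))"
        by (simp add: ennreal_plus ennreal_mult)
      finally show "ennreal (?a * ?b) * indicator (ball 0 r) z \<le> ennreal (norm (x - z) powr - \<beta>) * indicator (ball 0 r) z + ennreal (2 powr p) * (indicator (ball 0 r) z + ennreal (\<bar>v z\<bar> powr p))"
        by (simp add: indicator_def)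
    qed
    also have "\<dots> = (\<integral>\<^sup>+z. ennreal (norm (x - z) powr - \<beta>) * indicator (ball 0 r) z \<partial>lborel) +
        ennreal (2 powr p) * (emeasure lborel (ball 0 r :: 'a set) + (\<integral>\<^sup>+z. ennreal (\<bar>v z\<bar> powr p) \<partial>lborel))"
      by (simp add: nn_integral_add nn_integral_cmult)
    also have "\<dots> \<le> ennreal (riesz_bound \<beta> (2 * r)) + ennreal (2 powr p) * (ennreal (measure lborel (ball 0 r :: 'a set)) + 1)"
      using vp emeasure_bounded_finite[of "ball 0 r :: 'a set"]
      by (intro add_mono mult_left_mono nn_integral_riesz_kernel_shifted dim \<beta> x) (auto simp: emeasure_eq_ennreal_measure)
    also have "\<dots> = ennreal M"
      using riesz_bound_nonneg[OF \<beta>(2), of "2 * r"] unfolding M(1)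
      by (simp add: ennreal_plus ennreal_mult)
    finally show ?thesis .
  qed
  have pointwise: "AE x in lborel. norm x < r \<longrightarrow> ennreal ((m * \<bar>v x\<bar>) ^ (2 * n)) \<le>
      ennreal ((16 * r ^ 4 * M) ^ n * E ^ (n - 1)) * ?N x"
    using potential
  proof eventually_elim
    case (elim x)
    show ?case
    proof
      assume x: "norm x < r"
      let ?I = "\<integral>\<^sup>+z. ennreal (norm (g z) / norm (z - x)) \<partial>lborel"
      let ?f = "\<lambda>z. ennreal (norm (g z) / (1 + \<bar>v z\<bar>) powr \<theta> * norm (z - x) powr - (1 / (2 * real n)))"
      let ?h = "\<lambda>z. ennreal ((1 + \<bar>v z\<bar>) powr \<theta> * norm (z - x) powr - (1 - 1 / (2 * real n))) * indicator (ball 0 r) z"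
      let ?H = "\<integral>\<^sup>+z. ennreal (norm (z - x) powr - (1 / real n)) * w z \<partial>lborel"
      have "?I = (\<integral>\<^sup>+z. ?f z * ?h z \<partial>lborel)"
      proof (rule nn_integral_cong_AE)
        have "AE z in lborel. z \<noteq> x" by (rule AE_lborel_singleton)
        then show "AE z in lborel. ennreal (norm (g z) / norm (z - x)) = ?f z * ?h z"
        proof eventually_elim
          case (elim z)
          have "norm (z - x) powr - (1 / (2 * real n)) * norm (z - x) powr - (1 - 1 / (2 * real n)) = norm (z - x) powr - 1"
            by (simp flip: powr_add)
          then have "norm (g z) / (1 + \<bar>v z\<bar>) powr \<theta> * norm (z - x) powr - (1 / (2 * real n)) *
              ((1 + \<bar>v z\<bar>) powr \<theta> * norm (z - x) powr - (1 - 1 / (2 * real n))) = norm (g z) * norm (z - x) powr - 1"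
            by (simp add: field_simps)
          also have "\<dots> = norm (g z) / norm (z - x)" by (simp add: powr_minus_divide)
          finally show ?case using g_supp[of z]
            by (cases "norm z < r") (auto simp: indicator_def simp flip: ennreal_mult)
        qed
      qed
      then have "?I\<^sup>2 \<le> (\<integral>\<^sup>+z. (?f z)\<^sup>2 \<partial>lborel) * (\<integral>\<^sup>+z. (?h z)\<^sup>2 \<partial>lborel)"
        using Cauchy_Schwarz_nn_integral[of ?f lborel ?h] by simp
      also have "(\<integral>\<^sup>+z. (?f z)\<^sup>2 \<partial>lborel) = ?H"
      proof (rule nn_integral_cong_AE)
        have "AE z in lborel. z \<noteq> x" by (rule AE_lborel_singleton)
        then show "AE z in lborel. (?f z)\<^sup>2 = ennreal (norm (z - x) powr - (1 / real n)) * w z"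
        proof eventually_elim
          case (elim z)
          have "(norm (g z) / (1 + \<bar>v z\<bar>) powr \<theta> * norm (z - x) powr - (1 / (2 * real n)))\<^sup>2 =
              norm (z - x) powr - (1 / real n) * ((norm (g z))\<^sup>2 / (1 + \<bar>v z\<bar>) powr (2 * \<theta>))"
            using elim by (simp add: power_mult_distrib power_divide powr_power)
          then show ?case by (simp add: w_def ennreal_power flip: ennreal_mult)
        qed
      qed
      also have "(\<integral>\<^sup>+z. (?h z)\<^sup>2 \<partial>lborel) =
          (\<integral>\<^sup>+z. ennreal ((1 + \<bar>v z\<bar>) powr (2 * \<theta>) * norm (z - x) powr - (2 - 1 / real n)) * indicator (ball 0 r) z \<partial>lborel)"
      proof (rule nn_integral_cong_AE)
        have "AE z in lborel. z \<noteq> x" by (rule AE_lborel_singleton)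
        then show "AE z in lborel. (?h z)\<^sup>2 = ennreal ((1 + \<bar>v z\<bar>) powr (2 * \<theta>) * norm (z - x) powr - (2 - 1 / real n)) * indicator (ball 0 r) z"
        proof eventually_elim
          case (elim z)
          have e: "2 * (1 / (2 * real n) - 1) = 1 / real n - 2" by (simp add: field_simps)
          have "((1 + \<bar>v z\<bar>) powr \<theta> * norm (z - x) powr - (1 - 1 / (2 * real n)))\<^sup>2 =
              (1 + \<bar>v z\<bar>) powr (2 * \<theta>) * norm (z - x) powr - (2 - 1 / real n)"
            using elim e by (simp add: power_mult_distrib powr_power)
          then show ?case by (simp add: indicator_def ennreal_power)
        qed
      qed
      also have "?H * \<dots> \<le> ?H * ennreal M" by (intro mult_left_mono kernel x) auto
      finally have I2: "?I\<^sup>2 \<le> ?H * ennreal M" .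
      have mean: "?H ^ n \<le> ennreal E ^ (n - 1) * ?N x"
      proof -
        have "?H ^ n \<le> ennreal E ^ (n - 1) * (\<integral>\<^sup>+z. ennreal ((norm (z - x) powr - (1 / real n)) ^ n) * w z \<partial>lborel)"
          using E unfolding w_def[symmetric] by (intro nn_integral_power_mean n) auto
        also have "(\<lambda>z. (norm (z - x) powr - (1 / real n)) ^ n) = (\<lambda>z. norm (z - x) powr - 1)"
        proof
          fix z
          show "(norm (z - x) powr - (1 / real n)) ^ n = norm (z - x) powr - 1"
            using n by (cases "z = x") (auto simp: powr_power zero_power)
        qed
        finally show ?thesis .
      qed
      have "ennreal ((m * \<bar>v x\<bar>) ^ (2 * n)) = ((ennreal (m * \<bar>v x\<bar>))\<^sup>2) ^ n"
        using m by (simp add: ennreal_power power_mult)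
      also have "\<dots> \<le> ((ennreal (4 * r\<^sup>2) * ?I)\<^sup>2) ^ n"
        using elim x by (intro power_mono) auto
      also have "\<dots> = (ennreal (16 * r ^ 4) * ?I\<^sup>2) ^ n"
        by (simp add: power_mult_distrib ennreal_power flip: power_mult)
      also have "\<dots> \<le> (ennreal (16 * r ^ 4) * (?H * ennreal M)) ^ n"
        by (intro power_mono mult_left_mono I2) auto
      also have "ennreal (16 * r ^ 4) * (?H * ennreal M) = ennreal (16 * r ^ 4 * M) * ?H"
        using M(2) r by (subst ennreal_mult) (simp_all only: mult_ac zero_le_power2 power_mult, simp)
      also have "(ennreal (16 * r ^ 4 * M) * ?H) ^ n = ennreal ((16 * r ^ 4 * M) ^ n) * ?H ^ n"
      proof -
        have "(ennreal y * H) ^ n = ennreal (y ^ n) * H ^ n" if "y \<ge> 0" for y H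
          using that by (simp add: power_mult_distrib ennreal_power)
        then show ?thesis using M(2) r by simp
      qed
      also have "\<dots> \<le> ennreal ((16 * r ^ 4 * M) ^ n) * (ennreal E ^ (n - 1) * ?N x)"
        by (intro mult_left_mono mean) auto
      also have "\<dots> = ennreal ((16 * r ^ 4 * M) ^ n * E ^ (n - 1)) * ?N x"
        using M(2) r E(2) by (simp add: ennreal_mult ennreal_power mult.assoc)
      finally show "ennreal ((m * \<bar>v x\<bar>) ^ (2 * n)) \<le>
        ennreal ((16 * r ^ 4 * M) ^ n * E ^ (n - 1)) * ?N x" .
    qed
  qed
  let ?c = "ennreal ((16 * r ^ 4 * M) ^ n * E ^ (n - 1))"
  have "(\<integral>\<^sup>+x. ennreal ((m * \<bar>v x\<bar>) ^ (2 * n)) \<partial>lborel) \<le>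
      (\<integral>\<^sup>+x. ?c * (\<integral>\<^sup>+z. ?k x z \<partial>lborel) \<partial>lborel)"
  proof (rule nn_integral_mono_AE)
    show "AE x in lborel. ennreal ((m * \<bar>v x\<bar>) ^ (2 * n)) \<le>
      ?c * (\<integral>\<^sup>+z. ?k x z \<partial>lborel)"
      using pointwise
    proof eventually_elim
      case (elim x)
      show ?case
      proof (cases "norm x < r")
        case True
        then show ?thesis using elim by (simp add: mult.commute)
      next
        case False
        then show ?thesis using n by (simp add: v_supp zero_power)
      qed
    qed
  qed
  also have "\<dots> = ?c * (\<integral>\<^sup>+x. (\<integral>\<^sup>+z. ?k x z \<partial>lborel) \<partial>lborel)"
    by (rule nn_integral_cmult) measurable
  also have "(\<integral>\<^sup>+x. (\<integral>\<^sup>+z. ?k x z \<partial>lborel) \<partial>lborel) =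
      (\<integral>\<^sup>+z. (\<integral>\<^sup>+x. ?k x z \<partial>lborel) \<partial>lborel)"
    by (rule lborel_pair.Fubini') measurable
  also have "?c * \<dots> \<le> ?c * (\<integral>\<^sup>+z. w z * ennreal (riesz_bound 1 (2 * r)) \<partial>lborel)"
  proof (intro mult_left_mono nn_integral_mono)
    fix z
    have "(\<integral>\<^sup>+x. ?k x z \<partial>lborel) =
        w z * (\<integral>\<^sup>+x. ennreal (norm (z - x) powr - 1) * indicator (ball 0 r) x \<partial>lborel)"
      by (rule nn_integral_cmult) measurable
    also have "\<dots> \<le> w z * ennreal (riesz_bound 1 (2 * r))"
    proof (cases "norm z < r")
      case True
      then show ?thesis by (intro mult_left_mono nn_integral_riesz_kernel_shifted dim) auto
    qed (simp add: w_def g_supp)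
    finally show "(\<integral>\<^sup>+x. ?k x z \<partial>lborel) \<le> w z * ennreal (riesz_bound 1 (2 * r))" .
  qed simp
  also have "(\<integral>\<^sup>+z. w z * ennreal (riesz_bound 1 (2 * r)) \<partial>lborel) = ennreal E * ennreal (riesz_bound 1 (2 * r))"
    using E(1) by (subst nn_integral_multc) (simp_all add: w_def[abs_def])
  also have "?c * \<dots> = ennreal ((16 * r ^ 4 * M) ^ n * (E ^ (n - 1) * E) * riesz_bound 1 (2 * r))"
    using M(2) r E(2) riesz_bound_nonneg[of 1 "2 * r"] by (simp add: ennreal_mult mult_ac)
  also have "E ^ (n - 1) * E = E ^ n" using n by (cases n) auto
  finally show ?thesis .
qed

end

text \<open>Lets the \<open>p\<close>-th power integral be estimated from the one with the larger even exponent.\<close>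

lemma powr_le_split_at:
  fixes y \<eta> :: real
  assumes "\<eta> > 0" "y \<ge> 0" "0 < p" "p \<le> real k"
  shows "y powr p \<le> \<eta> powr p + \<eta> powr (p - real k) * y ^ k"
proof (cases "y \<le> \<eta>")
  case True
  then have "y powr p \<le> \<eta> powr p" using assms by (intro powr_mono2) auto
  then show ?thesis using assms by (simp add: add_increasing2)
next
  case False
  then have y: "y > 0" using assms by auto
  have "y powr p = y powr (p - real k) * y ^ k"
    using y by (simp add: powr_diff powr_realpow)
  also have "\<dots> \<le> \<eta> powr (p - real k) * y ^ k"
    using False assms y by (intro mult_right_mono powr_mono2') auto
  finally show ?thesis by (simp add: add_increasing)
qed

section \<open>Passage to Borel representatives\<close>

lemma finite_measure_lebesgue_on_bounded:
  fixes S :: "'a::euclidean_space set"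
  assumes "open S" "bounded S"
  shows "finite_measure (lebesgue_on S)"
proof (rule finite_measureI)
  have "emeasure (lebesgue_on S) (space (lebesgue_on S)) = emeasure lborel S"
    using assms(1) by (simp add: emeasure_restrict_space space_restrict_space)
  then show "emeasure (lebesgue_on S) (space (lebesgue_on S)) \<noteq> \<infinity>"
    using emeasure_bounded_finite[OF assms(2)] by simp
qed

lemma le_one_plus_powr:
  fixes y p :: real
  assumes "y \<ge> 0" "p \<ge> 1"
  shows "y \<le> 1 + y powr p"
proof (cases "y \<le> 1")
  case False
  then have "y powr 1 \<le> y powr p" using assms by (intro powr_mono) auto
  then show ?thesis using False by simp
qed (simp add: add_increasing2)

lemma Lp_on_imp_integrable:
  assumes "f \<in> Lp_on q S" "open S" "bounded S" "q \<ge> 1"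
  shows "integrable (lebesgue_on S) f"
proof -
  interpret finite_measure "lebesgue_on S" using assms finite_measure_lebesgue_on_bounded by blast
  show ?thesis
  proof (rule Bochner_Integration.integrable_bound[of _ "\<lambda>x. 1 + norm (f x) powr q"])
    show "integrable (lebesgue_on S) (\<lambda>x. 1 + norm (f x) powr q)"
      using assms(1) by (auto simp: Lp_on_def)
    show "AE x in lebesgue_on S. norm (f x) \<le> norm (1 + norm (f x) powr q)"
      using assms(4) le_one_plus_powr[OF norm_ge_zero] by (intro AE_I2) auto
  qed (use assms(1) in \<open>auto simp: Lp_on_def\<close>)
qed

lemma lebesgue_on_measurable_AE:
  fixes f g :: "'a::euclidean_space \<Rightarrow> 'b::euclidean_space"
  assumes "open S" "f \<in> borel_measurable (lebesgue_on S)" "AE x in lebesgue_on S. f x = g x"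
  shows "g \<in> borel_measurable (lebesgue_on S)"
proof -
  have "(\<lambda>x. indicator S x *\<^sub>R f x) \<in> borel_measurable lebesgue"
    using assms(1,2) by (simp add: borel_measurable_restrict_space_iff)
  moreover have "AE x in lebesgue. indicator S x *\<^sub>R f x = indicator S x *\<^sub>R g x"
    using assms(1,3) by (auto simp: AE_restrict_space_iff indicator_def elim!: eventually_mono)
  ultimately have "(\<lambda>x. indicator S x *\<^sub>R g x) \<in> borel_measurable lebesgue"
    by (rule borel_measurable_AE)
  then show ?thesis using assms(1) by (simp add: borel_measurable_restrict_space_iff)
qed

lemma W1_weak_gradient:
  fixes v :: "'a::euclidean_space \<Rightarrow> real"
  assumes "v \<in> W1 q S" "open S"
  shows "has_weak_gradient_on v (weak_gradient S v) S" "weak_gradient S v \<in> Lp_on q S"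
proof -
  obtain g where g: "g \<in> Lp_on q S" "has_weak_gradient_on v g S" using assms by (auto simp: W1_def)
  show w: "has_weak_gradient_on v (weak_gradient S v) S"
    unfolding weak_gradient_def by (rule someI[of "\<lambda>g. has_weak_gradient_on v g S", OF g(2)])
  have ae: "AE x in lebesgue_on S. g x = weak_gradient S v x"
    by (rule has_weak_gradient_on_unique[OF assms(2) g(2) w])
  have [measurable]: "g \<in> borel_measurable (lebesgue_on S)" using g(1) by (simp add: Lp_on_def)
  have meas [measurable]: "weak_gradient S v \<in> borel_measurable (lebesgue_on S)"
    by (rule lebesgue_on_measurable_AE[OF assms(2) _ ae]) measurable
  have "integrable (lebesgue_on S) (\<lambda>x. norm (weak_gradient S v x) powr q)"
    by (rule integrable_cong_AE_imp[of _ "\<lambda>x. norm (g x) powr q"])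
       (use g(1) ae in \<open>auto simp: Lp_on_def elim: eventually_mono\<close>)
  then show "weak_gradient S v \<in> Lp_on q S" using meas by (simp add: Lp_on_def)
qed

lemma energy_eq:
  fixes v :: "'a::euclidean_space \<Rightarrow> real"
  assumes "open S" "v \<in> W1 q S" "has_weak_gradient_on v g S"
  shows "energy \<theta> S v = (\<integral>\<^sup>+x. ennreal ((norm (g x))\<^sup>2 / (1 + \<bar>v x\<bar>) powr (2 * \<theta>)) \<partial>lebesgue_on S)"
  unfolding energy_def
  by (rule nn_integral_cong_AE)
     (use has_weak_gradient_on_unique[OF assms(1) W1_weak_gradient(1)[OF assms(2,1)] assms(3)] in
       \<open>auto elim: eventually_mono\<close>)

lemma nn_integral_lebesgue_on_representative:
  fixes F :: "real \<Rightarrow> 'a::euclidean_space \<Rightarrow> ennreal"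
  assumes "open S" "AE x in lebesgue_on S. v x = v0 x" "AE x in lebesgue_on S. g x = g0 x"
    and "\<And>x. x \<notin> S \<Longrightarrow> F (v0 x) (g0 x) = 0"
  shows "(\<integral>\<^sup>+x. F (v x) (g x) \<partial>lebesgue_on S) = (\<integral>\<^sup>+x. F (v0 x) (g0 x) \<partial>lborel)"
proof -
  have "AE x in lebesgue_on S. F (v x) (g x) = F (v0 x) (g0 x)"
    using assms(2,3) by eventually_elim simp
  then have "(\<integral>\<^sup>+x. F (v x) (g x) \<partial>lebesgue_on S) = (\<integral>\<^sup>+x. F (v0 x) (g0 x) \<partial>lebesgue_on S)"
    by (rule nn_integral_cong_AE)
  also have "\<dots> = (\<integral>\<^sup>+x. F (v0 x) (g0 x) * indicator S x \<partial>lborel)"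
    using assms(1) by (simp add: nn_integral_restrict_space nn_integral_completion)
  also have "\<dots> = (\<integral>\<^sup>+x. F (v0 x) (g0 x) \<partial>lborel)"
    using assms(4) by (intro nn_integral_cong) (auto simp: indicator_def)
  finally show ?thesis .
qed

lemma integral_lebesgue_on_representative:
  fixes f f0 :: "'a::euclidean_space \<Rightarrow> real"
  assumes "open S" "AE x in lebesgue_on S. f x = f0 x" "\<And>x. x \<notin> S \<Longrightarrow> f0 x = 0"
    and "f \<in> borel_measurable (lebesgue_on S)" "f0 \<in> borel_measurable borel"
  shows "(LINT x|lebesgue_on S. f x) = (LINT x|lborel. f0 x)"
    and "integrable (lebesgue_on S) f \<longleftrightarrow> integrable lborel f0"
proof -
  have meas: "f0 \<in> borel_measurable (lebesgue_on S)"
    using assms(5) by (auto intro!: measurable_restrict_space1 measurable_completion)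
  have eq: "(\<lambda>x. indicator S x *\<^sub>R f0 x) = f0" using assms(3) by (auto simp: indicator_def fun_eq_iff)
  have "(LINT x|lebesgue_on S. f x) = (LINT x|lebesgue_on S. f0 x)"
    by (rule integral_cong_AE[OF assms(4) meas assms(2)])
  also have "\<dots> = (LINT x|lebesgue. indicator S x *\<^sub>R f0 x)"
    using assms(1) by (intro integral_restrict_space) simp
  also have "\<dots> = (LINT x|lborel. f0 x)"
    unfolding eq using assms(5) by (intro integral_completion) simp
  finally show "(LINT x|lebesgue_on S. f x) = (LINT x|lborel. f0 x)" .
  have "integrable (lebesgue_on S) f \<longleftrightarrow> integrable (lebesgue_on S) f0"
    by (rule integrable_cong_AE[OF assms(4) meas assms(2)])
  also have "\<dots> \<longleftrightarrow> integrable lebesgue (\<lambda>x. indicator S x *\<^sub>R f0 x)"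
    using assms(1) by (intro integrable_restrict_space) simp
  also have "\<dots> \<longleftrightarrow> integrable lborel f0"
    unfolding eq using assms(5) by (intro integrable_completion) simp
  finally show "integrable (lebesgue_on S) f \<longleftrightarrow> integrable lborel f0" .
qed

text \<open>The potential estimate for Sobolev functions on a disk, stated for Borel representatives of the
  function and of its weak gradient.\<close>

lemma mean_zero_representatives:
  fixes v :: "'a::euclidean_space \<Rightarrow> real"
  assumes dim: "DIM('a) = 2" and r: "r > 0" and q: "q \<ge> 1"
    and v: "v \<in> W1 q (ball 0 r)" and mean: "(LINT x|lebesgue_on (ball 0 r). v x) = 0"
  obtains v0 g0 where
    "v0 \<in> borel_measurable borel" "\<And>x. r \<le> norm x \<Longrightarrow> v0 x = 0" "AE x in lebesgue_on (ball 0 r). v x = v0 x"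
    "g0 \<in> borel_measurable borel" "\<And>x. r \<le> norm x \<Longrightarrow> g0 x = 0" "AE x in lebesgue_on (ball 0 r). weak_gradient (ball 0 r) v x = g0 x"
    "AE x in lborel. norm x < r \<longrightarrow> ennreal (measure lborel (ball 0 r :: 'a set) * \<bar>v0 x\<bar>) \<le>
      ennreal (4 * r\<^sup>2) * (\<integral>\<^sup>+z. ennreal (norm (g0 z) / norm (z - x)) \<partial>lborel)"
proof -
  let ?B = "ball 0 r :: 'a set"
  let ?g = "weak_gradient ?B v"
  note w = W1_weak_gradient[OF v open_ball]
  have vint: "integrable (lebesgue_on ?B) v"
    using v q by (intro Lp_on_imp_integrable[where q = q]) (auto simp: W1_def)
  have gint: "integrable (lebesgue_on ?B) ?g"
    using w(2) q by (intro Lp_on_imp_integrable[where q = q]) auto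
  obtain v0 where v0: "v0 \<in> borel_measurable borel" "\<And>x. x \<notin> ?B \<Longrightarrow> v0 x = 0" "AE x in lebesgue_on ?B. v x = v0 x"
    using borel_representative_on[OF open_ball borel_measurable_integrable[OF vint]] by metis
  obtain g0 where g0: "g0 \<in> borel_measurable borel" "\<And>x. x \<notin> ?B \<Longrightarrow> g0 x = 0" "AE x in lebesgue_on ?B. ?g x = g0 x"
    using borel_representative_on[OF open_ball borel_measurable_integrable[OF gint]] by metis
  note [measurable] = v0(1) g0(1)
  have v0int: "integrable lborel v0"
    using integral_lebesgue_on_representative(2)[OF open_ball v0(3,2) borel_measurable_integrable[OF vint] v0(1)] vint by simp
  have "integrable lborel (\<lambda>x. norm (g0 x))"
  proof -
    have "AE x in lebesgue_on ?B. norm (?g x) = norm (g0 x)" using g0(3) by eventually_elim simp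
    moreover have "(\<lambda>x. norm (g0 x)) \<in> borel_measurable borel" by measurable
    moreover have "norm (g0 x) = 0" if "x \<notin> ?B" for x using g0(2)[OF that] by simp
    ultimately have "integrable (lebesgue_on ?B) (\<lambda>x. norm (?g x)) \<longleftrightarrow> integrable lborel (\<lambda>x. norm (g0 x))"
      by (intro integral_lebesgue_on_representative(2)[OF open_ball] borel_measurable_integrable[OF integrable_norm[OF gint]])
    then show ?thesis using integrable_norm[OF gint] by blast
  qed
  then have g0int: "integrable lborel g0" by (rule integrable_norm_cancel) measurable
  have weak: "(LINT x|lborel. v0 x * frechet_derivative \<phi> (at x) h) = - (LINT x|lborel. (g0 x \<bullet> h) * \<phi> x)"
    if \<phi>: "\<phi> \<in> test_functions ?B" for \<phi> h
  proof -
    note [measurable] = test_functions_measurable[OF \<phi>] test_functions_measurable[OF test_functions_derivative[OF \<phi>]]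
    note prod = weak_gradient_integrable_products[OF w(1) open_ball \<phi>]
    have "(LINT x|lebesgue_on ?B. v x * frechet_derivative \<phi> (at x) h) = (LINT x|lborel. v0 x * frechet_derivative \<phi> (at x) h)"
    proof (rule integral_lebesgue_on_representative(1)[OF open_ball])
      show "AE x in lebesgue_on ?B. v x * frechet_derivative \<phi> (at x) h = v0 x * frechet_derivative \<phi> (at x) h"
        using v0(3) by eventually_elim simp
    qed (use v0(2) prod(2)[of h] in \<open>auto intro: borel_measurable_integrable\<close>)
    moreover have "(LINT x|lebesgue_on ?B. (?g x \<bullet> h) * \<phi> x) = (LINT x|lborel. (g0 x \<bullet> h) * \<phi> x)"
    proof (rule integral_lebesgue_on_representative(1)[OF open_ball])
      show "AE x in lebesgue_on ?B. (?g x \<bullet> h) * \<phi> x = (g0 x \<bullet> h) * \<phi> x"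
        using g0(3) by eventually_elim simp
    qed (use g0(2) prod(3)[of h] in \<open>auto intro: borel_measurable_integrable\<close>)
    ultimately show ?thesis using weak_gradient_direction[OF w(1) open_ball \<phi>, of h] by simp
  qed
  have mean0: "(LINT x|lborel. v0 x) = 0"
    using integral_lebesgue_on_representative(1)[OF open_ball v0(3,2) borel_measurable_integrable[OF vint] v0(1)] mean by simp
  have supp: "v0 x = 0" "g0 x = 0" if "r \<le> norm x" for x
    using v0(2)[of x] g0(2)[of x] that by auto
  show ?thesis
    by (rule that[OF v0(1) supp(1) v0(3) g0(1) supp(2) g0(3)
        mean_zero_potential_estimate[OF dim r v0(1) v0int supp(1) g0(1) g0int weak mean0]])
qed

lemma normalized_nn_integral:
  assumes "v \<in> normalized p S" "p > 0"
  shows "(\<integral>\<^sup>+x. ennreal (\<bar>v x\<bar> powr p) \<partial>lebesgue_on S) = 1"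
proof -
  have int: "integrable (lebesgue_on S) (\<lambda>x. \<bar>v x\<bar> powr p)"
    using assms by (auto simp: normalized_def Lp_on_def)
  let ?I = "LINT x|lebesgue_on S. \<bar>v x\<bar> powr p"
  have "?I \<ge> 0" by (rule integral_nonneg_AE) simp
  moreover have "?I powr (1 / p) = 1" using assms by (auto simp: normalized_def Lp_norm_on_def)
  ultimately have "?I = (1::real) powr p" using assms(2) by (metis powr_one_eq_one powr_powr nonzero_eq_divide_eq powr_one less_irrefl mult.commute)
  then have "?I = 1" by simp
  then show ?thesis using int by (subst nn_integral_eq_integral) auto
qed

section \<open>Lower bounds for the energy on the ball\<close>

lemma measure_ball_pos: "r > 0 \<Longrightarrow> measure lborel (ball 0 r :: 'a::euclidean_space set) > 0"
  using content_ball_pos[of r "0::'a"] by (simp add: measure_completion)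

lemma L1_bound_on_normalized:
  assumes dim: "DIM('a::euclidean_space) = 2" and r: "r > 0" and q: "q \<ge> 1"
    and \<theta>: "0 \<le> \<theta>" "2 * \<theta> \<le> 1"
  obtains C where "C > 0" "\<And>p v E. p \<ge> 1 \<Longrightarrow> v \<in> W1 q (ball 0 r :: 'a set) \<Longrightarrow> v \<in> normalized p (ball 0 r) \<Longrightarrow>
    energy \<theta> (ball 0 r) v \<le> ennreal E \<Longrightarrow> E \<ge> 0 \<Longrightarrow> (LINT x|lebesgue_on (ball 0 r). \<bar>v x\<bar>)\<^sup>2 \<le> C * E"
proof -
  let ?B = "ball 0 r :: 'a set"
  define m where "m = measure lborel ?B"
  define c where "c = 4 * r\<^sup>2 * riesz_bound 1 (2 * r) / m"
  have m: "m > 0" using r by (simp add: m_def measure_ball_pos)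
  have c: "c \<ge> 0" using m riesz_bound_nonneg[of 1] by (simp add: c_def)
  have em: "emeasure lborel ?B = ennreal m"
    using emeasure_bounded_finite[of ?B] by (simp add: m_def emeasure_eq_ennreal_measure)
  have "(LINT x|lebesgue_on ?B. \<bar>v x\<bar>)\<^sup>2 \<le> (c\<^sup>2 * (2 * m + 1) + 1) * E"
    if p: "p \<ge> 1" and v: "v \<in> W1 q ?B" "v \<in> normalized p ?B" and E: "energy \<theta> ?B v \<le> ennreal E" "E \<ge> 0" for p v E
  proof -
    have mean: "(LINT x|lebesgue_on ?B. v x) = 0" using v(2) by (simp add: normalized_def)
    obtain v0 g0 where R: "v0 \<in> borel_measurable borel" "\<And>x. r \<le> norm x \<Longrightarrow> v0 x = 0" "AE x in lebesgue_on ?B. v x = v0 x"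
      "g0 \<in> borel_measurable borel" "\<And>x. r \<le> norm x \<Longrightarrow> g0 x = 0" "AE x in lebesgue_on ?B. weak_gradient ?B v x = g0 x"
      "AE x in lborel. norm x < r \<longrightarrow> ennreal (m * \<bar>v0 x\<bar>) \<le>
        ennreal (4 * r\<^sup>2) * (\<integral>\<^sup>+z. ennreal (norm (g0 z) / norm (z - x)) \<partial>lborel)"
      by (rule mean_zero_representatives[OF dim r q v(1) mean, folded m_def]) (rule that, blast+)
    note [measurable] = R(1,4)
    have vint: "integrable (lebesgue_on ?B) v"
      using v(1) q by (intro Lp_on_imp_integrable[where q = q]) (auto simp: W1_def)
    define I where "I = (LINT x|lebesgue_on ?B. \<bar>v x\<bar>)"
    have I0: "I \<ge> 0" unfolding I_def by simp
    have I: "(\<integral>\<^sup>+x. ennreal \<bar>v0 x\<bar> \<partial>lborel) = ennreal I"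
    proof -
      have "(\<integral>\<^sup>+x. ennreal \<bar>v0 x\<bar> \<partial>lborel) = (\<integral>\<^sup>+x. ennreal \<bar>v x\<bar> \<partial>lebesgue_on ?B)"
        by (rule nn_integral_lebesgue_on_representative[OF open_ball R(3,6), of "\<lambda>y _. ennreal \<bar>y\<bar>", symmetric]) (simp add: R(2))
      also have "\<dots> = ennreal I" unfolding I_def using vint by (intro nn_integral_eq_integral) auto
      finally show ?thesis .
    qed
    have Ile: "I \<le> m + 1"
    proof -
      have "ennreal I = (\<integral>\<^sup>+x. ennreal \<bar>v x\<bar> \<partial>lebesgue_on ?B)"
        unfolding I_def using vint by (intro nn_integral_eq_integral[symmetric]) auto
      also have "\<dots> \<le> (\<integral>\<^sup>+x. 1 + ennreal (\<bar>v x\<bar> powr p) \<partial>lebesgue_on ?B)"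
      proof (rule nn_integral_mono)
        fix x
        have "ennreal \<bar>v x\<bar> \<le> ennreal (1 + \<bar>v x\<bar> powr p)"
          using p by (intro ennreal_leI le_one_plus_powr) auto
        then show "ennreal \<bar>v x\<bar> \<le> 1 + ennreal (\<bar>v x\<bar> powr p)" by (simp add: ennreal_plus)
      qed
      also have "\<dots> = emeasure (lebesgue_on ?B) (space (lebesgue_on ?B)) + 1"
        using normalized_nn_integral[OF v(2)] p vint by (subst nn_integral_add) auto
      also have "\<dots> = ennreal (m + 1)"
        using m em by (simp add: emeasure_restrict_space space_restrict_space ennreal_plus)
      finally show ?thesis using m by (subst (asm) ennreal_le_iff) simp_all
    qed
    have en: "(\<integral>\<^sup>+z. ennreal ((norm (g0 z))\<^sup>2 / (1 + \<bar>v0 z\<bar>) powr (2 * \<theta>)) \<partial>lborel) \<le> ennreal E"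
      using nn_integral_lebesgue_on_representative[OF open_ball R(3,6), of "\<lambda>y g. ennreal ((norm g)\<^sup>2 / (1 + \<bar>y\<bar>) powr (2 * \<theta>))"] E(1) R(5)
      by (simp add: energy_def)
    let ?N = "\<integral>\<^sup>+z. ennreal (norm (g0 z)) \<partial>lborel"
    have "ennreal m * ennreal I = (\<integral>\<^sup>+x. ennreal (m * \<bar>v0 x\<bar>) \<partial>lborel)"
      using m I by (simp add: ennreal_mult nn_integral_cmult)
    also have "\<dots> \<le> ennreal (4 * r\<^sup>2 * riesz_bound 1 (2 * r)) * ?N"
      by (rule L1_bound_of_potential[OF dim r m R(1,2,4,5,7)])
    finally have "ennreal (1 / m) * (ennreal m * ennreal I) \<le> ennreal (1 / m) * (ennreal (4 * r\<^sup>2 * riesz_bound 1 (2 * r)) * ?N)"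
      by (rule mult_left_mono) simp
    then have "ennreal I \<le> ennreal c * ?N"
      using m I0 riesz_bound_nonneg[of 1 "2 * r"]
      by (simp add: c_def mult.assoc[symmetric] flip: ennreal_mult)
    then have "(ennreal I)\<^sup>2 \<le> (ennreal c * ?N)\<^sup>2" by (intro power_mono) auto
    also have "\<dots> = ennreal (c\<^sup>2) * ?N\<^sup>2" using c by (simp add: power_mult_distrib ennreal_power)
    also have "\<dots> \<le> ennreal (c\<^sup>2) * (ennreal E * (ennreal m + ennreal (m + 1)))"
    proof (rule mult_left_mono)
      have "?N\<^sup>2 \<le> (\<integral>\<^sup>+z. ennreal ((norm (g0 z))\<^sup>2 / (1 + \<bar>v0 z\<bar>) powr (2 * \<theta>)) \<partial>lborel) * (ennreal m + ennreal I)"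
        using gradient_L1_bound_of_energy[OF dim r m R(1,2,4,5,7) \<theta>] by (simp add: em I)
      also have "\<dots> \<le> ennreal E * (ennreal m + ennreal (m + 1))"
        using Ile by (intro mult_mono en add_left_mono ennreal_leI) auto
      finally show "?N\<^sup>2 \<le> ennreal E * (ennreal m + ennreal (m + 1))" .
    qed simp
    also have "\<dots> = ennreal (c\<^sup>2 * (2 * m + 1) * E)"
      using m E(2) by (simp add: ennreal_mult[symmetric] ennreal_plus[symmetric] mult_ac del: ennreal_plus)
    finally have "I\<^sup>2 \<le> c\<^sup>2 * (2 * m + 1) * E"
      using I0 m E(2) by (simp add: ennreal_power ennreal_le_iff)
    also have "\<dots> \<le> (c\<^sup>2 * (2 * m + 1) + 1) * E" using E(2) by (intro mult_right_mono) auto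
    finally show ?thesis by (simp add: I_def)
  qed
  moreover have "c\<^sup>2 * (2 * m + 1) + 1 > 0" using m by (intro add_nonneg_pos mult_nonneg_nonneg) auto
  ultimately show ?thesis using that by blast
qed

text \<open>Take \<open>n\<close> minimal with \<open>p \<le> 2n\<close>; the condition on \<open>p\<close> ensures \<open>4 \<theta> n < p\<close>. A function of norm one carries at
  least half of \<open>\<integral>\<bar>v\<bar>\<^sup>p\<close> above a fixed threshold, hence has a \<open>2n\<close>-th power integral bounded below, whereas
  that integral is at most a constant times \<open>E\<^sup>n\<close>.\<close>

lemma energy_bounded_below_on_normalized:
  assumes dim: "DIM('a::euclidean_space) = 2" and r: "r > 0" and q: "q \<ge> 1"
    and \<theta>: "0 < \<theta>" "2 * \<theta> < 1" and p: "p \<ge> 1" "4 * \<theta> \<le> (1 - 2 * \<theta>) * p"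
  obtains e where "e > 0" "\<And>v. v \<in> W1 q (ball 0 r :: 'a set) \<Longrightarrow> v \<in> normalized p (ball 0 r) \<Longrightarrow>
    ennreal e \<le> energy \<theta> (ball 0 r) v"
proof -
  let ?B = "ball 0 r :: 'a set"
  define m where "m = measure lborel ?B"
  have m: "m > 0" using r by (simp add: m_def measure_ball_pos)
  have em: "emeasure lborel ?B = ennreal m"
    using emeasure_bounded_finite[of ?B] by (simp add: m_def emeasure_eq_ennreal_measure)
  define n where "n = nat \<lceil>p / 2\<rceil>"
  have n: "p \<le> 2 * real n" "real n < p / 2 + 1" "n \<ge> 1"
  proof -
    have "real n = of_int \<lceil>p / 2\<rceil>" using p by (simp add: n_def)
    then show "p \<le> 2 * real n" "real n < p / 2 + 1" by linarith+
    then show "n \<ge> 1" using p by linarith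
  qed
  have np: "4 * \<theta> * real n < p"
  proof -
    have "4 * \<theta> * real n < 4 * \<theta> * (p / 2 + 1)" using n(2) \<theta> by (intro mult_strict_left_mono) auto
    also have "\<dots> \<le> p" using p(2) by (simp add: algebra_simps)
    finally show ?thesis .
  qed
  define M where "M = riesz_bound ((2 - 1 / real n) * (p / (p - 2 * \<theta>))) (2 * r) + 2 powr p * (m + 1)"
  \<comment> \<open>The threshold at which the part of \<open>v\<close> below it carries at most half of the norm.\<close>
  define \<eta> where "\<eta> = (1 / (2 * m)) powr (1 / p)"
  have \<eta>: "\<eta> > 0" "\<eta> powr p = 1 / (2 * m)" using m p by (auto simp: \<eta>_def powr_powr)
  define K where "K = \<bar>\<eta> powr (p - real (2 * n)) / m ^ (2 * n) * (16 * r ^ 4 * M) ^ n * riesz_bound 1 (2 * r)\<bar>"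
  \<comment> \<open>Below \<open>e\<close> the energy satisfies \<open>E\<^sup>n \<le> E\<close>, so that \<open>K E\<^sup>n < 1/2\<close>.\<close>
  define e where "e = min 1 (1 / (2 * (K + 1)))"
  have K0: "K \<ge> 0" by (simp add: K_def)
  have e0: "e > 0" using K0 by (simp add: e_def)
  have "ennreal e \<le> energy \<theta> ?B v" if v: "v \<in> W1 q ?B" "v \<in> normalized p ?B" for v
  proof (rule ccontr)
    assume neg: "\<not> ennreal e \<le> energy \<theta> ?B v"
    then have lt: "energy \<theta> ?B v < ennreal e" by simp
    then obtain E where E: "energy \<theta> ?B v = ennreal E" "E \<ge> 0" by (cases "energy \<theta> ?B v") auto
    have Ee: "E < e" using lt E e0 by (simp add: ennreal_less_iff)
    have mean: "(LINT x|lebesgue_on ?B. v x) = 0" using v(2) by (simp add: normalized_def)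
    obtain v0 g0 where R: "v0 \<in> borel_measurable borel" "\<And>x. r \<le> norm x \<Longrightarrow> v0 x = 0" "AE x in lebesgue_on ?B. v x = v0 x"
      "g0 \<in> borel_measurable borel" "\<And>x. r \<le> norm x \<Longrightarrow> g0 x = 0" "AE x in lebesgue_on ?B. weak_gradient ?B v x = g0 x"
      "AE x in lborel. norm x < r \<longrightarrow> ennreal (m * \<bar>v0 x\<bar>) \<le>
        ennreal (4 * r\<^sup>2) * (\<integral>\<^sup>+z. ennreal (norm (g0 z) / norm (z - x)) \<partial>lborel)"
      by (rule mean_zero_representatives[OF dim r q v(1) mean, folded m_def]) (rule that, blast+)
    note [measurable] = R(1,4)
    have [measurable]: "?B \<in> sets borel" by simp
    have vp: "(\<integral>\<^sup>+x. ennreal (\<bar>v0 x\<bar> powr p) \<partial>lborel) = 1"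
      using nn_integral_lebesgue_on_representative[OF open_ball R(3,6), of "\<lambda>y _. ennreal (\<bar>y\<bar> powr p)"]
        normalized_nn_integral[OF v(2)] p R(2) by simp
    have en: "(\<integral>\<^sup>+z. ennreal ((norm (g0 z))\<^sup>2 / (1 + \<bar>v0 z\<bar>) powr (2 * \<theta>)) \<partial>lborel) = ennreal E"
      using nn_integral_lebesgue_on_representative[OF open_ball R(3,6), of "\<lambda>y g. ennreal ((norm g)\<^sup>2 / (1 + \<bar>y\<bar>) powr (2 * \<theta>))"] E(1) R(5)
      by (simp add: energy_def)
    let ?c = "\<eta> powr (p - real (2 * n)) / m ^ (2 * n)"
    have "1 = (\<integral>\<^sup>+x. ennreal (\<bar>v0 x\<bar> powr p) \<partial>lborel)" using vp by simp
    also have "\<dots> \<le> (\<integral>\<^sup>+x. ennreal (1 / (2 * m)) * indicator ?B x + ennreal ?c * ennreal ((m * \<bar>v0 x\<bar>) ^ (2 * n)) \<partial>lborel)"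
    proof (rule nn_integral_mono)
      fix x
      have "\<bar>v0 x\<bar> powr p \<le> 1 / (2 * m) + \<eta> powr (p - real (2 * n)) * \<bar>v0 x\<bar> ^ (2 * n)"
        using powr_le_split_at[OF \<eta>(1), of "\<bar>v0 x\<bar>" p "2 * n"] \<eta>(2) n p by simp
      also have "\<eta> powr (p - real (2 * n)) * \<bar>v0 x\<bar> ^ (2 * n) = ?c * (m * \<bar>v0 x\<bar>) ^ (2 * n)"
        using m by (simp add: power_mult_distrib)
      finally have "ennreal (\<bar>v0 x\<bar> powr p) \<le> ennreal (1 / (2 * m) + ?c * (m * \<bar>v0 x\<bar>) ^ (2 * n))"
        by (intro ennreal_leI)
      also have "\<dots> = ennreal (1 / (2 * m)) + ennreal ?c * ennreal ((m * \<bar>v0 x\<bar>) ^ (2 * n))"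
      proof -
        have "?c \<ge> 0" "(m * \<bar>v0 x\<bar>) ^ (2 * n) \<ge> 0" using m by simp_all
        then have "ennreal (1 / (2 * m) + ?c * (m * \<bar>v0 x\<bar>) ^ (2 * n)) = ennreal (1 / (2 * m)) + ennreal (?c * (m * \<bar>v0 x\<bar>) ^ (2 * n))"
          using m by (intro ennreal_plus mult_nonneg_nonneg) simp_all
        then show ?thesis by (simp only: ennreal_mult'[OF \<open>?c \<ge> 0\<close>])
      qed
      finally show "ennreal (\<bar>v0 x\<bar> powr p) \<le> ennreal (1 / (2 * m)) * indicator ?B x + ennreal ?c * ennreal ((m * \<bar>v0 x\<bar>) ^ (2 * n))"
        using R(2)[of x] p by (cases "norm x < r") (auto simp: indicator_def)
    qed
    also have "\<dots> = ennreal (1 / (2 * m)) * ennreal m + ennreal ?c * (\<integral>\<^sup>+x. ennreal ((m * \<bar>v0 x\<bar>) ^ (2 * n)) \<partial>lborel)"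
      by (subst nn_integral_add) (auto simp: nn_integral_cmult em)
    also have "\<dots> \<le> ennreal (1 / 2) + ennreal ?c * ennreal ((16 * r ^ 4 * M) ^ n * E ^ n * riesz_bound 1 (2 * r))"
    proof (rule add_mono)
      show "ennreal (1 / (2 * m)) * ennreal m \<le> ennreal (1 / 2)"
        using m by (simp flip: ennreal_mult)
      show "ennreal ?c * (\<integral>\<^sup>+x. ennreal ((m * \<bar>v0 x\<bar>) ^ (2 * n)) \<partial>lborel) \<le>
          ennreal ?c * ennreal ((16 * r ^ 4 * M) ^ n * E ^ n * riesz_bound 1 (2 * r))"
        unfolding M_def m_def
        by (intro mult_left_mono L2n_bound_of_energy[OF dim r _ R(1,2,4,5) R(7)[unfolded m_def] \<theta>(1) n(3) np _ en E(2)])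
           (use m vp in \<open>auto simp: m_def\<close>)
    qed
    also have "\<dots> \<le> ennreal (1 / 2) + ennreal (K * E ^ n)"
    proof (rule add_left_mono)
      have "?c \<ge> 0" using m by simp
      then have "ennreal ?c * ennreal ((16 * r ^ 4 * M) ^ n * E ^ n * riesz_bound 1 (2 * r)) =
          ennreal (?c * ((16 * r ^ 4 * M) ^ n * E ^ n * riesz_bound 1 (2 * r)))"
        by (rule ennreal_mult'[symmetric])
      also have "\<dots> \<le> ennreal (K * E ^ n)"
      proof (rule ennreal_leI)
        have "?c * (16 * r ^ 4 * M) ^ n * riesz_bound 1 (2 * r) \<le> K" unfolding K_def by (rule abs_ge_self)
        then have "(?c * (16 * r ^ 4 * M) ^ n * riesz_bound 1 (2 * r)) * E ^ n \<le> K * E ^ n"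
          using E(2) by (intro mult_right_mono) auto
        then show "?c * ((16 * r ^ 4 * M) ^ n * E ^ n * riesz_bound 1 (2 * r)) \<le> K * E ^ n"
          by (simp only: mult_ac)
      qed
      finally show "ennreal ?c * ennreal ((16 * r ^ 4 * M) ^ n * E ^ n * riesz_bound 1 (2 * r)) \<le> ennreal (K * E ^ n)" .
    qed
    also have "\<dots> = ennreal (1 / 2 + K * E ^ n)" using K0 E(2) by (subst ennreal_plus) auto
    finally have "1 \<le> ennreal (1 / 2 + K * E ^ n)" .
    then have "ennreal 1 \<le> ennreal (1 / 2 + K * E ^ n)" by (simp only: ennreal_1)
    then have half: "1 \<le> 1 / 2 + K * E ^ n" using K0 E(2) by (subst (asm) ennreal_le_iff) auto
    have "E ^ n \<le> E" using Ee E(2) n(3) power_decreasing[of 1 n E] by (simp add: e_def)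
    then have "K * E ^ n \<le> (K + 1) * E" using K0 E(2) by (intro mult_mono) auto
    also have "\<dots> < (K + 1) * (1 / (2 * (K + 1)))" using Ee K0 by (intro mult_strict_left_mono) (auto simp: e_def)
    also have "\<dots> = 1 / 2" using K0 by simp
    finally show False using half by simp
  qed
  then show ?thesis using that e0 by blast
qed

section \<open>Antisymmetric functions of small energy\<close>

text \<open>The powers \<open>\<bar>x - a\<bar>\<^sup>\<tau>\<close> with small \<open>\<tau>\<close> vary from \<open>0\<close> to nearly \<open>1\<close> within a bounded region at an energy of
  order \<open>\<tau>\<close>. Adding \<open>\<epsilon>\<close> makes them smooth without increasing the bound on the gradient.\<close>

lemma regularized_power_has_derivative:
  fixes x a :: "'a::euclidean_space"
  assumes "\<epsilon> > 0"
  shows "((\<lambda>x. (\<epsilon> + (norm (x - a))\<^sup>2) powr (\<tau> / 2)) has_derivative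
    (\<lambda>h. ((\<tau> * (\<epsilon> + (norm (x - a))\<^sup>2) powr (\<tau> / 2 - 1)) *\<^sub>R (x - a)) \<bullet> h)) (at x)"
proof -
  have pos: "\<epsilon> + (norm (x - a))\<^sup>2 > 0" using assms by (simp add: add_pos_nonneg)
  have d: "((\<lambda>x. \<epsilon> + (norm (x - a))\<^sup>2) has_derivative (\<lambda>h. 2 * ((x - a) \<bullet> h))) (at x)"
    unfolding power2_norm_eq_inner
    by (auto intro!: derivative_eq_intros simp: inner_commute)
  have "((\<lambda>t. t powr (\<tau> / 2)) has_derivative
      (\<lambda>t. (\<tau> / 2 * (\<epsilon> + (norm (x - a))\<^sup>2) powr (\<tau> / 2 - 1)) * t)) (at (\<epsilon> + (norm (x - a))\<^sup>2))"
    using has_real_derivative_powr[OF pos, of "\<tau> / 2"] unfolding has_field_derivative_def .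
  from has_derivative_compose[OF d this]
  have "((\<lambda>x. (\<epsilon> + (norm (x - a))\<^sup>2) powr (\<tau> / 2)) has_derivative
      (\<lambda>h. \<tau> / 2 * (\<epsilon> + (norm (x - a))\<^sup>2) powr (\<tau> / 2 - 1) * (2 * ((x - a) \<bullet> h)))) (at x)" .
  moreover have "(\<lambda>h. \<tau> / 2 * (\<epsilon> + (norm (x - a))\<^sup>2) powr (\<tau> / 2 - 1) * (2 * ((x - a) \<bullet> h))) =
      (\<lambda>h. ((\<tau> * (\<epsilon> + (norm (x - a))\<^sup>2) powr (\<tau> / 2 - 1)) *\<^sub>R (x - a)) \<bullet> h)"
    by (simp add: fun_eq_iff)
  ultimately show ?thesis by (simp only:)
qed

lemma regularized_power_gradient_bound:
  fixes y :: "'a::euclidean_space"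
  assumes "\<epsilon> > 0" "0 < \<tau>" "\<tau> < 1" "y \<noteq> 0"
  shows "(norm ((\<tau> * (\<epsilon> + (norm y)\<^sup>2) powr (\<tau> / 2 - 1)) *\<^sub>R y))\<^sup>2 \<le> \<tau>\<^sup>2 * norm y powr - (2 - 2 * \<tau>)"
proof -
  have ny: "norm y > 0" using assms by simp
  then have pos: "\<epsilon> + (norm y)\<^sup>2 > 0" using assms by (simp add: add_pos_nonneg)
  have "((\<epsilon> + (norm y)\<^sup>2) powr (\<tau> / 2 - 1))\<^sup>2 = (\<epsilon> + (norm y)\<^sup>2) powr (\<tau> - 2)"
    using pos by (simp add: powr_power algebra_simps)
  also have "\<dots> \<le> ((norm y)\<^sup>2) powr (\<tau> - 2)"
    using assms ny by (intro powr_mono2') auto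
  also have "\<dots> = norm y powr (2 * (\<tau> - 2))"
    using ny powr_powr[of "norm y" 2 "\<tau> - 2"] by (simp add: powr_numeral)
  finally have "((\<epsilon> + (norm y)\<^sup>2) powr (\<tau> / 2 - 1))\<^sup>2 \<le> norm y powr (2 * (\<tau> - 2))" .
  then have "\<tau>\<^sup>2 * ((\<epsilon> + (norm y)\<^sup>2) powr (\<tau> / 2 - 1))\<^sup>2 * (norm y)\<^sup>2 \<le> \<tau>\<^sup>2 * norm y powr (2 * (\<tau> - 2)) * (norm y)\<^sup>2"
    by (intro mult_right_mono mult_left_mono) auto
  also have "norm y powr (2 * (\<tau> - 2)) * (norm y)\<^sup>2 = norm y powr - (2 - 2 * \<tau>)"
    using ny powr_add[of "norm y" "2 * (\<tau> - 2)" 2] by (simp add: powr_numeral algebra_simps)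
  then have "\<tau>\<^sup>2 * norm y powr (2 * (\<tau> - 2)) * (norm y)\<^sup>2 = \<tau>\<^sup>2 * norm y powr - (2 - 2 * \<tau>)" by (simp only: mult.assoc)
  finally show ?thesis by (simp add: power_mult_distrib)
qed

text \<open>The energy \<open>\<tau>\<^sup>2 \<integral>\<bar>x\<bar>\<^bsup>2\<tau> - 2\<^esup>\<close> is of order \<open>\<tau>\<close>, since \<open>1 - 2\<^bsup>-2\<tau>\<^esup> \<ge> \<tau> / 2\<close>.\<close>

lemma riesz_bound_near_2:
  assumes "0 < \<tau>" "\<tau> < 1" "R > 0"
  shows "\<tau>\<^sup>2 * riesz_bound (2 - 2 * \<tau>) R \<le> 8 * unit_ball_vol 2 * (1 + R)\<^sup>2 * \<tau>"
proof -
  have "(2::real) powr - (2 * \<tau>) \<le> exp (- \<tau>)"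
  proof -
    have "1 / 2 \<le> ln (2::real)" using ln_le_minus_one[of "1 / 2 :: real"] by (simp add: ln_div)
    then have "\<tau> * 1 \<le> \<tau> * (2 * ln 2)" using assms by (intro mult_left_mono) auto
    then have "- (2 * \<tau>) * ln 2 \<le> - \<tau>" by simp
    then show ?thesis by (simp add: powr_def)
  qed
  also have "exp (- \<tau>) \<le> 1 / (1 + \<tau>)"
    using exp_ge_add_one_self[of \<tau>] assms by (simp add: exp_minus field_simps)
  also have "\<dots> \<le> 1 - \<tau> / 2" using assms by (simp add: field_simps power2_eq_square)
  finally have den: "\<tau> / 2 \<le> 1 - 2 powr - (2 * \<tau>)" by simp
  have "R powr (2 * \<tau>) \<le> (1 + R) powr (2 * \<tau>)" using assms by (intro powr_mono2) auto
  also have "\<dots> \<le> (1 + R) powr 2" using assms by (intro powr_mono) auto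
  also have "\<dots> = (1 + R)\<^sup>2" using assms by (simp add: powr_numeral)
  finally have num: "R powr (2 * \<tau>) \<le> (1 + R)\<^sup>2" .
  have "riesz_bound (2 - 2 * \<tau>) R = 4 * unit_ball_vol 2 * R powr (2 * \<tau>) / (1 - 2 powr - (2 * \<tau>))"
    by (simp add: riesz_bound_def)
  also have "\<dots> \<le> 4 * unit_ball_vol 2 * (1 + R)\<^sup>2 / (\<tau> / 2)"
    using den num assms by (intro frac_le mult_left_mono) auto
  finally have "\<tau>\<^sup>2 * riesz_bound (2 - 2 * \<tau>) R \<le> \<tau>\<^sup>2 * (4 * unit_ball_vol 2 * (1 + R)\<^sup>2 / (\<tau> / 2))"
    by (rule mult_left_mono) simp
  also have "\<dots> = 8 * unit_ball_vol 2 * (1 + R)\<^sup>2 * \<tau>"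
    using assms by (simp add: power2_eq_square field_simps)
  finally show ?thesis .
qed

text \<open>The difference of two regularized powers centred at \<open>a = (r/2) e\<close> and at its mirror image \<open>- a\<close>. Near \<open>a\<close>
  the first is at most \<open>1/4\<close> and the second at least \<open>3/4\<close>; the factor \<open>2\<close> raises the gap of \<open>1/2\<close> to \<open>1\<close>.\<close>

lemma small_energy_antisymmetric_function:
  fixes e :: "'a::euclidean_space"
  assumes dim: "DIM('a) = 2" and e: "e \<in> Basis" and r: "r > 0" and \<delta>: "\<delta> > 0"
  obtains v :: "'a \<Rightarrow> real" and G a \<rho> where
    "\<And>x. (v has_derivative (\<lambda>h. G x \<bullet> h)) (at x)" "continuous_on UNIV G"
    "\<And>x. v (mirror e x) = - v x"
    "(\<integral>\<^sup>+x. ennreal ((norm (G x))\<^sup>2) * indicator (ball 0 r) x \<partial>lborel) \<le> ennreal \<delta>"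
    "\<rho> > 0" "ball a \<rho> \<subseteq> ball 0 r" "\<And>x. x \<in> ball a \<rho> \<Longrightarrow> 1 \<le> \<bar>v x\<bar>"
proof -
  have [measurable]: "ball 0 r \<in> sets (borel :: 'a measure)" by simp
  define K where "K = 8 * unit_ball_vol 2 * (1 + 2 * r)\<^sup>2"
  have "((\<lambda>\<tau>. (r / 2) powr \<tau>) \<longlongrightarrow> (r / 2) powr 0) (at_right 0)"
    using r by (intro tendsto_intros) auto
  then have "\<forall>\<^sub>F \<tau> in at_right 0. (r / 2) powr \<tau> > 3 / 4"
    using r by (intro order_tendstoD(1)) auto
  moreover have "((\<lambda>\<tau>. 16 * K * \<tau>) \<longlongrightarrow> 16 * K * 0) (at_right 0)" by (intro tendsto_intros)
  then have "\<forall>\<^sub>F \<tau> in at_right 0. 16 * K * \<tau> < \<delta>"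
    using \<delta> by (intro order_tendstoD(2)) auto
  moreover have "\<forall>\<^sub>F \<tau> in at_right 0. \<tau> < (1::real)" by (intro order_tendstoD(2)[OF tendsto_ident_at]) simp
  moreover have "\<forall>\<^sub>F \<tau> in at_right 0. \<tau> > (0::real)" by (simp add: eventually_at_right_less)
  ultimately have "\<forall>\<^sub>F \<tau> in at_right 0. (r / 2) powr \<tau> > 3 / 4 \<and> 16 * K * \<tau> < \<delta> \<and> \<tau> < 1 \<and> \<tau> > 0"
    by eventually_elim auto
  then obtain \<tau> where \<tau>: "(r / 2) powr \<tau> > 3 / 4" "16 * K * \<tau> < \<delta>" "\<tau> < 1" "\<tau> > 0"
    using eventually_happens[of _ "at_right (0::real)"] by auto
  \<comment> \<open>On the disk of radius \<open>sqrt \<epsilon>\<close> about \<open>a\<close> the first power is at most \<open>(2 \<epsilon>)\<^bsup>\<tau>/2\<^esup> = 1/4\<close>.\<close>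
  define \<epsilon> where "\<epsilon> = (1 / 4) powr (2 / \<tau>) / 2"
  have \<epsilon>: "\<epsilon> > 0" "(2 * \<epsilon>) powr (\<tau> / 2) = 1 / 4" using \<tau> by (auto simp: \<epsilon>_def powr_powr)
  define \<rho> where "\<rho> = min (sqrt \<epsilon>) (r / 4)"
  have \<rho>: "\<rho> > 0" "\<rho> \<le> sqrt \<epsilon>" "\<rho> \<le> r / 4" using \<epsilon> r by (auto simp: \<rho>_def)
  define a where "a = (r / 2) *\<^sub>R e"
  have na: "norm a = r / 2" "norm (- a) = r / 2" using e r by (auto simp: a_def)
  have ma: "mirror e a = - a" using e by (simp add: mirror_def a_def algebra_simps flip: scaleR_left_distrib)
  define u where "u b x = (\<epsilon> + (norm (x - b))\<^sup>2) powr (\<tau> / 2)" for b x :: 'a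
  define U where "U b x = (\<tau> * (\<epsilon> + (norm (x - b))\<^sup>2) powr (\<tau> / 2 - 1)) *\<^sub>R (x - b)" for b x :: 'a
  define v where "v x = 2 * (u a x - u (- a) x)" for x
  define G where "G x = 2 *\<^sub>R (U a x - U (- a) x)" for x
  have [measurable]: "U b \<in> borel_measurable borel" for b unfolding U_def by measurable
  show ?thesis
  proof
    fix x
    have "((\<lambda>x. 2 * (u a x - u (- a) x)) has_derivative (\<lambda>h. 2 * (U a x \<bullet> h - U (- a) x \<bullet> h))) (at x)"
      unfolding u_def U_def
      by (intro has_derivative_mult_right has_derivative_diff regularized_power_has_derivative \<epsilon>)
    then show "(v has_derivative (\<lambda>h. G x \<bullet> h)) (at x)"
      by (simp add: v_def[abs_def] G_def inner_diff_left)
    have "u b (mirror e x) = u (mirror e b) x" for b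
    proof -
      have "mirror e x - b = mirror e (x - mirror e b)"
        using linear_diff[OF bounded_linear.linear[OF bounded_linear_mirror[of e]]] mirror_mirror[OF e] by simp
      then show ?thesis by (simp add: u_def norm_mirror[OF e])
    qed
    moreover have "mirror e (- a) = a"
      using ma mirror_mirror[OF e, of a] by simp
    ultimately show "v (mirror e x) = - v x" using ma by (simp add: v_def)
  next
    have "\<epsilon> + (norm y)\<^sup>2 \<noteq> 0" for y :: 'a
      using \<epsilon>(1) zero_le_power2[of "norm y"] by linarith
    then show "continuous_on UNIV G" unfolding G_def U_def
      by (intro continuous_intros) blast+
  next
    have Ub: "(\<integral>\<^sup>+x. ennreal ((norm (U b x))\<^sup>2) * indicator (ball 0 r) x \<partial>lborel) \<le> ennreal (K * \<tau>)" if "norm b < r" for b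
    proof -
      have "(\<integral>\<^sup>+x. ennreal ((norm (U b x))\<^sup>2) * indicator (ball 0 r) x \<partial>lborel) \<le>
          (\<integral>\<^sup>+x. ennreal (\<tau>\<^sup>2) * (ennreal (norm (b - x) powr - (2 - 2 * \<tau>)) * indicator (ball 0 r) x) \<partial>lborel)"
      proof (rule nn_integral_mono_AE)
        have "AE x in lborel. x \<noteq> b" by (rule AE_lborel_singleton)
        then show "AE x in lborel. ennreal ((norm (U b x))\<^sup>2) * indicator (ball 0 r) x \<le>
            ennreal (\<tau>\<^sup>2) * (ennreal (norm (b - x) powr - (2 - 2 * \<tau>)) * indicator (ball 0 r) x)"
        proof eventually_elim
          case (elim x)
          have "(norm (U b x))\<^sup>2 \<le> \<tau>\<^sup>2 * norm (x - b) powr - (2 - 2 * \<tau>)"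
            unfolding U_def using elim \<tau> \<epsilon>(1) by (intro regularized_power_gradient_bound) auto
          then have "ennreal ((norm (U b x))\<^sup>2) \<le> ennreal (\<tau>\<^sup>2 * norm (b - x) powr - (2 - 2 * \<tau>))"
            by (intro ennreal_leI) (simp only: norm_minus_commute[of b x])
          then show ?case by (auto simp: indicator_def ennreal_mult)
        qed
      qed
      also have "\<dots> = ennreal (\<tau>\<^sup>2) * (\<integral>\<^sup>+x. ennreal (norm (b - x) powr - (2 - 2 * \<tau>)) * indicator (ball 0 r) x \<partial>lborel)"
        by (rule nn_integral_cmult) measurable
      also have "\<dots> \<le> ennreal (\<tau>\<^sup>2) * ennreal (riesz_bound (2 - 2 * \<tau>) (2 * r))"
        using \<tau> that by (intro mult_left_mono nn_integral_riesz_kernel_shifted dim) auto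
      also have "\<dots> = ennreal (\<tau>\<^sup>2 * riesz_bound (2 - 2 * \<tau>) (2 * r))" by (simp add: ennreal_mult')
      also have "\<dots> \<le> ennreal (K * \<tau>)"
        unfolding K_def using riesz_bound_near_2[of \<tau> "2 * r"] \<tau> r by (intro ennreal_leI) simp
      finally show ?thesis .
    qed
    have "(\<integral>\<^sup>+x. ennreal ((norm (G x))\<^sup>2) * indicator (ball 0 r) x \<partial>lborel) \<le>
        (\<integral>\<^sup>+x. 8 * (ennreal ((norm (U a x))\<^sup>2) * indicator (ball 0 r) x) + 8 * (ennreal ((norm (U (- a) x))\<^sup>2) * indicator (ball 0 r) x) \<partial>lborel)"
    proof (rule nn_integral_mono)
      fix x
      have "norm (U a x - U (- a) x) \<le> norm (U a x) + norm (U (- a) x)" by (rule norm_triangle_ineq4)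
      then have "(norm (U a x - U (- a) x))\<^sup>2 \<le> (norm (U a x) + norm (U (- a) x))\<^sup>2" by (intro power_mono) auto
      also have "\<dots> \<le> 2 * (norm (U a x))\<^sup>2 + 2 * (norm (U (- a) x))\<^sup>2"
        using sum_squares_bound[of "norm (U a x)" "norm (U (- a) x)"] by (simp add: power2_sum)
      finally have "(norm (G x))\<^sup>2 \<le> 8 * (norm (U a x))\<^sup>2 + 8 * (norm (U (- a) x))\<^sup>2"
        by (simp add: G_def power_mult_distrib)
      then have "ennreal ((norm (G x))\<^sup>2) \<le> ennreal (8 * (norm (U a x))\<^sup>2 + 8 * (norm (U (- a) x))\<^sup>2)"
        by (rule ennreal_leI)
      also have "\<dots> = 8 * ennreal ((norm (U a x))\<^sup>2) + 8 * ennreal ((norm (U (- a) x))\<^sup>2)"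
        by (simp add: ennreal_plus ennreal_mult')
      finally show "ennreal ((norm (G x))\<^sup>2) * indicator (ball 0 r) x \<le>
          8 * (ennreal ((norm (U a x))\<^sup>2) * indicator (ball 0 r) x) + 8 * (ennreal ((norm (U (- a) x))\<^sup>2) * indicator (ball 0 r) x)"
        by (auto simp: indicator_def)
    qed
    also have "\<dots> = 8 * (\<integral>\<^sup>+x. ennreal ((norm (U a x))\<^sup>2) * indicator (ball 0 r) x \<partial>lborel) +
        8 * (\<integral>\<^sup>+x. ennreal ((norm (U (- a) x))\<^sup>2) * indicator (ball 0 r) x \<partial>lborel)"
      by (subst nn_integral_add) (auto simp: nn_integral_cmult)
    also have "\<dots> \<le> 8 * ennreal (K * \<tau>) + 8 * ennreal (K * \<tau>)"
      using na r by (intro add_mono mult_left_mono Ub) auto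
    also have "\<dots> = ennreal (16 * K * \<tau>)"
    proof -
      have "K * \<tau> \<ge> 0" using \<tau> by (simp add: K_def)
      then have "ennreal (8 * (K * \<tau>) + 8 * (K * \<tau>)) = 8 * ennreal (K * \<tau>) + 8 * ennreal (K * \<tau>)"
        by (subst ennreal_plus) (simp_all add: ennreal_mult')
      then show ?thesis by (simp add: algebra_simps)
    qed
    also have "\<dots> \<le> ennreal \<delta>" using \<tau>(2) by (intro ennreal_leI) simp
    finally show "(\<integral>\<^sup>+x. ennreal ((norm (G x))\<^sup>2) * indicator (ball 0 r) x \<partial>lborel) \<le> ennreal \<delta>" .
  next
    show "\<rho> > 0" by (rule \<rho>)
    show "ball a \<rho> \<subseteq> ball 0 r"
    proof
      fix x assume "x \<in> ball a \<rho>"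
      then have "norm (x - a) < r / 4" using \<rho> by (simp add: dist_norm norm_minus_commute)
      then show "x \<in> ball 0 r" using na r norm_triangle_sub[of x a] by simp
    qed
    fix x assume "x \<in> ball a \<rho>"
    then have xa: "norm (x - a) < \<rho>" by (simp add: dist_norm norm_minus_commute)
    have "(norm (x - a))\<^sup>2 \<le> (sqrt \<epsilon>)\<^sup>2" using xa \<rho> by (intro power_mono) auto
    then have "u a x \<le> (2 * \<epsilon>) powr (\<tau> / 2)"
      unfolding u_def using \<epsilon>(1) \<tau> by (intro powr_mono2) auto
    then have near: "u a x \<le> 1 / 4" using \<epsilon>(2) by simp
    have "norm (x - - a) \<ge> r / 2"
    proof -
      have "norm (2 *\<^sub>R a) \<le> norm (x + a) + norm (x - a)"
        using norm_triangle_ineq4[of "x + a" "x - a"] by (simp add: scaleR_2)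
      then show ?thesis using xa \<rho> na by simp
    qed
    then have "(r / 2)\<^sup>2 \<le> (norm (x - - a))\<^sup>2" using r by (intro power_mono) auto
    then have "((r / 2)\<^sup>2) powr (\<tau> / 2) \<le> u (- a) x"
      unfolding u_def using \<epsilon>(1) \<tau> by (intro powr_mono2) auto
    moreover have "((r / 2)\<^sup>2) powr (\<tau> / 2) = (r / 2) powr \<tau>"
      using r powr_powr[of "r / 2" 2 "\<tau> / 2"] by (simp add: powr_numeral)
    ultimately have "u (- a) x \<ge> 3 / 4" using \<tau>(1) by simp
    then show "1 \<le> \<bar>v x\<bar>" using near by (simp add: v_def)
  qed
qed

section \<open>Comparison of the two infima\<close>

lemma scale_to_normalized:
  assumes "w \<in> Lp_on p S" "(LINT x|lebesgue_on S. w x) = 0" "p > 0"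
    and I: "(LINT x|lebesgue_on S. \<bar>w x\<bar> powr p) = I" "I > 0"
  shows "(\<lambda>x. I powr - (1 / p) * w x) \<in> normalized p S"
proof -
  let ?t = "I powr - (1 / p)"
  have w: "w \<in> borel_measurable (lebesgue_on S)" "integrable (lebesgue_on S) (\<lambda>x. \<bar>w x\<bar> powr p)"
    using assms(1) by (auto simp: Lp_on_def)
  have t: "\<bar>?t * y\<bar> powr p = (1 / I) * \<bar>y\<bar> powr p" for y
  proof -
    have "?t powr p = I powr - 1" unfolding powr_powr using assms(3) by simp
    then have "?t powr p = 1 / I" using I(2) by (simp add: powr_minus_divide)
    then show ?thesis by (simp add: abs_mult powr_mult)
  qed
  have Lp: "(\<lambda>x. ?t * w x) \<in> Lp_on p S"
    using w by (simp add: Lp_on_def t)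
  have one: "(LINT x|lebesgue_on S. \<bar>?t * w x\<bar> powr p) = 1"
    unfolding t using I by simp
  have "\<not> (AE x in lebesgue_on S. ?t * w x = 0)"
  proof
    assume "AE x in lebesgue_on S. ?t * w x = 0"
    then have "AE x in lebesgue_on S. \<bar>?t * w x\<bar> powr p = 0" by eventually_elim (simp only: abs_zero powr_zero_eq_one if_True, simp)
    then have "(LINT x|lebesgue_on S. \<bar>?t * w x\<bar> powr p) = 0" by (rule integral_eq_zero_AE)
    then show False using one by simp
  qed
  then show ?thesis using Lp one assms(2) by (simp add: normalized_def Lp_norm_on_def)
qed

lemma continuous_imp_Lp_on_ball:
  fixes f :: "'a::euclidean_space \<Rightarrow> 'b::euclidean_space"
  assumes "continuous_on UNIV f" "p > 0"
  shows "f \<in> Lp_on p (ball 0 r)"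
proof -
  have int: "h absolutely_integrable_on ball 0 r" if "continuous_on UNIV h" for h :: "'a \<Rightarrow> real"
    using continuous_imp_absolutely_integrable_on_compact[OF that compact_cball[of 0 r]]
    by (rule set_integrable_subset) (auto simp: ball_subset_cball)
  have "continuous_on UNIV (\<lambda>x. norm (f x) powr p)"
    using assms by (intro continuous_on_powr' continuous_intros) auto
  then have "integrable (lebesgue_on (ball 0 r)) (\<lambda>x. norm (f x) powr p)"
    using int by (auto simp: set_integrable_def integrable_restrict_space)
  moreover have "f \<in> borel_measurable (lebesgue_on (ball 0 r))"
    using assms(1) by (auto intro!: measurable_restrict_space1 measurable_completion borel_measurable_continuous_onI)
  ultimately show ?thesis by (simp add: Lp_on_def)
qed

lemma mirror_axis_2: "mirror (axis 2 1) x = (vector [x $ 1, - (x $ 2)] :: real^2)"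
  by (simp add: mirror_def vec_eq_iff forall_2 cart_eq_inner_axis[symmetric]) (simp add: axis_def)

lemma mirror_ball: "e \<in> Basis \<Longrightarrow> x \<in> ball 0 r \<Longrightarrow> mirror e x \<in> ball 0 r"
  by (simp add: norm_mirror)

text \<open>Normalize a function of small energy that is at least \<open>1\<close> in absolute value on a disk of measure \<open>c\<close>: its
  \<open>L\<^sup>p\<close> norm is at least \<open>c\<^bsup>1/p\<^esup>\<close>, which exceeds \<open>1/2\<close> for large \<open>p\<close>, so its energy grows by at most a factor \<open>4\<close>.\<close>

lemma lambda_as_tendsto_0:
  fixes r \<theta> q \<delta> :: real
  assumes r: "r > 0" and \<theta>: "\<theta> \<ge> 0" and q: "q \<ge> 1" and \<delta>: "\<delta> > 0"
  shows "\<forall>\<^sub>F p in at_top. lambda_as \<theta> q p (ball 0 r) \<le> ennreal \<delta>"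
proof -
  let ?B = "ball 0 r :: (real^2) set"
  have dim: "DIM(real^2) = 2" by simp
  have e: "axis 2 1 \<in> (Basis :: (real^2) set)" by (auto simp: Basis_vec_def)
  obtain v :: "real^2 \<Rightarrow> real" and G a \<rho> where v: "\<And>x. (v has_derivative (\<lambda>h. G x \<bullet> h)) (at x)" "continuous_on UNIV G"
    "\<And>x. v (mirror (axis 2 1) x) = - v x"
    "(\<integral>\<^sup>+x. ennreal ((norm (G x))\<^sup>2) * indicator ?B x \<partial>lborel) \<le> ennreal (\<delta> / 4)"
    and \<rho>: "\<rho> > 0" "ball a \<rho> \<subseteq> ?B" "\<And>x. x \<in> ball a \<rho> \<Longrightarrow> 1 \<le> \<bar>v x\<bar>"
    by (rule small_energy_antisymmetric_function[OF dim e r, of "\<delta> / 4"]) (use \<delta> in auto)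
  have vc: "continuous_on UNIV v"
    by (intro continuous_at_imp_continuous_on ballI has_derivative_continuous[OF v(1)])
  have vw: "has_weak_gradient_on v G ?B"
    by (rule has_weak_gradient_on_C1[OF open_ball v(1,2)])
  have vint: "integrable (lebesgue_on ?B) v"
    using continuous_imp_Lp_on_ball[OF vc, of 1 r] by (intro Lp_on_imp_integrable[where q = 1]) auto
  have mean: "(LINT x|lebesgue_on ?B. v x) = 0"
  proof -
    have "(LINT x|lebesgue_on ?B. v (mirror (axis 2 1) x)) = (LINT x|lebesgue_on ?B. v x)"
      by (rule mirror_integrable(2)[OF e open_ball mirror_ball[OF e] vint])
    then show ?thesis by (simp add: v(3))
  qed
  define c where "c = measure lebesgue (ball a \<rho>)"
  have c: "c > 0" using \<rho>(1) by (simp add: c_def content_ball_pos)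
  have "((\<lambda>p. c powr - (1 / p)) \<longlongrightarrow> c powr - 0) at_top"
    using c by (intro tendsto_intros tendsto_divide_0[OF tendsto_const] filterlim_at_top_imp_at_infinity filterlim_ident) auto
  then have "\<forall>\<^sub>F p in at_top. c powr - (1 / p) < 2"
    using c by (intro order_tendstoD(2)) auto
  moreover have "\<forall>\<^sub>F p in at_top. p \<ge> (1::real)" by (rule eventually_ge_at_top)
  ultimately show ?thesis
  proof eventually_elim
    case (elim p)
    then have p: "p > 0" by simp
    define I where "I = (LINT x|lebesgue_on ?B. \<bar>v x\<bar> powr p)"
    have vLp: "v \<in> Lp_on p ?B" by (rule continuous_imp_Lp_on_ball[OF vc p])
    have Ic: "c \<le> I"
    proof -
      have "c = (LINT x|lebesgue_on ?B. indicator (ball a \<rho>) x)"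
      proof -
        have "(LINT x|lebesgue_on ?B. indicator (ball a \<rho>) x :: real) = (LINT x|lebesgue. indicator ?B x *\<^sub>R indicator (ball a \<rho>) x)"
          by (rule integral_restrict_space) simp
        also have "(\<lambda>x. indicator ?B x *\<^sub>R indicator (ball a \<rho>) x :: real) = indicator (ball a \<rho>)"
          using \<rho>(2) by (auto simp: fun_eq_iff split: split_indicator)
        finally show ?thesis by (simp add: c_def)
      qed
      also have "\<dots> \<le> I" unfolding I_def
      proof (rule integral_mono)
        interpret finite_measure "lebesgue_on ?B" by (rule finite_measure_lebesgue_on_bounded) auto
        have "ball a \<rho> \<inter> ?B \<in> sets lebesgue" by simp
        then have s: "ball a \<rho> \<in> sets (lebesgue_on ?B)"
          using \<rho>(2) by (simp add: sets_restrict_space_iff)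
        show "integrable (lebesgue_on ?B) (indicator (ball a \<rho>) :: _ \<Rightarrow> real)"
          using s by (rule integrable_real_indicator) (metis emeasure_finite infinity_ennreal_def top.not_eq_extremum)
        show "integrable (lebesgue_on ?B) (\<lambda>x. \<bar>v x\<bar> powr p)" using vLp by (simp add: Lp_on_def)
        show "indicator (ball a \<rho>) x \<le> \<bar>v x\<bar> powr p" for x
          using \<rho>(3)[of x] p by (auto simp: indicator_def intro: ge_one_powr_ge_zero)
      qed
      finally show ?thesis .
    qed
    then have I: "I > 0" using c by simp
    define t where "t = I powr - (1 / p)"
    have t: "0 \<le> t" "t \<le> 2"
    proof -
      have "t \<le> c powr - (1 / p)" unfolding t_def using Ic c p by (intro powr_mono2') auto
      then show "t \<le> 2" using elim by simp
    qed (simp add: t_def)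
    let ?u = "\<lambda>x. t * v x"
    have norm: "?u \<in> normalized p ?B"
      unfolding t_def by (rule scale_to_normalized[OF vLp mean p I_def[symmetric] I])
    have w: "has_weak_gradient_on ?u (\<lambda>x. t *\<^sub>R G x) ?B"
      using has_weak_gradient_on_scale_shift[OF open_ball vw, of t 0] by simp
    have W1: "?u \<in> W1 q ?B"
      unfolding W1_def using w q vc v(2) by (auto intro!: bexI[of _ "\<lambda>x. t *\<^sub>R G x"] continuous_imp_Lp_on_ball continuous_intros)
    then have as: "?u \<in> W1_as q ?B"
      unfolding W1_as_def using v(3) by (simp add: mirror_axis_2)
    have "energy \<theta> ?B ?u = (\<integral>\<^sup>+x. ennreal ((norm (t *\<^sub>R G x))\<^sup>2 / (1 + \<bar>t * v x\<bar>) powr (2 * \<theta>)) \<partial>lebesgue_on ?B)"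
      by (rule energy_eq[OF open_ball W1 w])
    also have "\<dots> \<le> (\<integral>\<^sup>+x. 4 * ennreal ((norm (G x))\<^sup>2) \<partial>lebesgue_on ?B)"
    proof (rule nn_integral_mono)
      fix x
      have "1 \<le> (1 + \<bar>t * v x\<bar>) powr (2 * \<theta>)" using \<theta> by (intro ge_one_powr_ge_zero) auto
      then have "(norm (t *\<^sub>R G x))\<^sup>2 / (1 + \<bar>t * v x\<bar>) powr (2 * \<theta>) \<le> (norm (t *\<^sub>R G x))\<^sup>2"
        using mult_left_mono[of 1 "(1 + \<bar>t * v x\<bar>) powr (2 * \<theta>)" "(norm (t *\<^sub>R G x))\<^sup>2"]
        by (subst pos_divide_le_eq) auto
      also have "\<dots> = t\<^sup>2 * (norm (G x))\<^sup>2" by (simp add: power_mult_distrib)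
      also have "\<dots> \<le> 4 * (norm (G x))\<^sup>2"
        using power_mono[OF t(2,1), of 2] by (intro mult_right_mono) auto
      finally show "ennreal ((norm (t *\<^sub>R G x))\<^sup>2 / (1 + \<bar>t * v x\<bar>) powr (2 * \<theta>)) \<le> 4 * ennreal ((norm (G x))\<^sup>2)"
        by (subst ennreal_numeral[symmetric], subst ennreal_mult'[symmetric]) (auto intro: ennreal_leI)
    qed
    also have "\<dots> = 4 * (\<integral>\<^sup>+x. ennreal ((norm (G x))\<^sup>2) * indicator ?B x \<partial>lborel)"
    proof -
      have "G \<in> borel_measurable borel" using v(2) by (rule borel_measurable_continuous_onI)
      then have "(\<lambda>x. ennreal ((norm (G x))\<^sup>2)) \<in> borel_measurable (lebesgue_on ?B)"
        by (intro measurable_restrict_space1 measurable_completion) measurable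
      then show ?thesis
        by (subst nn_integral_cmult) (simp_all add: nn_integral_restrict_space nn_integral_completion)
    qed
    also have "\<dots> \<le> 4 * ennreal (\<delta> / 4)" by (intro mult_left_mono v(4)) simp
    also have "\<dots> = ennreal \<delta>" using \<delta> by (simp flip: ennreal_mult' ennreal_numeral)
    finally have "energy \<theta> ?B ?u \<le> ennreal \<delta>" .
    moreover have "lambda_as \<theta> q p ?B \<le> energy \<theta> ?B ?u"
      unfolding lambda_as_def using as norm by (intro INF_lower) auto
    ultimately show ?case by simp
  qed
qed


lemma mirror_nn_integral:
  fixes f :: "'a::euclidean_space \<Rightarrow> ennreal"
  assumes e: "e \<in> Basis" and S: "open S" "\<And>x. x \<in> S \<Longrightarrow> mirror e x \<in> S"
    and f: "f \<in> borel_measurable (lebesgue_on S)"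
  shows "(\<lambda>x. f (mirror e x)) \<in> borel_measurable (lebesgue_on S)"
    and "(\<integral>\<^sup>+x. f (mirror e x) \<partial>lebesgue_on S) = (\<integral>\<^sup>+x. f x \<partial>lebesgue_on S)"
proof -
  have "mirror e \<in> lebesgue_on S \<rightarrow>\<^sub>M lebesgue_on S"
    by (rule measurable_restrict_space3[OF mirror_measurable[OF e]]) (use S in auto)
  then show "(\<lambda>x. f (mirror e x)) \<in> borel_measurable (lebesgue_on S)"
    using f by (rule measurable_compose)
  have f': "(\<lambda>x. f x * indicator S x) \<in> borel_measurable lebesgue"
    using f S(1) by (simp add: borel_measurable_restrict_space_iff_ennreal)
  have "(\<integral>\<^sup>+x. f (mirror e x) \<partial>lebesgue_on S) = (\<integral>\<^sup>+x. f (mirror e x) * indicator S x \<partial>lebesgue)"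
    using S(1) by (simp add: nn_integral_restrict_space)
  also have "\<dots> = (\<integral>\<^sup>+x. f (mirror e x) * indicator S (mirror e x) \<partial>lebesgue)"
  proof (rule nn_integral_cong)
    fix x
    show "f (mirror e x) * indicator S x = f (mirror e x) * indicator S (mirror e x)"
      using S(2)[of x] S(2)[of "mirror e x"] mirror_mirror[OF e, of x] by (auto simp: indicator_def)
  qed
  also have "\<dots> = (\<integral>\<^sup>+x. f x * indicator S x \<partial>distr lebesgue lebesgue (mirror e))"
    using nn_integral_distr[of "mirror e" lebesgue lebesgue "\<lambda>x. f x * indicator S x"] mirror_measurable[OF e] f' by simp
  also have "\<dots> = (\<integral>\<^sup>+x. f x \<partial>lebesgue_on S)"
    using S(1) by (simp add: mirror_distr[OF e] nn_integral_restrict_space)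
  finally show "(\<integral>\<^sup>+x. f (mirror e x) \<partial>lebesgue_on S) = (\<integral>\<^sup>+x. f x \<partial>lebesgue_on S)" .
qed

lemma nn_integral_half:
  fixes F :: "'a::euclidean_space \<Rightarrow> ennreal"
  assumes e: "e \<in> Basis" and S: "open S" "\<And>x. x \<in> S \<Longrightarrow> mirror e x \<in> S"
    and F: "F \<in> borel_measurable (lebesgue_on S)" "AE x in lebesgue_on S. F (mirror e x) = F x"
  shows "(\<integral>\<^sup>+x. F x \<partial>lebesgue_on S) = 2 * (\<integral>\<^sup>+x. (if x \<bullet> e > 0 then F x else 0) \<partial>lebesgue_on S)"
proof -
  let ?P = "\<lambda>x. if x \<bullet> e > 0 then F x else 0"
  have "(\<lambda>x. F x * indicator ({x. x \<bullet> e > 0} \<inter> space (lebesgue_on S)) x) \<in> borel_measurable (lebesgue_on S)"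
    using half_indicator_measurable[OF e S(1)] F(1)
    by (intro borel_measurable_times_ennreal borel_measurable_indicator) auto
  then have P: "?P \<in> borel_measurable (lebesgue_on S)"
    by (rule measurable_cong[THEN iffD1, rotated]) (auto simp: indicator_def)
  have "(\<integral>\<^sup>+x. F x \<partial>lebesgue_on S) = (\<integral>\<^sup>+x. ?P x + ?P (mirror e x) \<partial>lebesgue_on S)"
  proof (rule nn_integral_cong_AE)
    show "AE x in lebesgue_on S. F x = ?P x + ?P (mirror e x)"
      using F(2) AE_off_mirror_axis[OF e S(1)] by eventually_elim (auto simp: mirror_inner[OF e])
  qed
  also have "\<dots> = (\<integral>\<^sup>+x. ?P x \<partial>lebesgue_on S) + (\<integral>\<^sup>+x. ?P (mirror e x) \<partial>lebesgue_on S)"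
    by (rule nn_integral_add[OF P mirror_nn_integral(1)[OF e S(1) _ P]]) (rule S(2))
  also have "(\<integral>\<^sup>+x. ?P (mirror e x) \<partial>lebesgue_on S) = (\<integral>\<^sup>+x. ?P x \<partial>lebesgue_on S)"
    by (rule mirror_nn_integral(2)[OF e S(1) _ P]) (rule S(2))
  also have "(\<integral>\<^sup>+x. ?P x \<partial>lebesgue_on S) + (\<integral>\<^sup>+x. ?P x \<partial>lebesgue_on S) = 2 * (\<integral>\<^sup>+x. ?P x \<partial>lebesgue_on S)"
    by (rule mult_2[symmetric])
  finally show ?thesis .
qed

lemma Lp_on_scale_shift:
  fixes f :: "'a::euclidean_space \<Rightarrow> real"
  assumes "f \<in> Lp_on p S" "open S" "bounded S" "p > 0"
  shows "(\<lambda>x. t * (f x - c)) \<in> Lp_on p S"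
proof -
  interpret finite_measure "lebesgue_on S" using assms(2,3) by (rule finite_measure_lebesgue_on_bounded)
  have [measurable]: "f \<in> borel_measurable (lebesgue_on S)" using assms(1) by (simp add: Lp_on_def)
  have "integrable (lebesgue_on S) (\<lambda>x. \<bar>t * (f x - c)\<bar> powr p)"
  proof (rule Bochner_Integration.integrable_bound)
    show "integrable (lebesgue_on S) (\<lambda>x. \<bar>t\<bar> powr p * (2 powr p * (\<bar>f x\<bar> powr p + \<bar>c\<bar> powr p)))"
      using assms(1) by (auto simp: Lp_on_def)
    show "AE x in lebesgue_on S. norm (\<bar>t * (f x - c)\<bar> powr p) \<le> norm (\<bar>t\<bar> powr p * (2 powr p * (\<bar>f x\<bar> powr p + \<bar>c\<bar> powr p)))"
    proof (rule AE_I2)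
      fix x
      have "\<bar>f x - c\<bar> powr p \<le> (2 * max \<bar>f x\<bar> \<bar>c\<bar>) powr p" using assms(4) by (intro powr_mono2) auto
      also have "\<dots> = 2 powr p * max \<bar>f x\<bar> \<bar>c\<bar> powr p" by (simp add: powr_mult)
      also have "\<dots> \<le> 2 powr p * (\<bar>f x\<bar> powr p + \<bar>c\<bar> powr p)" by (intro mult_left_mono) (auto simp: max_def)
      finally have "\<bar>t\<bar> powr p * \<bar>f x - c\<bar> powr p \<le> \<bar>t\<bar> powr p * (2 powr p * (\<bar>f x\<bar> powr p + \<bar>c\<bar> powr p))"
        by (rule mult_left_mono) simp
      then show "norm (\<bar>t * (f x - c)\<bar> powr p) \<le> norm (\<bar>t\<bar> powr p * (2 powr p * (\<bar>f x\<bar> powr p + \<bar>c\<bar> powr p)))"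
        by (simp add: abs_mult powr_mult)
    qed
  qed measurable
  then show ?thesis by (simp add: Lp_on_def)
qed

lemma Lp_on_half:
  fixes f :: "'a::euclidean_space \<Rightarrow> 'b::euclidean_space"
  assumes e: "e \<in> Basis" and S: "open S" "bounded S" and f: "f \<in> Lp_on q S" "q \<ge> 1"
  shows "(\<lambda>x. if x \<bullet> e > 0 then f x else 0) \<in> Lp_on q S"
proof -
  have "integrable (lebesgue_on S) (\<lambda>x. if x \<bullet> e > 0 then f x else 0)"
    by (rule half_integrable[OF e S(1) Lp_on_imp_integrable[OF f(1) S f(2)]])
  moreover have "integrable (lebesgue_on S) (\<lambda>x. if x \<bullet> e > 0 then norm (f x) powr q else 0)"
    using f by (intro half_integrable[OF e S(1)]) (simp add: Lp_on_def)
  moreover have "(\<lambda>x. norm (if x \<bullet> e > 0 then f x else 0) powr q) = (\<lambda>x. if x \<bullet> e > 0 then norm (f x) powr q else 0)"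
    by (auto simp: fun_eq_iff)
  ultimately show ?thesis by (simp add: Lp_on_def)
qed

lemma Lp_on_scaleR:
  fixes f :: "'a::euclidean_space \<Rightarrow> 'b::euclidean_space"
  assumes "f \<in> Lp_on p S"
  shows "(\<lambda>x. t *\<^sub>R f x) \<in> Lp_on p S"
  using assms by (auto simp: Lp_on_def powr_mult)

text \<open>The ratio of the two weights is at most \<open>A = (1 + \<bar>c\<bar>) max 1 (1/t)\<close> to the power \<open>2\<theta> \<le> 1\<close>, hence at most \<open>A\<close>,
  and \<open>t\<^sup>2 A = (1 + \<bar>c\<bar>) max t\<^sup>2 t\<close> is at most \<open>(21/20) (29/25)\<^sup>2 < 8/5\<close>.\<close>

lemma energy_density_shift_scale:
  fixes t c y \<theta> G :: real
  assumes \<theta>: "0 \<le> \<theta>" "2 * \<theta> \<le> 1" and t: "0 < t" "t \<le> 29 / 25" and c: "\<bar>c\<bar> \<le> 1 / 20" and G: "G \<ge> 0"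
  shows "t\<^sup>2 * G / (1 + \<bar>t * (y - c)\<bar>) powr (2 * \<theta>) \<le> 8 / 5 * (G / (1 + \<bar>y\<bar>) powr (2 * \<theta>))"
proof -
  define A where "A = (1 + \<bar>c\<bar>) * max 1 (1 / t)"
  have A1: "A \<ge> 1"
    using mult_mono[of 1 "1 + \<bar>c\<bar>" 1 "max 1 (1 / t)"] by (simp add: A_def)
  have "1 + \<bar>y\<bar> \<le> (1 + \<bar>c\<bar>) * (1 + \<bar>y - c\<bar>)"
  proof -
    have "\<bar>y\<bar> \<le> \<bar>y - c\<bar> + \<bar>c\<bar>" by linarith
    moreover have "0 \<le> \<bar>c\<bar> * \<bar>y - c\<bar>" by simp
    moreover have "(1 + \<bar>c\<bar>) * (1 + \<bar>y - c\<bar>) = 1 + \<bar>c\<bar> + \<bar>y - c\<bar> + \<bar>c\<bar> * \<bar>y - c\<bar>"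
      by (simp add: distrib_left distrib_right)
    ultimately show ?thesis by linarith
  qed
  also have "\<dots> \<le> (1 + \<bar>c\<bar>) * (max 1 (1 / t) * (1 + \<bar>t * (y - c)\<bar>))"
  proof (rule mult_left_mono)
    have "1 * 1 \<le> max 1 (1 / t) * 1" by simp
    moreover have "\<bar>y - c\<bar> \<le> max 1 (1 / t) * \<bar>t * (y - c)\<bar>"
    proof -
      have "\<bar>y - c\<bar> = 1 / t * \<bar>t * (y - c)\<bar>" using t by (simp add: abs_mult)
      also have "\<dots> \<le> max 1 (1 / t) * \<bar>t * (y - c)\<bar>" by (intro mult_right_mono) auto
      finally show ?thesis .
    qed
    ultimately show "1 + \<bar>y - c\<bar> \<le> max 1 (1 / t) * (1 + \<bar>t * (y - c)\<bar>)" by (simp add: distrib_left)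
  qed simp
  finally have "1 + \<bar>y\<bar> \<le> A * (1 + \<bar>t * (y - c)\<bar>)" by (simp add: A_def mult.assoc)
  then have "(1 + \<bar>y\<bar>) powr (2 * \<theta>) \<le> (A * (1 + \<bar>t * (y - c)\<bar>)) powr (2 * \<theta>)"
    using \<theta> by (intro powr_mono2) auto
  also have "\<dots> = A powr (2 * \<theta>) * (1 + \<bar>t * (y - c)\<bar>) powr (2 * \<theta>)"
    using A1 by (simp add: powr_mult)
  also have "\<dots> \<le> A * (1 + \<bar>t * (y - c)\<bar>) powr (2 * \<theta>)"
  proof (rule mult_right_mono)
    have "A powr (2 * \<theta>) \<le> A powr 1" using A1 \<theta> by (intro powr_mono) auto
    then show "A powr (2 * \<theta>) \<le> A" using A1 by simp
  qed simp
  finally have le: "(1 + \<bar>y\<bar>) powr (2 * \<theta>) \<le> A * (1 + \<bar>t * (y - c)\<bar>) powr (2 * \<theta>)" .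
  have "t\<^sup>2 * A \<le> 8 / 5"
  proof -
    have "t\<^sup>2 * max 1 (1 / t) = max (t\<^sup>2) t"
      using t by (simp add: max_mult_distrib_left power2_eq_square)
    also have "\<dots> \<le> (29 / 25)\<^sup>2"
      using t power_mono[of t "29 / 25" 2] by (simp add: power2_eq_square)
    finally have "t\<^sup>2 * max 1 (1 / t) \<le> (29 / 25)\<^sup>2" .
    then have "(1 + \<bar>c\<bar>) * (t\<^sup>2 * max 1 (1 / t)) \<le> (1 + 1 / 20) * (29 / 25)\<^sup>2"
      using c by (intro mult_mono) auto
    also have "\<dots> \<le> 8 / 5" by (simp add: power2_eq_square)
    finally show ?thesis by (simp add: A_def mult_ac)
  qed
  define Y where "Y = (1 + \<bar>y\<bar>) powr (2 * \<theta>)"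
  define Z where "Z = (1 + \<bar>t * (y - c)\<bar>) powr (2 * \<theta>)"
  have YZ: "Y > 0" "Z > 0" "Y \<le> A * Z" using le by (auto simp: Y_def Z_def)
  have "t\<^sup>2 * G * Y \<le> t\<^sup>2 * G * (A * Z)" using YZ G by (intro mult_left_mono) auto
  also have "\<dots> = (t\<^sup>2 * A) * (G * Z)" by (simp add: mult_ac)
  also have "\<dots> \<le> 8 / 5 * (G * Z)" using \<open>t\<^sup>2 * A \<le> 8 / 5\<close> YZ G by (intro mult_right_mono) auto
  finally have "t\<^sup>2 * G / Z \<le> 8 / 5 * (G / Y)" using YZ by (simp add: field_simps)
  then show ?thesis by (simp add: Y_def Z_def)
qed

text \<open>The competitor is \<open>t (w - c)\<close> with \<open>w\<close> the restriction of \<open>v\<close> to the half ball, \<open>c\<close> its mean and \<open>t\<close> the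
  normalizing constant. Smallness of \<open>\<integral>\<bar>v\<bar>\<close> gives \<open>\<bar>c\<bar> \<le> 1/20\<close>. Where \<open>\<bar>w\<bar> \<ge> 1/2\<close> this implies
  \<open>\<bar>w\<bar> \<le> (10/9) \<bar>w - c\<bar>\<close>, while the rest contributes little to \<open>\<integral>\<bar>w\<bar>\<^sup>p = 1/2\<close>; thus \<open>t \<le> 4\<^bsup>1/p\<^esup> (10/9) \<le> 29/25\<close>. The
  energy of the competitor is at most \<open>8/5\<close> of the half that \<open>w\<close> inherits from \<open>v\<close>.\<close>

lemma one_sided_competitor:
  fixes v :: "'a::euclidean_space \<Rightarrow> real" and r \<theta> p q :: real
  assumes e: "e \<in> Basis" and r: "r > 0" and \<theta>: "0 \<le> \<theta>" "2 * \<theta> \<le> 1" and q: "q \<ge> 1" and p: "p \<ge> 1"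
    and v: "v \<in> W1 q (ball 0 r)" "v \<in> normalized p (ball 0 r)"
    and anti: "AE x in lebesgue_on (ball 0 r). v (mirror e x) = - v x"
    and small: "(LINT x|lebesgue_on (ball 0 r). \<bar>v x\<bar>) \<le> measure lebesgue (ball 0 r :: 'a set) / 20"
    and p_large: "(1 / 2) powr p * measure lebesgue (ball 0 r :: 'a set) \<le> 1 / 4" "4 powr (1 / p) \<le> (26 / 25 :: real)"
  obtains u :: "'a \<Rightarrow> real" where "u \<in> W1 q (ball 0 r)" "u \<in> normalized p (ball 0 r)"
    "energy \<theta> (ball 0 r) u \<le> ennreal (4 / 5) * energy \<theta> (ball 0 r) v"
proof -
  let ?B = "ball 0 r :: 'a set"
  define m where "m = measure lebesgue ?B"
  have m: "m > 0" using r by (simp add: m_def content_ball_pos)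
  have S: "open ?B" "\<And>x. x \<in> ?B \<Longrightarrow> mirror e x \<in> ?B" using mirror_ball[OF e] by auto
  interpret finite_measure "lebesgue_on ?B" by (rule finite_measure_lebesgue_on_bounded) auto
  have total: "measure (lebesgue_on ?B) (space (lebesgue_on ?B)) = m"
    by (simp add: m_def measure_restrict_space space_restrict_space)
  define g where "g = weak_gradient ?B v"
  have vw: "has_weak_gradient_on v g ?B" and gLq: "g \<in> Lp_on q ?B"
    using W1_weak_gradient[OF v(1) open_ball] by (auto simp: g_def)
  have vLq: "v \<in> Lp_on q ?B" using v(1) by (simp add: W1_def)
  have vLp: "v \<in> Lp_on p ?B" using v(2) by (simp add: normalized_def)
  have vint: "integrable (lebesgue_on ?B) v" and gint: "integrable (lebesgue_on ?B) g"
    using Lp_on_imp_integrable[OF vLq] Lp_on_imp_integrable[OF gLq] q by auto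
  define w where "w x = (if x \<bullet> e > 0 then v x else 0)" for x
  define gw where "gw x = (if x \<bullet> e > 0 then g x else 0)" for x
  have ww: "has_weak_gradient_on w gw ?B"
    unfolding w_def[abs_def] gw_def[abs_def]
    by (rule half_weak_gradient[OF e S(1) _ vint gint vw anti]) (rule S(2))
  have wLp: "w \<in> Lp_on p ?B" and wLq: "w \<in> Lp_on q ?B" and gwLq: "gw \<in> Lp_on q ?B"
    unfolding w_def[abs_def] gw_def[abs_def] using p q
    by (auto intro!: Lp_on_half[OF e] vLp vLq gLq)
  have wint: "integrable (lebesgue_on ?B) w" using Lp_on_imp_integrable[OF wLq] q by auto
  define c where "c = (LINT x|lebesgue_on ?B. w x) / m"
  have c: "\<bar>c\<bar> \<le> 1 / 20"
  proof -
    have "\<bar>LINT x|lebesgue_on ?B. w x\<bar> \<le> (LINT x|lebesgue_on ?B. \<bar>w x\<bar>)"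
      using integral_norm_bound[of "lebesgue_on ?B" w] by simp
    also have "\<dots> \<le> (LINT x|lebesgue_on ?B. \<bar>v x\<bar>)"
      by (rule integral_mono[OF integrable_abs[OF wint] integrable_abs[OF vint]]) (simp add: w_def)
    also have "\<dots> \<le> m / 20" using small by (simp add: m_def)
    finally show ?thesis using m by (simp add: c_def field_simps)
  qed
  have mean: "(LINT x|lebesgue_on ?B. w x - c) = 0"
    using wint m total by (simp add: c_def)
  have u0Lp: "(\<lambda>x. w x - c) \<in> Lp_on p ?B"
    using Lp_on_scale_shift[OF wLp, of 1 c] p by simp
  define J where "J = (LINT x|lebesgue_on ?B. \<bar>w x - c\<bar> powr p)"
  have Jint: "integrable (lebesgue_on ?B) (\<lambda>x. \<bar>w x - c\<bar> powr p)"
    using u0Lp by (simp add: Lp_on_def)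
  have whalf: "(LINT x|lebesgue_on ?B. \<bar>w x\<bar> powr p) = 1 / 2"
  proof -
    have "(\<integral>\<^sup>+x. ennreal (\<bar>v x\<bar> powr p) \<partial>lebesgue_on ?B) =
        2 * (\<integral>\<^sup>+x. (if x \<bullet> e > 0 then ennreal (\<bar>v x\<bar> powr p) else 0) \<partial>lebesgue_on ?B)"
    proof (rule nn_integral_half[OF e S(1)])
      show "AE x in lebesgue_on ?B. ennreal (\<bar>v (mirror e x)\<bar> powr p) = ennreal (\<bar>v x\<bar> powr p)"
        using anti by eventually_elim simp
      have [measurable]: "v \<in> borel_measurable (lebesgue_on ?B)" using vint by simp
      show "(\<lambda>x. ennreal (\<bar>v x\<bar> powr p)) \<in> borel_measurable (lebesgue_on ?B)" by measurable
    qed (rule S(2))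
    also have "(\<integral>\<^sup>+x. (if x \<bullet> e > 0 then ennreal (\<bar>v x\<bar> powr p) else 0) \<partial>lebesgue_on ?B) =
        (\<integral>\<^sup>+x. ennreal (\<bar>w x\<bar> powr p) \<partial>lebesgue_on ?B)"
      using p by (intro nn_integral_cong) (auto simp: w_def)
    also have "\<dots> = ennreal (LINT x|lebesgue_on ?B. \<bar>w x\<bar> powr p)"
      using wLp by (intro nn_integral_eq_integral) (auto simp: Lp_on_def)
    finally have "ennreal (2 * (LINT x|lebesgue_on ?B. \<bar>w x\<bar> powr p)) = ennreal 1"
      using normalized_nn_integral[OF v(2)] p by (simp add: ennreal_mult')
    moreover have "(LINT x|lebesgue_on ?B. \<bar>w x\<bar> powr p) \<ge> 0" by (rule integral_nonneg_AE) simp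
    ultimately have "2 * (LINT x|lebesgue_on ?B. \<bar>w x\<bar> powr p) = 1" by (subst (asm) ennreal_inj) auto
    then show ?thesis by simp
  qed
  have J: "1 / 4 * (9 / 10) powr p \<le> J"
  proof -
    have "1 / 2 = (LINT x|lebesgue_on ?B. \<bar>w x\<bar> powr p)" using whalf by simp
    also have "\<dots> \<le> (LINT x|lebesgue_on ?B. (10 / 9) powr p * \<bar>w x - c\<bar> powr p + (1 / 2) powr p)"
    proof (rule integral_mono)
      show "integrable (lebesgue_on ?B) (\<lambda>x. \<bar>w x\<bar> powr p)" using wLp by (simp add: Lp_on_def)
      show "integrable (lebesgue_on ?B) (\<lambda>x. (10 / 9) powr p * \<bar>w x - c\<bar> powr p + (1 / 2) powr p)"
        using Jint by auto
      fix x
      show "\<bar>w x\<bar> powr p \<le> (10 / 9) powr p * \<bar>w x - c\<bar> powr p + (1 / 2) powr p"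
      proof (cases "\<bar>w x\<bar> \<le> 1 / 2")
        case True
        then have "\<bar>w x\<bar> powr p \<le> (1 / 2) powr p" using p by (intro powr_mono2) auto
        then show ?thesis by (simp add: add_increasing)
      next
        case False
        moreover have "A \<le> 10 / 9 * D" if "\<not> A \<le> 1 / 2" "k \<le> 1 / 20" "A - k \<le> D" for A k D :: real
          using that by simp
        ultimately have "\<bar>w x\<bar> \<le> 10 / 9 * \<bar>w x - c\<bar>" using c abs_triangle_ineq2[of "w x" c] by blast
        then have "\<bar>w x\<bar> powr p \<le> (10 / 9 * \<bar>w x - c\<bar>) powr p" using p by (intro powr_mono2) auto
        also have "\<dots> = (10 / 9) powr p * \<bar>w x - c\<bar> powr p" by (rule powr_mult)
        finally show ?thesis using powr_ge_zero[of "1 / 2" p] by linarith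
      qed
    qed
    also have "\<dots> = (10 / 9) powr p * J + (1 / 2) powr p * m"
      using Jint total by (simp add: J_def)
    finally have "1 / 4 \<le> (10 / 9) powr p * J" using p_large(1) by (simp add: m_def)
    then have "(9 / 10) powr p * (1 / 4) \<le> (9 / 10) powr p * ((10 / 9) powr p * J)"
      by (intro mult_left_mono) auto
    also have "\<dots> = J"
    proof -
      have "(9 / 10) powr p * (10 / 9) powr p = (9 / 10 * (10 / 9)) powr p" by (rule powr_mult[symmetric])
      then have "(9 / 10) powr p * (10 / 9) powr p = (1::real)" by simp
      then show ?thesis by (simp only: mult.assoc[symmetric] mult_1)
    qed
    finally show ?thesis by (simp add: mult.commute)
  qed
  moreover have "1 / 4 * (9 / 10) powr p > (0::real)" by simp
  ultimately have J0: "J > 0" by linarith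
  define t where "t = J powr - (1 / p)"
  have t: "0 < t" "t \<le> 29 / 25"
  proof -
    show "0 < t" using J0 by (simp add: t_def)
    have "t \<le> (1 / 4 * (9 / 10) powr p) powr - (1 / p)"
      unfolding t_def using J p by (intro powr_mono2') auto
    also have "\<dots> = (1 / 4) powr - (1 / p) * ((9 / 10) powr p) powr - (1 / p)"
      by (rule powr_mult)
    also have "((9 / 10 :: real) powr p) powr - (1 / p) = 10 / 9"
      using p by (simp add: powr_powr powr_minus_divide)
    also have "(1 / 4 :: real) powr - (1 / p) = 4 powr (1 / p)"
      using powr_mult[of 4 "1 / 4" "1 / p"] by (simp add: powr_minus_divide field_simps)
    also have "4 powr (1 / p) * (10 / 9) \<le> 26 / 25 * (10 / 9 :: real)" using p_large(2) by (intro mult_right_mono) auto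
    also have "\<dots> \<le> 29 / 25" by simp
    finally show "t \<le> 29 / 25" .
  qed
  define u where "u x = t * (w x - c)" for x
  show ?thesis
  proof (rule that[of u])
    have uw: "has_weak_gradient_on u (\<lambda>x. t *\<^sub>R gw x) ?B"
      unfolding u_def[abs_def] by (rule has_weak_gradient_on_scale_shift[OF open_ball ww])
    have "u \<in> Lp_on q ?B"
      unfolding u_def[abs_def] using Lp_on_scale_shift[OF wLq] q by simp
    then show uW: "u \<in> W1 q ?B"
      unfolding W1_def using uw Lp_on_scaleR[OF gwLq] by auto
    show "u \<in> normalized p ?B"
      unfolding u_def[abs_def] t_def
      by (rule scale_to_normalized[OF u0Lp mean]) (use p J0 in \<open>auto simp: J_def\<close>)
    define F where "F x = ennreal ((norm (g x))\<^sup>2 / (1 + \<bar>v x\<bar>) powr (2 * \<theta>))" for x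
    have [measurable]: "v \<in> borel_measurable (lebesgue_on ?B)" "g \<in> borel_measurable (lebesgue_on ?B)"
      using vint gint by auto
    have F: "F \<in> borel_measurable (lebesgue_on ?B)" unfolding F_def by measurable
    have F_mirror: "AE x in lebesgue_on ?B. F (mirror e x) = F x"
    proof -
      have "AE x in lebesgue_on ?B. g (mirror e x) = - mirror e (g x)"
        by (rule weak_gradient_mirror[OF e S(1) _ vint gint vw anti]) (rule S(2))
      then show ?thesis using anti by eventually_elim (simp add: F_def norm_mirror[OF e])
    qed
    have "energy \<theta> ?B u = (\<integral>\<^sup>+x. ennreal ((norm (t *\<^sub>R gw x))\<^sup>2 / (1 + \<bar>u x\<bar>) powr (2 * \<theta>)) \<partial>lebesgue_on ?B)"
      by (rule energy_eq[OF open_ball uW uw])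
    also have "\<dots> \<le> (\<integral>\<^sup>+x. ennreal (8 / 5) * (if x \<bullet> e > 0 then F x else 0) \<partial>lebesgue_on ?B)"
    proof (rule nn_integral_mono)
      fix x
      show "ennreal ((norm (t *\<^sub>R gw x))\<^sup>2 / (1 + \<bar>u x\<bar>) powr (2 * \<theta>)) \<le> ennreal (8 / 5) * (if x \<bullet> e > 0 then F x else 0)"
      proof (cases "x \<bullet> e > 0")
        case True
        have "ennreal (t\<^sup>2 * (norm (g x))\<^sup>2 / (1 + \<bar>t * (v x - c)\<bar>) powr (2 * \<theta>)) \<le>
            ennreal (8 / 5 * ((norm (g x))\<^sup>2 / (1 + \<bar>v x\<bar>) powr (2 * \<theta>)))"
          by (intro ennreal_leI energy_density_shift_scale \<theta> t c) simp
        also have "\<dots> = ennreal (8 / 5) * F x" unfolding F_def by (rule ennreal_mult') simp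
        finally show ?thesis using True by (simp add: gw_def u_def w_def power_mult_distrib)
      qed (simp add: gw_def)
    qed
    also have "\<dots> = ennreal (8 / 5) * (\<integral>\<^sup>+x. (if x \<bullet> e > 0 then F x else 0) \<partial>lebesgue_on ?B)"
    proof (rule nn_integral_cmult)
      have "(\<lambda>x. F x * indicator ({x. x \<bullet> e > 0} \<inter> space (lebesgue_on ?B)) x) \<in> borel_measurable (lebesgue_on ?B)"
        using half_indicator_measurable[OF e S(1)] F
        by (intro borel_measurable_times_ennreal borel_measurable_indicator) auto
      then show "(\<lambda>x. if x \<bullet> e > 0 then F x else 0) \<in> borel_measurable (lebesgue_on ?B)"
        by (rule measurable_cong[THEN iffD1, rotated]) (auto simp: indicator_def)
    qed
    also have "\<dots> = ennreal (4 / 5) * (2 * (\<integral>\<^sup>+x. (if x \<bullet> e > 0 then F x else 0) \<partial>lebesgue_on ?B))"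
    proof -
      have "ennreal (8 / 5) = ennreal (4 / 5) * 2"
        using ennreal_mult'[of "4 / 5" 2] by simp
      then show ?thesis by (simp only: mult.assoc)
    qed
    also have "2 * (\<integral>\<^sup>+x. (if x \<bullet> e > 0 then F x else 0) \<partial>lebesgue_on ?B) = (\<integral>\<^sup>+x. F x \<partial>lebesgue_on ?B)"
      by (rule nn_integral_half[OF e S(1) _ F F_mirror, symmetric]) (rule S(2))
    also have "\<dots> = energy \<theta> ?B v" by (simp add: energy_def F_def g_def)
    finally show "energy \<theta> ?B u \<le> ennreal (4 / 5) * energy \<theta> ?B v" .
  qed
qed

text \<open>Apply the one-sided competitor to an antisymmetric function whose energy is within a factor \<open>11/10\<close> of
  the infimum, which is positive and finite: \<open>(4/5) (11/10) < 1\<close>.\<close>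

lemma lambda_less_lambda_as:
  fixes r \<theta> q :: real
  assumes r: "r > 0" and \<theta>: "0 < \<theta>" "2 * \<theta> < 1" and q: "q \<ge> 1"
  shows "\<forall>\<^sub>F p in at_top. lambda \<theta> q p (ball 0 r) < lambda_as \<theta> q p (ball 0 r)"
proof -
  let ?B = "ball 0 r :: (real^2) set"
  have dim: "DIM(real^2) = 2" by simp
  have e: "axis 2 1 \<in> (Basis :: (real^2) set)" by (auto simp: Basis_vec_def)
  define m where "m = measure lebesgue ?B"
  have m: "m > 0" using r by (simp add: m_def content_ball_pos)
  obtain C where C: "C > 0" "\<And>p v E. p \<ge> 1 \<Longrightarrow> v \<in> W1 q ?B \<Longrightarrow> v \<in> normalized p ?B \<Longrightarrow>
    energy \<theta> ?B v \<le> ennreal E \<Longrightarrow> E \<ge> 0 \<Longrightarrow> (LINT x|lebesgue_on ?B. \<bar>v x\<bar>)\<^sup>2 \<le> C * E"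
    by (rule L1_bound_on_normalized[OF dim r q, of \<theta>]) (use \<theta> in auto)
  \<comment> \<open>Energies up to \<open>E0\<close> keep \<open>\<integral>\<bar>v\<bar>\<close> below \<open>m / 20\<close>.\<close>
  define E0 where "E0 = (m / 20)\<^sup>2 / C"
  have E0: "E0 > 0" using m C(1) by (simp add: E0_def)
  have "filterlim (\<lambda>p. ln 2 * p) at_top (at_top :: real filter)"
    by (rule filterlim_tendsto_pos_mult_at_top[OF tendsto_const _ filterlim_ident]) simp
  then have "((\<lambda>p. exp (- (ln 2 * p))) \<longlongrightarrow> (0::real)) at_top"
    by (intro filterlim_compose[OF exp_at_bot]) (simp add: filterlim_uminus_at_bot)
  then have "((\<lambda>p. (1 / 2) powr p * m) \<longlongrightarrow> 0 * m) at_top"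
    by (intro tendsto_mult tendsto_const) (simp add: powr_def ln_div mult.commute)
  then have "\<forall>\<^sub>F p in at_top. (1 / 2) powr p * m < 1 / 4" by (intro order_tendstoD(2)) auto
  moreover have "((\<lambda>p. 4 powr (1 / p)) \<longlongrightarrow> 4 powr (0::real)) at_top"
    by (intro tendsto_intros tendsto_divide_0[OF tendsto_const] filterlim_at_top_imp_at_infinity filterlim_ident) auto
  then have "\<forall>\<^sub>F p in at_top. 4 powr (1 / p) < (26 / 25 :: real)" by (intro order_tendstoD(2)) auto
  moreover have "\<forall>\<^sub>F p in at_top. p \<ge> max 1 (4 * \<theta> / (1 - 2 * \<theta>))" by (rule eventually_ge_at_top)
  moreover have "\<forall>\<^sub>F p in at_top. lambda_as \<theta> q p ?B \<le> ennreal (E0 / 2)"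
    using \<theta> E0 by (intro lambda_as_tendsto_0 r q) auto
  ultimately show ?thesis
  proof eventually_elim
    case (elim p)
    then have p: "p \<ge> 1" "4 * \<theta> \<le> (1 - 2 * \<theta>) * p"
      using \<theta> by (auto simp: field_simps)
    obtain \<epsilon> where \<epsilon>: "\<epsilon> > 0" "\<And>v. v \<in> W1 q ?B \<Longrightarrow> v \<in> normalized p ?B \<Longrightarrow> ennreal \<epsilon> \<le> energy \<theta> ?B v"
      by (rule energy_bounded_below_on_normalized[OF dim r q \<theta> p]) auto
    have "ennreal \<epsilon> \<le> lambda_as \<theta> q p ?B"
      unfolding lambda_as_def by (intro INF_greatest \<epsilon>(2)) (auto simp: W1_as_def)
    moreover obtain L where L: "lambda_as \<theta> q p ?B = ennreal L" "L \<ge> 0"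
      using elim by (cases "lambda_as \<theta> q p ?B") (auto simp: top_unique)
    ultimately have L0: "L > 0" using \<epsilon>(1) by (simp add: ennreal_le_iff)
    have LE: "L \<le> E0 / 2" using elim L E0 by (simp add: ennreal_le_iff)
    have "lambda_as \<theta> q p ?B < ennreal (11 / 10 * L)" using L L0 by (simp add: ennreal_less_iff)
    then obtain v where v: "v \<in> W1_as q ?B" "v \<in> normalized p ?B" "energy \<theta> ?B v < ennreal (11 / 10 * L)"
      unfolding lambda_as_def by (auto simp: INF_less_iff)
    have vW: "v \<in> W1 q ?B" and anti: "AE x in lebesgue_on ?B. v (mirror (axis 2 1) x) = - v x"
      using v(1) by (auto simp: W1_as_def mirror_axis_2)
    have "11 / 10 * L \<le> E0" using LE L0 by simp
    then have "energy \<theta> ?B v \<le> ennreal E0"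
      using v(3) by (meson ennreal_leI less_imp_le order_trans)
    then have "(LINT x|lebesgue_on ?B. \<bar>v x\<bar>)\<^sup>2 \<le> C * E0"
      using C(2)[OF p(1) vW v(2)] E0 by simp
    then have "(LINT x|lebesgue_on ?B. \<bar>v x\<bar>)\<^sup>2 \<le> (m / 20)\<^sup>2" using C(1) by (simp add: E0_def)
    then have small: "(LINT x|lebesgue_on ?B. \<bar>v x\<bar>) \<le> m / 20"
      by (rule power2_le_imp_le) (use m in simp)
    obtain u where u: "u \<in> W1 q ?B" "u \<in> normalized p ?B" "energy \<theta> ?B u \<le> ennreal (4 / 5) * energy \<theta> ?B v"
      by (rule one_sided_competitor[OF e r _ _ q p(1) vW v(2) anti small[unfolded m_def], of \<theta>])
         (use \<theta> elim in \<open>auto simp: m_def\<close>)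
    have "lambda \<theta> q p ?B \<le> energy \<theta> ?B u"
      unfolding lambda_def using u by (intro INF_lower) auto
    also have "\<dots> \<le> ennreal (4 / 5) * ennreal (11 / 10 * L)"
      by (rule order_trans[OF u(3)]) (use v(3) in \<open>intro mult_left_mono; simp\<close>)
    also have "\<dots> = ennreal (4 / 5 * (11 / 10 * L))" by (rule ennreal_mult'[symmetric]) simp
    also have "\<dots> < ennreal L" using L0 by (subst ennreal_less_iff) auto
    finally show ?case using L by simp
  qed
qed

theorem theorem6p1:
  fixes r \<theta> q :: real and B :: "(real^2) set"
  assumes "r > 0" and "B = ball 0 r"
    and "0 < 2 * \<theta>" and "2 * \<theta> < 1"
    and "2 * (1 - \<theta>) \<le> q" and "q < 2"
  shows "(\<forall>\<^sub>F p in at_top. lambda \<theta> q p B < lambda_as \<theta> q p B) \<and>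
         (\<forall>\<^sub>F p in at_top. \<forall>v. is_minimizer \<theta> q p B v \<longrightarrow> v \<notin> W1_as q B)"
proof -
  have strict: "\<forall>\<^sub>F p in at_top. lambda \<theta> q p B < lambda_as \<theta> q p B"
    unfolding assms(2) using assms by (intro lambda_less_lambda_as) auto
  moreover have "v \<notin> W1_as q B" if "lambda \<theta> q p B < lambda_as \<theta> q p B" "is_minimizer \<theta> q p B v" for p v
  proof
    assume "v \<in> W1_as q B"
    then have "lambda_as \<theta> q p B \<le> energy \<theta> B v"
      unfolding lambda_as_def using that(2) by (intro INF_lower) (auto simp: is_minimizer_def)
    then show False using that by (simp add: is_minimizer_def)
  qed
  ultimately show ?thesis by (auto elim: eventually_mono)
qed

end
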